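(* Consider a sequence of $m\times n$ grids with $N=mn\to\infty$ and, for each $N$, a vector $\mathbf{Y}$ of $\{0,1\}$-valued responses following the spatial logistic model in the context, with true parameter $\boldsymbol{\beta}_0\in\mathbb{R}^{u+1}$. Assume: (1) there are constants $a\in(0,1]$ and $\rho\in[0,1]$, not depending on $N$, such that $\mathrm{corr}(Y(\mathbf{s}_i),Y(\mathbf{s}_j))=a\rho^{d(\mathbf{s}_i,\mathbf{s}_j)}$ for $i\ne j$, where $d$ is the $L_p$ distance on $\mathbb{R}^2$ with $p\in\{1,2\}$, and the correlation matrix is invertible; (2) for every $k$ there exists $\alpha_k<\frac k2$ such that $\sum c_k(\mathbf{s}_{i_1},\dots,\mathbf{s}_{i_k})=O(N^{\alpha_k})$, the sum being over pairwise distinct $i_1,\dots,i_k\in\{1,\dots,N\}$ and $c_k$ being defined in the context; (3) the matrix $\frac1N\mathbf{D}_{\boldsymbol\beta}\mathbf{U}(\boldsymbol{\beta})$ is negative definite at $\boldsymbol{\beta}=\boldsymbol{\beta}_0$ with probability tending to $1$ as $N\to\infty$. Then the quasi-likelihood estimate $\hat{\boldsymbol{\beta}}=\hat{\boldsymbol{\beta}}_N$, i.e. the root of $\mathbf{U}(\boldsymbol{\beta};\mathbf{Y})=\mathbf{0}$ within a (sufficiently small, fixed) neighbourhood of $\boldsymbol{\beta}_0$, is consistent: $\hat{\boldsymbol{\beta}}_N\to\boldsymbol{\beta}_0$ in probability as $N\to\infty$.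
   Context: Model. The sites $\mathbf{s}_1,\dots,\mathbf{s}_N$, $N=mn$, are the points of an $m\times n$ integer lattice (unit spacing) in $\mathbb{R}^2$. For $\boldsymbol{\beta}=(\beta_0,\dots,\beta_u)^T\in\mathbb{R}^{u+1}$ ($u$ fixed), put $\theta_i(\boldsymbol{\beta})=\exp(\mathbf{t}_i^T\boldsymbol{\beta})/(1+\exp(\mathbf{t}_i^T\boldsymbol{\beta}))$, where $\mathbf{t}_i=(1,t_{i1},\dots,t_{iu})$ is a deterministic covariate vector with $t_{ij}\in\{0,1\}$; the true means are $E(Y(\mathbf{s}_i))=\theta_i(\boldsymbol{\beta}_0)$. Let $\boldsymbol{\Gamma}=(\gamma_{ij})$ be the correlation matrix of $\mathbf{Y}$ ($\gamma_{ii}=1$), which does not depend on $\boldsymbol{\beta}$, let $\boldsymbol{\Sigma}(\boldsymbol{\beta})=\mathrm{diag}(\theta_i(1-\theta_i))$, and let $\mathbf{V}(\boldsymbol{\beta})=\boldsymbol{\Sigma}^{1/2}\boldsymbol{\Gamma}\boldsymbol{\Sigma}^{1/2}$, so that $\mathrm{cov}(\mathbf{Y})=\mathbf{V}(\boldsymbol{\beta}_0)$. Let $\mathbf{P}=\partial\boldsymbol{\theta}/\partial\boldsymbol{\beta}$ be the $N\times(u+1)$ derivative matrix, whose $(i,1)$ entry is $\theta_i(1-\theta_i)$ and whose $(i,j)$ entry is $t_{i,j-1}\theta_i(1-\theta_i)$ for $j=2,\dots,u+1$. The quasi-score function is $$\mathbf{U}(\boldsymbol{\beta})=\mathbf{U}(\boldsymbol{\beta};\mathbf{Y})=\mathbf{P}^T\mathbf{V}^{-1}[\mathbf{Y}-\boldsymbol{\theta}(\boldsymbol{\beta})].$$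 $\mathbf{D}_{\boldsymbol\beta}$ denotes the derivative (Jacobian) with respect to $\boldsymbol{\beta}$. The quasi-likelihood (QL) estimate $\hat{\boldsymbol{\beta}}$ is a solution of $\mathbf{U}(\hat{\boldsymbol{\beta}};\mathbf{Y})=\mathbf{0}$, considered as a root of the quasi-score function within a neighbourhood of the true parameter. Let $\mathbf{Z}=\mathbf{Y}-\boldsymbol{\theta}(\boldsymbol{\beta}_0)$ and $m_k(\mathbf{s}_{i_1},\dots,\mathbf{s}_{i_k})=E[Z(\mathbf{s}_{i_1})\cdots Z(\mathbf{s}_{i_k})]$. For odd $k$, $c_k=m_k$; for even $k$, $$c_k(\mathbf{s}_{i_1},\dots,\mathbf{s}_{i_k})=m_k(\mathbf{s}_{i_1},\dots,\mathbf{s}_{i_k})-\sum m_2(\mathbf{s}_{\omega_1},\mathbf{s}_{\omega_2})\cdots m_2(\mathbf{s}_{\omega_{k-1}},\mathbf{s}_{\omega_k}),$$ the sum being over all partitions of the index positions $\{i_1,\dots,i_k\}$ into $k/2$ disjoint pairs $\{\omega_1,\omega_2\},\dots,\{\omega_{k-1},\omega_k\}$. *)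

theory Defs
  imports "HOL-Probability.Probability" "HOL-Library.Landau_Symbols"
begin

text \<open>
  The sites of an \<open>m \<times> n\<close> unit lattice are the index pairs themselves; the
  coordinates are read as real numbers in the distance.
\<close>

type_synonym site = "nat \<times> nat"

definition grid :: "nat \<Rightarrow> nat \<Rightarrow> site set" where
  "grid m n = {..<m} \<times> {..<n}"

definition Lp_dist :: "real \<Rightarrow> site \<Rightarrow> site \<Rightarrow> real" where
  "Lp_dist p s s' =
     (\<bar>real (fst s) - real (fst s')\<bar> powr p + \<bar>real (snd s) - real (snd s')\<bar> powr p) powr (1 / p)"

text \<open>
  Matrices whose rows and columns are indexed by the sites are functions of two sites, of
  which only the values on \<open>S \<times> S\<close> matter: the number of sites varies along the sequence of
  grids, so it cannot be a type. The inverse is chosen in the style of \<open>matrix_inv\<close>; its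
  values on \<open>S \<times> S\<close> are unique.
\<close>

type_synonym site_matrix = "site \<Rightarrow> site \<Rightarrow> real"

definition inverse_on :: "site set \<Rightarrow> site_matrix \<Rightarrow> site_matrix \<Rightarrow> bool" where
  "inverse_on S A B \<longleftrightarrow>
     (\<forall>i\<in>S. \<forall>k\<in>S. (\<Sum>j\<in>S. A i j * B j k) = (if i = k then 1 else 0)) \<and>
     (\<forall>i\<in>S. \<forall>k\<in>S. (\<Sum>j\<in>S. B i j * A j k) = (if i = k then 1 else 0))"

definition invertible_on :: "site set \<Rightarrow> site_matrix \<Rightarrow> bool" where
  "invertible_on S A \<longleftrightarrow> (\<exists>B. inverse_on S A B)"

definition inv_on :: "site set \<Rightarrow> site_matrix \<Rightarrow> site_matrix" where
  "inv_on S A = (SOME B. inverse_on S A B)"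

definition correlation :: "'w measure \<Rightarrow> ('w \<Rightarrow> real) \<Rightarrow> ('w \<Rightarrow> real) \<Rightarrow> real" where
  "correlation M X Y =
     prob_space.expectation M (\<lambda>\<omega>. (X \<omega> - prob_space.expectation M X) * (Y \<omega> - prob_space.expectation M Y))
     / sqrt (prob_space.variance M X * prob_space.variance M Y)"

text \<open>
  The parameter space \<open>\<real>\<^sup>u\<^sup>+\<^sup>1\<close> is \<open>real ^ 'q\<close>, where one coordinate of \<open>'q\<close> is the intercept;
  \<open>x :: real ^ 'q\<close> stands for a covariate vector \<open>t\<^sub>i\<close> and \<open>t s\<close> for the one at site \<open>s\<close>.
\<close>

definition theta :: "real ^ 'q \<Rightarrow> real ^ 'q \<Rightarrow> real" where
  "theta x \<beta> = exp (x \<bullet> \<beta>) / (1 + exp (x \<bullet> \<beta>))"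

text \<open>A row of \<open>P = \<partial>\<theta>/\<partial>\<beta>\<close>.\<close>

definition theta_row :: "real ^ 'q \<Rightarrow> real ^ 'q \<Rightarrow> real ^ 'q" where
  "theta_row x \<beta> = (theta x \<beta> * (1 - theta x \<beta>)) *\<^sub>R x"

lemma theta_row_is_gradient:
  "(theta x has_derivative (\<lambda>h. theta_row x \<beta> \<bullet> h)) (at \<beta>)"
proof -
  have pos: "1 + exp (x \<bullet> \<beta>) \<noteq> 0"
    using exp_gt_zero[of "x \<bullet> \<beta>"] by linarith
  have logit: "((\<lambda>z::real. exp z / (1 + exp z)) has_real_derivative
      theta x \<beta> * (1 - theta x \<beta>)) (at (x \<bullet> \<beta>))"
    unfolding theta_def using pos
    by (auto intro!: derivative_eq_intros simp: divide_simps algebra_simps power2_eq_square)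
  have "((\<lambda>\<beta>. x \<bullet> \<beta>) has_derivative (\<lambda>h. x \<bullet> h)) (at \<beta>)"
    by (auto intro!: derivative_eq_intros)
  from has_derivative_compose[OF this logit[unfolded has_field_derivative_def]]
  show ?thesis
    by (simp add: theta_def[abs_def] theta_row_def)
qed

definition work_cov :: "(site \<Rightarrow> real ^ 'q) \<Rightarrow> site_matrix \<Rightarrow> real ^ 'q \<Rightarrow> site_matrix" where
  "work_cov t \<Gamma> \<beta> i j =
     sqrt (theta (t i) \<beta> * (1 - theta (t i) \<beta>)) * \<Gamma> i j * sqrt (theta (t j) \<beta> * (1 - theta (t j) \<beta>))"

text \<open>\<open>U(\<beta>; y) = P\<^sup>T V\<^sup>-\<^sup>1 (y - \<theta>(\<beta>))\<close> as a sum over the rows of \<open>P\<close>.\<close>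

definition quasi_score ::
  "site set \<Rightarrow> (site \<Rightarrow> real ^ 'q) \<Rightarrow> site_matrix \<Rightarrow> (site \<Rightarrow> real) \<Rightarrow> real ^ 'q \<Rightarrow> real ^ 'q" where
  "quasi_score S t \<Gamma> y \<beta> =
     (\<Sum>i\<in>S. (\<Sum>j\<in>S. inv_on S (work_cov t \<Gamma> \<beta>) i j * (y j - theta (t j) \<beta>)) *\<^sub>R theta_row (t i) \<beta>)"

text \<open>
  No symmetry is required: the Jacobian of a quasi-score function need not be symmetric.
\<close>

definition negative_definite :: "real ^ 'q ^ 'q \<Rightarrow> bool" where
  "negative_definite A \<longleftrightarrow> (\<forall>v. v \<noteq> 0 \<longrightarrow> v \<bullet> (A *v v) < 0)"

text \<open>
  A tuple of sites is a list. \<open>moment M Z xs B\<close> is the joint moment of \<open>Z\<close> at the sites in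
  the positions \<open>B\<close> of \<open>xs\<close>. The correction for even \<open>k\<close> runs over the partitions of the
  positions into pairs.
\<close>

definition moment :: "'w measure \<Rightarrow> (site \<Rightarrow> 'w \<Rightarrow> real) \<Rightarrow> site list \<Rightarrow> nat set \<Rightarrow> real" where
  "moment M Z xs B = prob_space.expectation M (\<lambda>\<omega>. \<Prod>l\<in>B. Z (xs ! l) \<omega>)"

definition pairings :: "nat \<Rightarrow> nat set set set" where
  "pairings k = {\<pi>. partition_on {..<k} \<pi> \<and> (\<forall>B\<in>\<pi>. card B = 2)}"

definition c_moment :: "'w measure \<Rightarrow> (site \<Rightarrow> 'w \<Rightarrow> real) \<Rightarrow> site list \<Rightarrow> real" where
  "c_moment M Z xs =
     (if odd (length xs) then moment M Z xs {..<length xs}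
      else moment M Z xs {..<length xs} - (\<Sum>\<pi>\<in>pairings (length xs). \<Prod>B\<in>\<pi>. moment M Z xs B))"

definition distinct_tuples :: "site set \<Rightarrow> nat \<Rightarrow> site list set" where
  "distinct_tuples S k = {xs. length xs = k \<and> distinct xs \<and> set xs \<subseteq> S}"

text \<open>The probability space may vary with the index of the sequence.\<close>

definition with_prob_tending_to_1 :: "(nat \<Rightarrow> 'w measure) \<Rightarrow> (nat \<Rightarrow> 'w \<Rightarrow> bool) \<Rightarrow> bool" where
  "with_prob_tending_to_1 M Q \<longleftrightarrow>
     (\<lambda>r. measure (M r) {\<omega> \<in> space (M r). Q r \<omega>}) \<longlonglongrightarrow> 1"

definition tendsto_in_prob ::
  "(nat \<Rightarrow> 'w measure) \<Rightarrow> (nat \<Rightarrow> 'w \<Rightarrow> 'b::metric_space) \<Rightarrow> 'b \<Rightarrow> bool" where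
  "tendsto_in_prob M X c \<longleftrightarrow>
     (\<forall>\<epsilon>>0. (\<lambda>r. measure (M r) {\<omega> \<in> space (M r). dist (X r \<omega>) c > \<epsilon>}) \<longlonglongrightarrow> 0)"

end

theory Submission
  imports Defs "HOL-Combinatorics.Permutations"
begin

text \<open>The root is random, so a law of large numbers at one fixed \<open>\<beta>\<close> does
  not control the score there, and negative definiteness at \<open>\<beta>\<^sub>0\<close> comes
  without a constant uniform in the grid, so no inverse function argument starts from it. The way
  round is that \<open>G\<close> does not depend on \<open>\<beta>\<close>: the parameter enters the
  score only through scalar weights that depend on a site through its pattern. Grouped by pattern,
  the sums release these weights, and the remaining noise sums are free of \<open>\<beta>\<close>.

  Invertibility of each single correlation matrix gives no bound along the sequence, hence the
  explicit coercivity constant. It yields two different things: coercivity of \<open>G\<close>,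
  through the norm of \<Gamma>, and bounded absolute row sums of \<open>G\<close>, through the decay
  of the entries. The row sums matter because \<open>w \<bullet> U \<beta>\<^sub>0\<close> has to be
  bounded pointwise, independently of the grid, although every site contributes noise to it; a
  spectral bound on \<open>G\<close> would only control mean squares.\<close>

text \<open>
  With \<open>G = \<Gamma>\<^sup>-\<^sup>1\<close> and \<open>\<sigma>\<^sub>i = sqrt (\<theta>\<^sub>i (1 - \<theta>\<^sub>i))\<close> the score is
  \<open>U \<beta> = (\<Sum>i k. \<sigma>\<^sub>i * G i k * (y\<^sub>k - \<theta>\<^sub>k) / \<sigma>\<^sub>k *\<^sub>R t\<^sub>i)\<close>. The moment condition excludes \<open>\<rho> = 1\<close>; for
  \<open>\<rho> < 1\<close> the kernel \<open>a * \<rho> powr d\<close> is a mixture of Gaussian kernels, hence coercive uniformly in the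
  grid, and the row sums of \<open>G\<close> are uniformly bounded.

  Testing \<open>U \<beta> = 0\<close> against \<open>v = \<beta> - \<beta>\<^sub>0\<close> makes the linear part a coercive form in \<open>t\<^sub>i \<bullet> v\<close> that
  dominates the linearisation error for \<open>\<beta>\<close> near \<open>\<beta>\<^sub>0\<close>. As there are finitely many covariate patterns
  \<open>x\<close>, the noise splits into finitely many sums of variance \<open>O(n\<^sub>x)\<close>, where \<open>n\<^sub>x\<close> is the number of
  sites with pattern \<open>x\<close>; so \<open>n\<^sub>x * (x \<bullet> v)\<^sup>2\<close> is bounded in probability. If for every \<open>K\<close> the
  patterns with \<open>n\<^sub>x \<ge> K\<close> eventually span, then \<open>v\<close> tends to \<open>0\<close>.

  Otherwise some \<open>w \<noteq> 0\<close> is orthogonal, for infinitely many grids, to all patterns with \<open>n\<^sub>x \<ge> K\<close>,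
  but by negative definiteness not to all patterns. Then \<open>w \<bullet> U \<beta>\<^sub>0\<close> is a bounded random variable
  with variance bounded below, whereas a root in a small ball would make it uniformly small: such roots
  do not exist with probability tending to \<open>1\<close>.
\<close>

section \<open>Exponential kernels as mixtures of Gaussian kernels\<close>

text \<open>\<open>E\<close> is \<open>sqrt pi / 2\<close> times the error function: the limit at
  infinity is the Gaussian integral over the half-line, and the other limit follows as
  \<open>E\<close> is odd.\<close>

lemma gaussian_antiderivative:
  obtains E :: "real \<Rightarrow> real" where
    "\<And>x. (E has_real_derivative exp (- x\<^sup>2)) (at x)"
    "E 0 = 0" "(E \<longlongrightarrow> sqrt pi / 2) at_top" "(E \<longlongrightarrow> - (sqrt pi / 2)) at_bot"
proof -
  have "\<exists>F. \<forall>x::real. - \<infinity> < ereal x \<longrightarrow> ereal x < \<infinity> \<longrightarrow> (F has_vector_derivative exp (- x\<^sup>2)) (at x)"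
    by (rule einterval_antiderivative) (auto intro!: continuous_intros)
  then obtain F :: "real \<Rightarrow> real" where F: "\<And>x. (F has_real_derivative exp (- x\<^sup>2)) (at x)"
    by (auto simp: has_real_derivative_iff_has_vector_derivative)
  define E where "E x = F x - F 0" for x
  have E: "(E has_real_derivative exp (- x\<^sup>2)) (at x)" for x
    unfolding E_def by (auto intro!: derivative_eq_intros F)
  have odd: "E (- x) = - E x" for x
  proof -
    have "((\<lambda>x. E x + E (- x)) has_real_derivative 0) (at x)" for x
    proof -
      have "((\<lambda>x. E (- x)) has_real_derivative exp (- x\<^sup>2) * (- 1)) (at x)"
        by (rule DERIV_chain2[where f = E and g = uminus, OF _ DERIV_minus[OF DERIV_ident]])
          (use E[of "- x"] in simp)
      then show ?thesis using DERIV_add[OF E[of x]] by fastforce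
    qed
    then have "E x + E (- x) = E 0 + E (- 0)"
      by (intro DERIV_isconst_all) auto
    then show ?thesis by (simp add: E_def)
  qed
  have top: "(E \<longlongrightarrow> sqrt pi / 2) at_top"
  proof -
    have g: "integrable lborel (\<lambda>x::real. indicator {0..} x *\<^sub>R exp (- x\<^sup>2))"
      and i: "integral\<^sup>L lborel (\<lambda>x::real. indicator {0..} x *\<^sub>R exp (- x\<^sup>2)) = sqrt pi / 2"
      using gaussian_moment_0 by (auto simp: has_bochner_integral_iff)
    have "((\<lambda>y. \<integral>x. indicator {..y} x *\<^sub>R (indicator {0..} x *\<^sub>R exp (- x\<^sup>2)) \<partial>lborel) \<longlongrightarrow> sqrt pi / 2) at_top"
      using tendsto_integral_at_top[OF _ g] unfolding i by simp
    moreover have "\<forall>\<^sub>F y in at_top. (\<integral>x. indicator {..y} x *\<^sub>R (indicator {0..} x *\<^sub>R exp (- x\<^sup>2)) \<partial>lborel) = E y"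
      using eventually_ge_at_top[of 0]
    proof eventually_elim
      case (elim y)
      have "has_bochner_integral lborel (\<lambda>x. indicator {0..y} x *\<^sub>R exp (- x\<^sup>2)) (E y - E 0)"
        using elim E
        by (intro has_bochner_integral_FTC_Icc)
           (auto intro!: continuous_intros simp: has_real_derivative_iff_has_vector_derivative[symmetric]
              intro: has_field_derivative_at_within)
      moreover have "(\<lambda>x. indicator {..y} x *\<^sub>R (indicator {0..} x *\<^sub>R exp (- x\<^sup>2)))
          = (\<lambda>x::real. indicator {0..y} x *\<^sub>R exp (- x\<^sup>2))"
        by (auto simp: indicator_def)
      ultimately show ?case
        by (simp add: has_bochner_integral_iff E_def)
    qed
    ultimately show ?thesis by (rule Lim_transform_eventually)
  qed
  have "((\<lambda>x. - E (- x)) \<longlongrightarrow> - (sqrt pi / 2)) at_bot"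
    by (intro tendsto_minus filterlim_compose[OF top] filterlim_uminus_at_top_at_bot)
  then have bot: "(E \<longlongrightarrow> - (sqrt pi / 2)) at_bot" by (simp add: odd)
  show ?thesis by (rule that[OF E _ top bot]) (simp add: E_def)
qed

text \<open>
  The integrand has the antiderivative
  \<open>(e\<^sup>b E (x + b / 2x) + e\<^sup>-\<^sup>b E (x - b / 2x)) / 2\<close>, where \<open>E' x = exp (- x\<^sup>2)\<close>.
\<close>

lemma exp_neg_gaussian_mixture:
  fixes b :: real
  assumes "0 \<le> b"
  shows "has_bochner_integral lborel
    (\<lambda>x. indicator {0<..} x * (2 / sqrt pi * exp (- x\<^sup>2) * exp (- b\<^sup>2 / (4 * x\<^sup>2)))) (exp (- b))"
proof -
  obtain E :: "real \<Rightarrow> real" where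
    E: "\<And>x. (E has_real_derivative exp (- x\<^sup>2)) (at x)"
    and E0: "E 0 = 0" and top: "(E \<longlongrightarrow> sqrt pi / 2) at_top" and bot: "(E \<longlongrightarrow> - (sqrt pi / 2)) at_bot"
    using gaussian_antiderivative by blast
  define F where "F x = (exp b * E (x + b / (2 * x)) + exp (- b) * E (x - b / (2 * x))) / sqrt pi" for x
  define f where "f x = 2 / sqrt pi * exp (- x\<^sup>2) * exp (- b\<^sup>2 / (4 * x\<^sup>2))" for x :: real
  have F: "(F has_real_derivative f x) (at x)" if "x > 0" for x
  proof -
    have 1: "((\<lambda>x. E (x + b / (2 * x))) has_real_derivative
        exp (- (x + b / (2 * x))\<^sup>2) * (1 - b / (2 * x\<^sup>2))) (at x)"
      by (rule DERIV_chain2[OF E])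
        (use that in \<open>auto intro!: derivative_eq_intros simp: field_simps power2_eq_square\<close>)
    have 2: "((\<lambda>x. E (x - b / (2 * x))) has_real_derivative
        exp (- (x - b / (2 * x))\<^sup>2) * (1 + b / (2 * x\<^sup>2))) (at x)"
      by (rule DERIV_chain2[OF E])
        (use that in \<open>auto intro!: derivative_eq_intros simp: field_simps power2_eq_square\<close>)
    \<comment> \<open>Completing the square: \<open>(x + b / 2x)\<^sup>2 = x\<^sup>2 + b + b\<^sup>2
      / 4x\<^sup>2\<close>, and \<open>exp b\<close> cancels the middle term; likewise with
      \<open>- b\<close> below. The inner derivatives \<open>1 - b / 2x\<^sup>2\<close> and
      \<open>1 + b / 2x\<^sup>2\<close> then add up to \<open>2\<close>.\<close>
    have e1: "exp b * exp (- (x + b / (2 * x))\<^sup>2) = exp (- x\<^sup>2) * exp (- b\<^sup>2 / (4 * x\<^sup>2))"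
      using that by (simp add: exp_add[symmetric] power2_eq_square field_simps)
    have e2: "exp (- b) * exp (- (x - b / (2 * x))\<^sup>2) = exp (- x\<^sup>2) * exp (- b\<^sup>2 / (4 * x\<^sup>2))"
      using that by (simp add: exp_add[symmetric] power2_eq_square field_simps)
    have "(F has_real_derivative
       (exp b * (exp (- (x + b / (2 * x))\<^sup>2) * (1 - b / (2 * x\<^sup>2)))
        + exp (- b) * (exp (- (x - b / (2 * x))\<^sup>2) * (1 + b / (2 * x\<^sup>2)))) / sqrt pi) (at x)"
      unfolding F_def by (intro DERIV_cdivide DERIV_add DERIV_cmult 1 2)
    also have "exp b * (exp (- (x + b / (2 * x))\<^sup>2) * (1 - b / (2 * x\<^sup>2)))
        + exp (- b) * (exp (- (x - b / (2 * x))\<^sup>2) * (1 + b / (2 * x\<^sup>2)))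
        = exp (- x\<^sup>2) * exp (- b\<^sup>2 / (4 * x\<^sup>2)) * (1 - b / (2 * x\<^sup>2))
        + exp (- x\<^sup>2) * exp (- b\<^sup>2 / (4 * x\<^sup>2)) * (1 + b / (2 * x\<^sup>2))"
      by (simp only: mult.assoc[symmetric] e1 e2)
    also have "\<dots> / sqrt pi = f x" by (simp add: f_def algebra_simps)
    finally show ?thesis .
  qed
  \<comment> \<open>The limit at \<open>0\<close> from the right. For \<open>b > 0\<close> the two
    arguments of \<open>E\<close> diverge to plus and minus infinity, for \<open>b = 0\<close> they
    tend to \<open>0\<close>, so the limits need separate arguments.\<close>
  define A where "A = (if b = 0 then 0 else (exp b - exp (- b)) / 2)"
  have lim0: "(F \<longlongrightarrow> A) (at_right 0)"
  proof (cases "b = 0")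
    case True
    have "isCont E 0" using E DERIV_isCont by blast
    then have "(E \<longlongrightarrow> 0) (at_right 0)"
      by (metis E0 isCont_def tendsto_within_subset subset_UNIV)
    then have "((\<lambda>x. (E x + E x) / sqrt pi) \<longlongrightarrow> (0 + 0) / sqrt pi) (at_right 0)"
      by (intro tendsto_intros) auto
    then show ?thesis using True by (simp add: F_def[abs_def] A_def)
  next
    case False
    then have b: "b > 0" using assms by simp
    have inv: "filterlim (\<lambda>x. b / (2 * x)) at_top (at_right (0::real))"
    proof -
      have "filterlim (\<lambda>x. (b / 2) * inverse x) at_top (at_right (0::real))"
        using b by (intro filterlim_tendsto_pos_mult_at_top[OF tendsto_const]) (auto intro: filterlim_inverse_at_top_right)
      then show ?thesis by (simp add: field_simps)
    qed
    have id: "((\<lambda>x::real. x) \<longlongrightarrow> 0) (at_right 0)" by (rule tendsto_ident_at)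
    have p: "filterlim (\<lambda>x. x + b / (2 * x)) at_top (at_right 0)"
      by (rule filterlim_tendsto_add_at_top[OF id inv])
    have "filterlim (\<lambda>x. - x + b / (2 * x)) at_top (at_right 0)"
      using tendsto_minus[OF id] by (intro filterlim_tendsto_add_at_top[OF _ inv]) simp
    then have q: "filterlim (\<lambda>x. x - b / (2 * x)) at_bot (at_right 0)"
      by (simp add: filterlim_uminus_at_top)
    have "(F \<longlongrightarrow> (exp b * (sqrt pi / 2) + exp (- b) * (- (sqrt pi / 2))) / sqrt pi) (at_right 0)"
      unfolding F_def[abs_def]
      by (intro tendsto_intros filterlim_compose[OF top p] filterlim_compose[OF bot q]) auto
    moreover have "(exp b * (sqrt pi / 2) + exp (- b) * (- (sqrt pi / 2))) / sqrt pi = A"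
      using b by (simp add: A_def field_simps)
    ultimately show ?thesis by simp
  qed
  have limt: "(F \<longlongrightarrow> (exp b + exp (- b)) / 2) at_top"
  proof -
    have "((\<lambda>x. (b / 2) * inverse x) \<longlongrightarrow> (b / 2) * 0) (at_top :: real filter)"
      by (intro tendsto_intros tendsto_inverse_0_at_top filterlim_ident)
    then have z: "((\<lambda>x. b / (2 * x)) \<longlongrightarrow> 0) (at_top :: real filter)"
      by (simp add: field_simps)
    have p: "filterlim (\<lambda>x. x + b / (2 * x)) at_top at_top"
      using filterlim_tendsto_add_at_top[OF z filterlim_ident] by (simp add: add.commute)
    have q: "filterlim (\<lambda>x. x - b / (2 * x)) at_top at_top"
      using filterlim_tendsto_add_at_top[OF tendsto_minus[OF z] filterlim_ident] by (simp add: add.commute)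
    have "(F \<longlongrightarrow> (exp b * (sqrt pi / 2) + exp (- b) * (sqrt pi / 2)) / sqrt pi) at_top"
      unfolding F_def[abs_def]
      by (intro tendsto_intros filterlim_compose[OF top p] filterlim_compose[OF top q]) auto
    moreover have "(exp b * (sqrt pi / 2) + exp (- b) * (sqrt pi / 2)) / sqrt pi = (exp b + exp (- b)) / 2"
      by (simp add: field_simps)
    ultimately show ?thesis by metis
  qed
  have "set_integrable lborel (einterval 0 \<infinity>) f \<and> (LBINT x=0..\<infinity>. f x) = (exp b + exp (- b)) / 2 - A"
  proof (rule conjI)
    have c: "isCont f x" if "x > 0" for x
      unfolding f_def[abs_def] using that by (intro continuous_intros) auto
    have lims: "((F \<circ> real_of_ereal) \<longlongrightarrow> A) (at_right 0)"
        "((F \<circ> real_of_ereal) \<longlongrightarrow> (exp b + exp (- b)) / 2) (at_left \<infinity>)"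
      using lim0 limt by (auto simp: zero_ereal_def ereal_tendsto_simps)
    show "set_integrable lborel (einterval 0 \<infinity>) f" "(LBINT x=0..\<infinity>. f x) = (exp b + exp (- b)) / 2 - A"
      using interval_integral_FTC_nonneg[of 0 \<infinity> F f, OF _ _ _ _ lims] F c
      by (auto simp: zero_ereal_def f_def)
  qed
  moreover have "(exp b + exp (- b)) / 2 - A = exp (- b)"
    by (auto simp: A_def field_simps)
  moreover have "einterval 0 \<infinity> = {0<..}" by (auto simp: einterval_def)
  ultimately show ?thesis
    unfolding has_bochner_integral_iff f_def
    by (simp add: set_integrable_def interval_lebesgue_integral_def set_lebesgue_integral_def)
qed

text \<open>Expanding the exponential, the term of order \<open>n\<close> is
  \<open>c ^ n / fact n\<close> times the form of \<open>K\<close> at \<open>h i * f i ^ n\<close>,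
  hence nonnegative.\<close>

lemma exp_mult_nonneg_form:
  fixes K :: "'i \<Rightarrow> 'i \<Rightarrow> real" and f :: "'i \<Rightarrow> real"
  assumes c: "0 \<le> c"
    and K: "\<And>h. 0 \<le> (\<Sum>i\<in>S. \<Sum>j\<in>S. h i * h j * K i j)"
  shows "0 \<le> (\<Sum>i\<in>S. \<Sum>j\<in>S. h i * h j * (K i j * exp (c * (f i * f j))))"
proof -
  have s: "(\<lambda>n. \<Sum>i\<in>S. \<Sum>j\<in>S. h i * h j * K i j * ((c * (f i * f j)) ^ n /\<^sub>R fact n)) sums
      (\<Sum>i\<in>S. \<Sum>j\<in>S. h i * h j * K i j * exp (c * (f i * f j)))"
    by (intro sums_sum sums_mult exp_converges)
  have "0 \<le> (\<Sum>i\<in>S. \<Sum>j\<in>S. h i * h j * K i j * ((c * (f i * f j)) ^ n /\<^sub>R fact n))" for n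
  proof -
    have "(\<Sum>i\<in>S. \<Sum>j\<in>S. h i * h j * K i j * ((c * (f i * f j)) ^ n /\<^sub>R fact n))
      = c ^ n / fact n * (\<Sum>i\<in>S. \<Sum>j\<in>S. (h i * f i ^ n) * (h j * f j ^ n) * K i j)"
      by (simp add: sum_distrib_left power_mult_distrib field_simps)
    then show ?thesis using K[of "\<lambda>i. h i * f i ^ n"] c by simp
  qed
  then have "0 \<le> (\<Sum>i\<in>S. \<Sum>j\<in>S. h i * h j * K i j * exp (c * (f i * f j)))"
    using sums_le[OF _ sums_zero s] by blast
  then show ?thesis by (simp add: mult.assoc)
qed

text \<open>In \<open>(f i - f j)\<^sup>2\<close> the two pure squares are absorbed into
  \<open>h\<close>; the cross term is the kernel \<open>exp (2 * c * (f i * f j))\<close>.\<close>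

lemma gaussian_mult_nonneg_form:
  fixes K :: "'i \<Rightarrow> 'i \<Rightarrow> real" and f :: "'i \<Rightarrow> real"
  assumes c: "0 \<le> c"
    and K: "\<And>h. 0 \<le> (\<Sum>i\<in>S. \<Sum>j\<in>S. h i * h j * K i j)"
  shows "0 \<le> (\<Sum>i\<in>S. \<Sum>j\<in>S. h i * h j * (K i j * exp (- c * (f i - f j)\<^sup>2)))"
proof -
  define g where "g i = h i * exp (- c * (f i)\<^sup>2)" for i
  have "exp (- c * (f i - f j)\<^sup>2) = exp (- c * (f i)\<^sup>2) * exp (- c * (f j)\<^sup>2) * exp (2 * c * (f i * f j))" for i j
    by (simp add: exp_add[symmetric] power2_eq_square algebra_simps)
  then have "(\<Sum>i\<in>S. \<Sum>j\<in>S. h i * h j * (K i j * exp (- c * (f i - f j)\<^sup>2)))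
    = (\<Sum>i\<in>S. \<Sum>j\<in>S. g i * g j * (K i j * exp (2 * c * (f i * f j))))"
    by (simp add: g_def mult_ac)
  also have "0 \<le> \<dots>" using exp_mult_nonneg_form[OF _ K, of "2 * c"] c by simp
  finally show ?thesis .
qed

text \<open>
  The mixture weights Gaussian kernels of precision \<open>c\<^sup>2 / 4x\<^sup>2\<close>; the ones with
  \<open>x \<le> c / sqrt (4 * u\<^sub>0)\<close> have precision at least \<open>u\<^sub>0\<close> and carry a positive mass.
\<close>

lemma exp_mixture_coercive:
  fixes c u\<^sub>0 :: real
  assumes c: "0 < c" and u0: "0 < u\<^sub>0"
  obtains \<mu> where "0 < \<mu>"
    "\<And>(S :: 'i set) h K D \<kappa>. \<lbrakk>finite S; 0 \<le> \<kappa>;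
      \<And>i j. i \<in> S \<Longrightarrow> j \<in> S \<Longrightarrow> 0 \<le> D i j;
      \<And>u. 0 < u \<Longrightarrow> 0 \<le> (\<Sum>i\<in>S. \<Sum>j\<in>S. h i * h j * (K i j * exp (- u * (D i j)\<^sup>2)));
      \<And>u. u\<^sub>0 \<le> u \<Longrightarrow> \<kappa> \<le> (\<Sum>i\<in>S. \<Sum>j\<in>S. h i * h j * (K i j * exp (- u * (D i j)\<^sup>2)))\<rbrakk>
     \<Longrightarrow> \<kappa> * \<mu> \<le> (\<Sum>i\<in>S. \<Sum>j\<in>S. h i * h j * (K i j * exp (- c * D i j)))"
proof -
  define x0 where "x0 = c / sqrt (4 * u\<^sub>0)"
  have x0: "x0 > 0" using c u0 by (simp add: x0_def)
  define w where "w x = indicator {0<..} x * (2 / sqrt pi * exp (- x\<^sup>2))" for x :: real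
  have w0: "0 \<le> w x" for x by (simp add: w_def)
  have intw: "integrable lborel w"
  proof -
    have "integrable lborel (\<lambda>x. indicator {0<..} x * (2 / sqrt pi * exp (- x\<^sup>2) * exp (- 0\<^sup>2 / (4 * x\<^sup>2))))"
      using exp_neg_gaussian_mixture[of 0] by (auto simp: has_bochner_integral_iff)
    then show ?thesis by (simp add: w_def[abs_def])
  qed
  define \<mu> where "\<mu> = (\<integral>x. indicator {..x0} x * w x \<partial>lborel)"
  have intw': "integrable lborel (\<lambda>x. indicator {..x0} x * w x)"
    using integrable_mult_indicator[OF _ intw, of "{..x0}"] by simp
  \<comment> \<open>On \<open>{0<..x0}\<close> the mixing density is at least its value at
    \<open>x0\<close>.\<close>
  have "\<mu> \<ge> x0 * (2 / sqrt pi * exp (- x0\<^sup>2))"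
  proof -
    have "(\<integral>x. indicator {0<..x0} x * (2 / sqrt pi * exp (- x0\<^sup>2)) \<partial>lborel) \<le> \<mu>"
      unfolding \<mu>_def
    proof (rule integral_mono[OF _ intw'])
      show "integrable lborel (\<lambda>x. indicator {0<..x0} x * (2 / sqrt pi * exp (- x0\<^sup>2)))"
        using x0 by (intro integrable_mult_left integrable_real_indicator) auto
      fix x :: real
      show "indicator {0<..x0} x * (2 / sqrt pi * exp (- x0\<^sup>2)) \<le> indicator {..x0} x * w x"
        using x0 by (auto simp: indicator_def w_def intro!: divide_right_mono power_mono)
    qed
    then show ?thesis using x0 by simp
  qed
  moreover have "x0 * (2 / sqrt pi * exp (- x0\<^sup>2)) > 0" using x0 by simp
  ultimately have mu: "0 < \<mu>" by linarith
  show ?thesis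
  proof (rule that[OF mu])
    fix S :: "'i set" and h K D \<kappa>
    assume fin: "finite S" and \<kappa>: "(0::real) \<le> \<kappa>"
      and D: "\<And>i j. i \<in> S \<Longrightarrow> j \<in> S \<Longrightarrow> (0::real) \<le> D i j"
      and nn: "\<And>u. 0 < u \<Longrightarrow> 0 \<le> (\<Sum>i\<in>S. \<Sum>j\<in>S. h i * h j * (K i j * exp (- u * (D i j)\<^sup>2)))"
      and lb: "\<And>u. u\<^sub>0 \<le> u \<Longrightarrow> \<kappa> \<le> (\<Sum>i\<in>S. \<Sum>j\<in>S. h i * h j * (K i j * exp (- u * (D i j)\<^sup>2)))"
    define q where "q u = (\<Sum>i\<in>S. \<Sum>j\<in>S. h i * h j * (K i j * exp (- u * (D i j)\<^sup>2)))" for u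
    \<comment> \<open>The mixture is used at \<open>b = c * D i j\<close>, which turns the parameter
      \<open>x\<close> into the precision \<open>c\<^sup>2 / (4 * x\<^sup>2)\<close>.\<close>
    have eq: "exp (- (c * D i j)\<^sup>2 / (4 * x\<^sup>2)) = exp (- (c\<^sup>2 / (4 * x\<^sup>2)) * (D i j)\<^sup>2)" for i j x
      by (simp add: power_mult_distrib)
    have "has_bochner_integral lborel
       (\<lambda>x. \<Sum>i\<in>S. \<Sum>j\<in>S. h i * h j * K i j * (indicator {0<..} x * (2 / sqrt pi * exp (- x\<^sup>2) * exp (- (c * D i j)\<^sup>2 / (4 * x\<^sup>2)))))
       (\<Sum>i\<in>S. \<Sum>j\<in>S. h i * h j * K i j * exp (- (c * D i j)))"
      using c D by (intro has_bochner_integral_sum has_bochner_integral_mult_right exp_neg_gaussian_mixture) auto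
    moreover have "(\<lambda>x. \<Sum>i\<in>S. \<Sum>j\<in>S. h i * h j * K i j * (indicator {0<..} x * (2 / sqrt pi * exp (- x\<^sup>2) * exp (- (c * D i j)\<^sup>2 / (4 * x\<^sup>2)))))
       = (\<lambda>x. w x * q (c\<^sup>2 / (4 * x\<^sup>2)))"
      unfolding eq by (auto simp: w_def q_def sum_distrib_left mult_ac intro!: ext sum.cong)
    moreover have "(\<Sum>i\<in>S. \<Sum>j\<in>S. h i * h j * K i j * exp (- (c * D i j)))
        = (\<Sum>i\<in>S. \<Sum>j\<in>S. h i * h j * (K i j * exp (- c * D i j)))"
      by (simp add: mult.assoc)
    ultimately have I: "has_bochner_integral lborel (\<lambda>x. w x * q (c\<^sup>2 / (4 * x\<^sup>2)))
        (\<Sum>i\<in>S. \<Sum>j\<in>S. h i * h j * (K i j * exp (- c * D i j)))" by simp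
    have "(\<integral>x. \<kappa> * (indicator {..x0} x * w x) \<partial>lborel) \<le> (\<integral>x. w x * q (c\<^sup>2 / (4 * x\<^sup>2)) \<partial>lborel)"
    proof (rule integral_mono)
      show "integrable lborel (\<lambda>x. \<kappa> * (indicator {..x0} x * w x))"
        using intw' by simp
      show "integrable lborel (\<lambda>x. w x * q (c\<^sup>2 / (4 * x\<^sup>2)))"
        using I by (simp add: has_bochner_integral_iff)
      fix x :: real
      show "\<kappa> * (indicator {..x0} x * w x) \<le> w x * q (c\<^sup>2 / (4 * x\<^sup>2))"
      proof (cases "x > 0")
        case False then show ?thesis by (simp add: w_def)
      next
        case True
        then have "0 \<le> q (c\<^sup>2 / (4 * x\<^sup>2))" unfolding q_def using c by (intro nn) simp
        moreover have "\<kappa> \<le> q (c\<^sup>2 / (4 * x\<^sup>2))" if "x \<le> x0"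
        proof -
          have "x\<^sup>2 \<le> x0\<^sup>2" using that True by (intro power_mono) auto
          also have "x0\<^sup>2 = c\<^sup>2 / (4 * u\<^sub>0)" using u0 by (simp add: x0_def power_divide)
          finally have "u\<^sub>0 \<le> c\<^sup>2 / (4 * x\<^sup>2)" using True u0 by (simp add: field_simps)
          then show ?thesis unfolding q_def by (rule lb)
        qed
        ultimately show ?thesis using w0[of x]
          by (auto simp: indicator_def mult.commute[of \<kappa>] intro!: mult_left_mono)
      qed
    qed
    then show "\<kappa> * \<mu> \<le> (\<Sum>i\<in>S. \<Sum>j\<in>S. h i * h j * (K i j * exp (- c * D i j)))"
      using I by (simp add: \<mu>_def has_bochner_integral_iff)
  qed
qed

section \<open>Coercivity and inverses of exponentially decaying matrices\<close>

text \<open>The \<open>L\<^sub>1\<close> distance as a natural number, so that it can be an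
  exponent; decay is measured in it for both values of \<open>p\<close>.\<close>

definition grid_dist :: "site \<Rightarrow> site \<Rightarrow> nat" where
  "grid_dist i j = nat \<bar>int (fst i) - int (fst j)\<bar> + nat \<bar>int (snd i) - int (snd j)\<bar>"

lemma grid_dist_commute: "grid_dist i j = grid_dist j i"
  unfolding grid_dist_def by (subst (1 2) abs_minus_commute) (rule refl)

lemma grid_dist_self [simp]: "grid_dist i i = 0"
  by (simp add: grid_dist_def)

lemma grid_dist_pos: "i \<noteq> j \<Longrightarrow> 1 \<le> grid_dist i j"
  by (cases i; cases j) (auto simp: grid_dist_def)

lemma grid_dist_triangle: "grid_dist i k \<le> grid_dist i j + grid_dist j k"
proof -
  have "nat \<bar>int a - int c\<bar> \<le> nat \<bar>int a - int b\<bar> + nat \<bar>int b - int c\<bar>" for a b c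
    by linarith
  from add_mono[OF this[where a = "fst i" and b = "fst j" and c = "fst k"]
      this[where a = "snd i" and b = "snd j" and c = "snd k"]] show ?thesis
    by (simp add: grid_dist_def)
qed

section \<open>Geometric sums over the lattice\<close>

lemma sum_geometric_bound:
  fixes q :: real
  assumes "finite A" "0 \<le> q" "q < 1"
  shows "(\<Sum>n\<in>A. q ^ n) \<le> 1 / (1 - q)"
  using sum_le_suminf[OF summable_geometric[of q] assms(1)] assms
  by (simp add: suminf_geometric)

lemma sum_geometric_two_sided_bound:
  fixes q :: real
  assumes B: "finite B" and q: "0 \<le> q" "q < 1"
  shows "(\<Sum>b\<in>B. q ^ nat \<bar>int a - int b\<bar>) \<le> 2 / (1 - q)"
proof -
  have "(\<Sum>b\<in>B. q ^ nat \<bar>int a - int b\<bar>)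
     = (\<Sum>b\<in>B \<inter> {..a}. q ^ nat \<bar>int a - int b\<bar>) + (\<Sum>b\<in>B - {..a}. q ^ nat \<bar>int a - int b\<bar>)"
    using B by (rule sum.Int_Diff)
  also have "(\<Sum>b\<in>B \<inter> {..a}. q ^ nat \<bar>int a - int b\<bar>) = (\<Sum>n\<in>(\<lambda>b. a - b) ` (B \<inter> {..a}). q ^ n)"
    by (subst sum.reindex) (auto simp: inj_on_def intro!: sum.cong arg_cong[of _ _ "\<lambda>n. q ^ n"])
  also have "\<dots> \<le> 1 / (1 - q)" using B q by (intro sum_geometric_bound) auto
  also have "(\<Sum>b\<in>B - {..a}. q ^ nat \<bar>int a - int b\<bar>) = (\<Sum>n\<in>(\<lambda>b. b - a) ` (B - {..a}). q ^ n)"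
    by (subst sum.reindex) (auto simp: inj_on_def intro!: sum.cong arg_cong[of _ _ "\<lambda>n. q ^ n"])
  also have "\<dots> \<le> 1 / (1 - q)" using B q by (intro sum_geometric_bound) auto
  finally show ?thesis by simp
qed

text \<open>Over the product of the two projections of \<open>S\<close> the sum factorises into
  one-dimensional ones, so the bound is free of \<open>S\<close>.\<close>

lemma sum_power_grid_dist_bound:
  fixes q :: real
  assumes S: "finite S" and q: "0 \<le> q" "q < 1"
  shows "(\<Sum>j\<in>S. q ^ grid_dist i j) \<le> (2 / (1 - q))\<^sup>2"
proof -
  have "(\<Sum>j\<in>S. q ^ grid_dist i j) \<le> (\<Sum>j\<in>fst ` S \<times> snd ` S. q ^ grid_dist i j)"
    using S q by (intro sum_mono2) (auto intro: rev_image_eqI)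
  also have "\<dots> = (\<Sum>b\<in>fst ` S. q ^ nat \<bar>int (fst i) - int b\<bar>) * (\<Sum>b\<in>snd ` S. q ^ nat \<bar>int (snd i) - int b\<bar>)"
    by (simp add: sum_product sum.cartesian_product grid_dist_def power_add split_def)
  also have "\<dots> \<le> (2 / (1 - q)) * (2 / (1 - q))"
    using S q by (intro mult_mono sum_geometric_two_sided_bound sum_nonneg) auto
  finally show ?thesis by (simp add: power2_eq_square)
qed

text \<open>Replace \<open>\<bar>h i\<bar> * \<bar>h j\<bar>\<close> by the mean of the two squares;
  by symmetry of \<open>e\<close> both halves give the same weighted row sums.\<close>

lemma schur_test:
  fixes e :: "'i \<Rightarrow> 'i \<Rightarrow> real"
  assumes e0: "\<And>i j. i \<in> S \<Longrightarrow> j \<in> S \<Longrightarrow> 0 \<le> e i j"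
    and sym: "\<And>i j. i \<in> S \<Longrightarrow> j \<in> S \<Longrightarrow> e i j = e j i"
    and row: "\<And>i. i \<in> S \<Longrightarrow> (\<Sum>j\<in>S. e i j) \<le> c"
  shows "(\<Sum>i\<in>S. \<Sum>j\<in>S. \<bar>h i\<bar> * e i j * \<bar>h j\<bar>) \<le> c * (\<Sum>i\<in>S. (h i)\<^sup>2)"
proof -
  have "(\<Sum>i\<in>S. \<Sum>j\<in>S. \<bar>h i\<bar> * e i j * \<bar>h j\<bar>)
      \<le> (\<Sum>i\<in>S. \<Sum>j\<in>S. (h i)\<^sup>2 * e i j / 2 + (h j)\<^sup>2 * e i j / 2)"
  proof (intro sum_mono)
    fix i j assume ij: "i \<in> S" "j \<in> S"
    have "0 \<le> (\<bar>h i\<bar> - \<bar>h j\<bar>)\<^sup>2" by simp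
    then have "\<bar>h i\<bar> * \<bar>h j\<bar> \<le> ((h i)\<^sup>2 + (h j)\<^sup>2) / 2"
      by (simp add: power2_diff)
    then have "\<bar>h i\<bar> * \<bar>h j\<bar> * e i j \<le> ((h i)\<^sup>2 + (h j)\<^sup>2) / 2 * e i j"
      using e0[OF ij] by (rule mult_right_mono)
    then show "\<bar>h i\<bar> * e i j * \<bar>h j\<bar> \<le> (h i)\<^sup>2 * e i j / 2 + (h j)\<^sup>2 * e i j / 2"
      by (simp add: field_simps)
  qed
  also have "\<dots> = (\<Sum>i\<in>S. \<Sum>j\<in>S. (h i)\<^sup>2 * e i j) / 2 + (\<Sum>i\<in>S. \<Sum>j\<in>S. (h j)\<^sup>2 * e i j) / 2"
    by (simp add: sum.distrib sum_divide_distrib)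
  also have "(\<Sum>i\<in>S. \<Sum>j\<in>S. (h j)\<^sup>2 * e i j) = (\<Sum>i\<in>S. \<Sum>j\<in>S. (h i)\<^sup>2 * e i j)"
    by (subst sum.swap) (simp add: sym cong: sum.cong)
  also have "(\<Sum>i\<in>S. \<Sum>j\<in>S. (h i)\<^sup>2 * e i j) / 2 + (\<Sum>i\<in>S. \<Sum>j\<in>S. (h i)\<^sup>2 * e i j) / 2
      = (\<Sum>i\<in>S. (h i)\<^sup>2 * (\<Sum>j\<in>S. e i j))"
    by (simp add: sum_distrib_left)
  also have "\<dots> \<le> (\<Sum>i\<in>S. (h i)\<^sup>2 * c)"
    using row by (intro sum_mono mult_left_mono) auto
  finally show ?thesis by (simp add: sum_distrib_left mult.commute)
qed

text \<open>For symmetric \<open>A\<close> on finite nonempty \<open>S\<close>: the smallest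
  eigenvalue is at least \<open>l\<close>.\<close>

definition coercive_on :: "'i set \<Rightarrow> real \<Rightarrow> ('i \<Rightarrow> 'i \<Rightarrow> real) \<Rightarrow> bool" where
  "coercive_on S l A \<longleftrightarrow> (\<forall>h. l * (\<Sum>i\<in>S. (h i)\<^sup>2) \<le> (\<Sum>i\<in>S. \<Sum>j\<in>S. h i * h j * A i j))"

text \<open>The off-diagonal part costs at most the Schur bound of the majorant \<open>e\<close>. A
  nonnegative diagonal of \<open>e\<close> only enlarges the row sums, so \<open>e\<close> may be
  given by one formula for all pairs.\<close>

lemma diagonally_dominant_form:
  fixes K :: "'i \<Rightarrow> 'i \<Rightarrow> real"
  assumes S: "finite S"
    and diag: "\<And>i. i \<in> S \<Longrightarrow> K i i = 1"
    and bound: "\<And>i j. i \<in> S \<Longrightarrow> j \<in> S \<Longrightarrow> i \<noteq> j \<Longrightarrow> \<bar>K i j\<bar> \<le> e i j"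
    and sym: "\<And>i j. i \<in> S \<Longrightarrow> j \<in> S \<Longrightarrow> e i j = e j i"
    and e0: "\<And>i j. i \<in> S \<Longrightarrow> j \<in> S \<Longrightarrow> 0 \<le> e i j"
    and row: "\<And>i. i \<in> S \<Longrightarrow> (\<Sum>j\<in>S. e i j) \<le> c"
  shows "(1 - c) * (\<Sum>i\<in>S. (h i)\<^sup>2) \<le> (\<Sum>i\<in>S. \<Sum>j\<in>S. h i * h j * K i j)"
proof -
  have "(\<Sum>i\<in>S. (h i)\<^sup>2) = (\<Sum>i\<in>S. \<Sum>j\<in>S. if i = j then h i * h j else 0)"
    using S by (simp add: power2_eq_square)
  also have "\<dots> \<le> (\<Sum>i\<in>S. \<Sum>j\<in>S. h i * h j * K i j + \<bar>h i\<bar> * e i j * \<bar>h j\<bar>)"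
  proof (intro sum_mono)
    fix i j assume ij: "i \<in> S" "j \<in> S"
    show "(if i = j then h i * h j else 0) \<le> h i * h j * K i j + \<bar>h i\<bar> * e i j * \<bar>h j\<bar>"
    proof (cases "i = j")
      case True then show ?thesis using diag e0 ij by simp
    next
      case False
      have "\<bar>h i * h j * K i j\<bar> \<le> \<bar>h i\<bar> * \<bar>h j\<bar> * e i j"
        using bound[OF ij False] by (simp add: abs_mult mult_left_mono)
      then show ?thesis using False by (simp add: mult_ac)
    qed
  qed
  also have "\<dots> = (\<Sum>i\<in>S. \<Sum>j\<in>S. h i * h j * K i j) + (\<Sum>i\<in>S. \<Sum>j\<in>S. \<bar>h i\<bar> * e i j * \<bar>h j\<bar>)"
    by (simp add: sum.distrib)
  also have "(\<Sum>i\<in>S. \<Sum>j\<in>S. \<bar>h i\<bar> * e i j * \<bar>h j\<bar>) \<le> c * (\<Sum>i\<in>S. (h i)\<^sup>2)"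
    using e0 sym row by (rule schur_test)
  finally show ?thesis by (simp add: algebra_simps)
qed

text \<open>The constant is \<open>1024 = 32\<^sup>2\<close>: at distance at least \<open>1\<close>,
  one factor \<open>(1 / 32) ^ grid_dist i j\<close> is spent on the smallness
  \<open>1 / 32\<close>, the other on summability. The row sums are then at most
  \<open>(64 / 31)\<^sup>2 / 32\<close>, which is below \<open>1 / 2\<close>.\<close>

lemma gaussian_grid_form_coercive:
  fixes u v :: real
  assumes S: "finite S" and u: "ln 1024 \<le> u" and v: "ln 1024 \<le> v"
  shows "1 / 2 * (\<Sum>i\<in>S. (h i)\<^sup>2) \<le> (\<Sum>i\<in>S. \<Sum>j\<in>S. h i * h j *
     (exp (- u * (real (fst i) - real (fst j))\<^sup>2) * exp (- v * (real (snd i) - real (snd j))\<^sup>2)))"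
proof -
  have le: "exp (- u * (real a - real b)\<^sup>2) \<le> (1 / 1024) ^ nat \<bar>int a - int b\<bar>"
    if "ln 1024 \<le> u" for u a b
  proof -
    define k where "k = nat \<bar>int a - int b\<bar>"
    have "real k = \<bar>real a - real b\<bar>" by (simp add: k_def)
    then have "(real a - real b)\<^sup>2 = real (k\<^sup>2)" by (metis power2_abs of_nat_power)
    then have "exp (- u * (real a - real b)\<^sup>2) = exp (- u) ^ (k\<^sup>2)"
      using exp_of_nat_mult[of "k\<^sup>2" "- u"] by (simp only: mult.commute)
    also have "\<dots> \<le> exp (- ln 1024) ^ (k\<^sup>2)" using that by (intro power_mono) auto
    also have "\<dots> = (1 / 1024) ^ (k\<^sup>2)" by (simp add: exp_minus inverse_eq_divide)
    also have "\<dots> \<le> (1 / 1024) ^ k"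
      by (intro power_decreasing) (auto simp: power2_eq_square)
    finally show ?thesis by (simp add: k_def)
  qed
  define e :: "site \<Rightarrow> site \<Rightarrow> real" where "e i j = 1 / 32 * (1 / 32) ^ grid_dist i j" for i j
  have "(1 - 1 / 2) * (\<Sum>i\<in>S. (h i)\<^sup>2) \<le> (\<Sum>i\<in>S. \<Sum>j\<in>S. h i * h j *
     (exp (- u * (real (fst i) - real (fst j))\<^sup>2) * exp (- v * (real (snd i) - real (snd j))\<^sup>2)))"
  proof (rule diagonally_dominant_form[OF S, where e = e])
    fix i j :: site
    assume "i \<noteq> j"
    have "\<bar>exp (- u * (real (fst i) - real (fst j))\<^sup>2) * exp (- v * (real (snd i) - real (snd j))\<^sup>2)\<bar>
       \<le> (1 / 1024) ^ grid_dist i j"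
      unfolding grid_dist_def power_add abs_mult abs_exp_cancel
      by (intro mult_mono le u v exp_ge_zero zero_le_power) simp
    also have "\<dots> = (1 / 32) ^ grid_dist i j * (1 / 32) ^ grid_dist i j"
      by (simp add: power_mult_distrib[symmetric])
    also have "\<dots> \<le> (1 / 32) ^ 1 * (1 / 32) ^ grid_dist i j"
      by (intro mult_right_mono power_decreasing grid_dist_pos \<open>i \<noteq> j\<close>) auto
    also have "\<dots> = e i j" by (simp add: e_def)
    finally show "\<bar>exp (- u * (real (fst i) - real (fst j))\<^sup>2) * exp (- v * (real (snd i) - real (snd j))\<^sup>2)\<bar> \<le> e i j" .
  next
    fix i :: site
    have "(\<Sum>j\<in>S. e i j) = 1 / 32 * (\<Sum>j\<in>S. (1 / 32) ^ grid_dist i j)"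
      unfolding e_def sum_distrib_left ..
    also have "\<dots> \<le> 1 / 32 * (2 / (1 - 1 / 32))\<^sup>2"
      using S by (intro mult_left_mono sum_power_grid_dist_bound) auto
    finally show "(\<Sum>j\<in>S. e i j) \<le> 1 / 2" by (simp add: power2_eq_square)
  qed (auto simp: e_def grid_dist_commute)
  then show ?thesis by simp
qed

text \<open>Starting from the constant kernel \<open>1\<close>, whose form is a square, one Gaussian
  factor is multiplied on per coordinate.\<close>

lemma gaussian_grid_form_nonneg:
  fixes u v :: real
  assumes u: "0 \<le> u" and v: "0 \<le> v"
  shows "0 \<le> (\<Sum>i\<in>S. \<Sum>j\<in>S. h i * h j *
     (exp (- u * (real (fst i) - real (fst j))\<^sup>2) * exp (- v * (real (snd i) - real (snd j))\<^sup>2)))"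
proof -
  have "0 \<le> (\<Sum>i\<in>S. \<Sum>j\<in>S. h i * h j * 1)" for h :: "site \<Rightarrow> real"
    by (simp add: sum_product[symmetric])
  from gaussian_mult_nonneg_form[OF u this, of _ "\<lambda>i. real (fst i)"]
  have "0 \<le> (\<Sum>i\<in>S. \<Sum>j\<in>S. h i * h j * exp (- u * (real (fst i) - real (fst j))\<^sup>2))" for h
    by simp
  from gaussian_mult_nonneg_form[OF v this, of _ "\<lambda>i. real (snd i)"] show ?thesis .
qed

section \<open>Coercivity of the distance kernels for both metrics\<close>

lemma Lp_dist_1: "Lp_dist 1 i j = \<bar>real (fst i) - real (fst j)\<bar> + \<bar>real (snd i) - real (snd j)\<bar>"
  by (simp add: Lp_dist_def)

lemma Lp_dist_2: "Lp_dist 2 i j = sqrt ((real (fst i) - real (fst j))\<^sup>2 + (real (snd i) - real (snd j))\<^sup>2)"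
  unfolding Lp_dist_def by (simp add: powr_half_sqrt)

text \<open>For \<open>p = 2\<close> one mixture suffices, since a Gaussian in the Euclidean
  distance factors over the coordinates. For \<open>p = 1\<close> the kernel is a product of two
  exponentials, so the mixture is applied once per coordinate with the other factor as
  \<open>K\<close>; each application costs a factor \<open>\<mu>\<close>.\<close>

lemma Lp_kernel_coercive:
  fixes \<rho> p :: real
  assumes \<rho>: "0 < \<rho>" "\<rho> < 1" and p: "p \<in> {1, 2}"
  shows "\<exists>l>0. \<forall>S. finite S \<longrightarrow> coercive_on S l (\<lambda>i j. \<rho> powr Lp_dist p i j)"
proof -
  define c where "c = - ln \<rho>"
  have c: "0 < c" using \<rho> by (simp add: c_def)
  have powr: "\<rho> powr x = exp (- c * x)" for x using \<rho> by (simp add: powr_def c_def mult.commute)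
  have ln0: "(0::real) < ln 1024" by simp
  show ?thesis
  proof (rule exp_mixture_coercive[OF c ln0, where 'i = site], goal_cases)
    case (1 \<mu>)
    note \<mu> = 1(1) and mix = 1(2)
    show ?thesis
    proof (cases "p = 1")
      case True
      show ?thesis unfolding coercive_on_def
      proof (intro exI[of _ "1 / 2 * \<mu> * \<mu>"] conjI allI impI)
        show "0 < 1 / 2 * \<mu> * \<mu>" using \<mu> by simp
        fix S :: "site set" and h :: "site \<Rightarrow> real" assume S: "finite S"
        define a :: "site \<Rightarrow> site \<Rightarrow> real" where "a = (\<lambda>i j :: site. \<bar>real (fst i) - real (fst j)\<bar>)"
        define b :: "site \<Rightarrow> site \<Rightarrow> real" where "b = (\<lambda>i j :: site. \<bar>real (snd i) - real (snd j)\<bar>)"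
        have nn: "0 \<le> (\<Sum>i\<in>S. \<Sum>j\<in>S. h i * h j * (exp (- u * (a i j)\<^sup>2) * exp (- v * (b i j)\<^sup>2)))"
          if "0 < u" "0 < v" for u v
          unfolding a_def b_def power2_abs using that by (intro gaussian_grid_form_nonneg) auto
        have lb: "1 / 2 * (\<Sum>i\<in>S. (h i)\<^sup>2) \<le> (\<Sum>i\<in>S. \<Sum>j\<in>S. h i * h j * (exp (- u * (a i j)\<^sup>2) * exp (- v * (b i j)\<^sup>2)))"
          if "ln 1024 \<le> u" "ln 1024 \<le> v" for u v
          unfolding a_def b_def power2_abs using that S by (intro gaussian_grid_form_coercive) auto
        have nn': "0 \<le> (\<Sum>i\<in>S. \<Sum>j\<in>S. h i * h j * (exp (- c * b i j) * exp (- u * (a i j)\<^sup>2)))" if "0 < u" for u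
        proof -
          have "0 * \<mu> \<le> (\<Sum>i\<in>S. \<Sum>j\<in>S. h i * h j * (exp (- u * (a i j)\<^sup>2) * exp (- c * b i j)))"
          proof (rule mix[OF S order_refl])
            show "0 \<le> b i j" for i j by (simp add: b_def)
            show "0 \<le> (\<Sum>i\<in>S. \<Sum>j\<in>S. h i * h j * (exp (- u * (a i j)\<^sup>2) * exp (- v * (b i j)\<^sup>2)))"
              if "0 < v" for v by (rule nn[OF \<open>0 < u\<close> that])
            show "0 \<le> (\<Sum>i\<in>S. \<Sum>j\<in>S. h i * h j * (exp (- u * (a i j)\<^sup>2) * exp (- v * (b i j)\<^sup>2)))"
              if "ln 1024 \<le> v" for v by (rule nn[OF \<open>0 < u\<close> less_le_trans[OF ln0 that]])
          qed
          then show ?thesis by (simp add: mult.commute)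
        qed
        have lb': "1 / 2 * (\<Sum>i\<in>S. (h i)\<^sup>2) * \<mu> \<le> (\<Sum>i\<in>S. \<Sum>j\<in>S. h i * h j * (exp (- c * b i j) * exp (- u * (a i j)\<^sup>2)))"
          if "ln 1024 \<le> u" for u
        proof -
          have "1 / 2 * (\<Sum>i\<in>S. (h i)\<^sup>2) * \<mu> \<le> (\<Sum>i\<in>S. \<Sum>j\<in>S. h i * h j * (exp (- u * (a i j)\<^sup>2) * exp (- c * b i j)))"
            using less_le_trans[OF ln0 that] that
            by (intro mix S nn lb) (auto simp: b_def sum_nonneg)
          then show ?thesis by (simp add: mult.commute)
        qed
        have "1 / 2 * (\<Sum>i\<in>S. (h i)\<^sup>2) * \<mu> * \<mu> \<le> (\<Sum>i\<in>S. \<Sum>j\<in>S. h i * h j * (exp (- c * b i j) * exp (- c * a i j)))"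
          using \<mu> by (intro mix S nn' lb') (auto simp: a_def sum_nonneg)
        also have "\<dots> = (\<Sum>i\<in>S. \<Sum>j\<in>S. h i * h j * \<rho> powr Lp_dist p i j)"
          unfolding True Lp_dist_1 powr a_def b_def exp_add[symmetric] by (simp add: algebra_simps)
        finally show "1 / 2 * \<mu> * \<mu> * (\<Sum>i\<in>S. (h i)\<^sup>2) \<le> \<dots>" by (simp add: mult_ac)
      qed
    next
      case False
      then have p2: "p = 2" using p by simp
      show ?thesis unfolding coercive_on_def
      proof (intro exI[of _ "1 / 2 * \<mu>"] conjI allI impI)
        show "0 < 1 / 2 * \<mu>" using \<mu> by simp
        fix S :: "site set" and h :: "site \<Rightarrow> real" assume S: "finite S"
        have eq: "1 * exp (- u * (Lp_dist 2 i j)\<^sup>2)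
            = exp (- u * (real (fst i) - real (fst j))\<^sup>2) * exp (- u * (real (snd i) - real (snd j))\<^sup>2)" for u i j
          by (simp add: Lp_dist_2 exp_add[symmetric] algebra_simps)
        have "1 / 2 * (\<Sum>i\<in>S. (h i)\<^sup>2) * \<mu> \<le> (\<Sum>i\<in>S. \<Sum>j\<in>S. h i * h j * (1 * exp (- c * Lp_dist 2 i j)))"
        proof (intro mix, unfold eq)
          show "0 \<le> (\<Sum>i\<in>S. \<Sum>j\<in>S. h i * h j *
            (exp (- u * (real (fst i) - real (fst j))\<^sup>2) * exp (- u * (real (snd i) - real (snd j))\<^sup>2)))"
            if "0 < u" for u
            using that by (intro gaussian_grid_form_nonneg) auto
          show "1 / 2 * (\<Sum>i\<in>S. (h i)\<^sup>2) \<le> (\<Sum>i\<in>S. \<Sum>j\<in>S. h i * h j *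
            (exp (- u * (real (fst i) - real (fst j))\<^sup>2) * exp (- u * (real (snd i) - real (snd j))\<^sup>2)))"
            if "ln 1024 \<le> u" for u
            using that S by (intro gaussian_grid_form_coercive) auto
        qed (use S in \<open>auto simp: Lp_dist_2 sum_nonneg\<close>)
        then show "1 / 2 * \<mu> * (\<Sum>i\<in>S. (h i)\<^sup>2) \<le> (\<Sum>i\<in>S. \<Sum>j\<in>S. h i * h j * \<rho> powr Lp_dist p i j)"
          by (simp add: powr p2 mult_ac)
      qed
    qed
  qed
qed

text \<open>
  Combes--Thomas: conjugating by \<open>z ^ grid_dist i i\<^sub>0\<close> with \<open>z > 1\<close> close to \<open>1\<close> perturbs the
  form by at most half of its coercivity constant, so the solution of \<open>A g = e\<^sub>i\<^sub>0\<close> decays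
  like \<open>z ^ - grid_dist i i\<^sub>0\<close>.
\<close>

lemma inverse_column_bound:
  fixes q l :: real
  assumes q: "0 < q" "q < 1" and l: "0 < l"
  shows "\<exists>C>0. \<forall>S A g i\<^sub>0. finite S \<longrightarrow> i\<^sub>0 \<in> S \<longrightarrow>
      (\<forall>i\<in>S. \<forall>j\<in>S. \<bar>A i j\<bar> \<le> q ^ grid_dist i j) \<longrightarrow> coercive_on S l A \<longrightarrow>
      (\<forall>i\<in>S. (\<Sum>j\<in>S. A i j * g j) = (if i = i\<^sub>0 then 1 else 0)) \<longrightarrow> (\<Sum>j\<in>S. \<bar>g j\<bar>) \<le> C"
proof -
  \<comment> \<open>\<open>s\<^sup>2\<close> lies strictly between \<open>q\<close> and
    \<open>1\<close>, which leaves room for \<open>z > 1\<close> with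
    \<open>q * z \<le> s\<^sup>2\<close>. One factor \<open>s ^ n\<close> absorbs the linear growth
    in \<open>n\<close>, the other is summed over the grid with total at most \<open>R\<close>;
    \<open>\<eta>\<close> is set so that the rows of the perturbation sum to at most
    \<open>l / 2\<close>.\<close>
  define s where "s = sqrt ((1 + q) / 2)"
  have s: "0 < s" "s < 1" "s\<^sup>2 = (1 + q) / 2" using q by (auto simp: s_def)
  define R where "R = (2 / (1 - s))\<^sup>2"
  have R: "0 < R" using s by (simp add: R_def)
  define \<eta> where "\<eta> = l * (1 - s) / (2 * R)"
  have \<eta>: "0 < \<eta>" using l s R by (simp add: \<eta>_def)
  define z where "z = min (1 + \<eta>) ((1 + q) / (2 * q))"
  have z: "1 < z" "z \<le> 1 + \<eta>" "q * z \<le> s\<^sup>2"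
    using \<eta> q s(3) by (auto simp: z_def field_simps min_def)
  have pow_le: "q ^ n * (z ^ n - 1) \<le> \<eta> / (1 - s) * s ^ n" for n
  proof -
    \<comment> \<open>Bernoulli's inequality at \<open>1 / z\<close> instead of \<open>z\<close>
      turns into an upper bound for \<open>z ^ n - 1\<close>.\<close>
    have "1 + real n * (inverse z - 1) \<le> (1 + (inverse z - 1)) ^ n"
      using z by (intro Bernoulli_inequality) auto
    then have "1 - real n * (1 - inverse z) \<le> inverse z ^ n" by (simp add: algebra_simps)
    then have "(1 - real n * (1 - inverse z)) * z ^ n \<le> inverse z ^ n * z ^ n"
      using z by (intro mult_right_mono) auto
    also have "inverse z ^ n * z ^ n = 1" using z by (simp add: power_mult_distrib[symmetric])
    finally have "z ^ n - 1 \<le> real n * (1 - inverse z) * z ^ n" by (simp add: algebra_simps)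
    also have "\<dots> \<le> real n * \<eta> * z ^ n"
    proof -
      have "0 \<le> (z - 1)\<^sup>2" by simp
      then have "1 - inverse z \<le> z - 1" using z by (simp add: field_simps power2_eq_square)
      then show ?thesis using z by (intro mult_right_mono mult_left_mono) auto
    qed
    finally have "q ^ n * (z ^ n - 1) \<le> q ^ n * (real n * \<eta> * z ^ n)"
      using q by (intro mult_left_mono) auto
    also have "\<dots> = real n * \<eta> * (q * z) ^ n" by (simp add: power_mult_distrib)
    also have "\<dots> \<le> real n * \<eta> * (s\<^sup>2) ^ n"
      using z q \<eta> by (intro mult_left_mono power_mono) auto
    also have "(s\<^sup>2) ^ n = s ^ n * s ^ n" by (simp add: power2_eq_square power_mult_distrib)
    also have "real n * \<eta> * (s ^ n * s ^ n) = \<eta> * (real n * s ^ n) * s ^ n" by simp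
    also have "real n * s ^ n \<le> 1 / (1 - s)"
    proof -
      have "real n * s ^ n = (\<Sum>k<n. s ^ n)" by simp
      also have "\<dots> \<le> (\<Sum>k<n. s ^ k)" using s by (intro sum_mono power_decreasing) auto
      also have "\<dots> \<le> 1 / (1 - s)" using s by (intro sum_geometric_bound) auto
      finally show ?thesis .
    qed
    finally show ?thesis using \<eta> s by (simp add: mult_left_mono mult_right_mono)
  qed
  define C where "C = 2 / l * (2 / (1 - 1 / z))\<^sup>2"
  show ?thesis
  proof (intro exI[of _ C] conjI allI impI)
    show "0 < C" using l z by (auto simp: C_def)
    fix S A and g :: "site \<Rightarrow> real" and i\<^sub>0 :: site
    assume S: "finite S" and i0: "i\<^sub>0 \<in> S"
      and "\<forall>i\<in>S. \<forall>j\<in>S. \<bar>A i j\<bar> \<le> q ^ grid_dist i j" and co: "coercive_on S l A"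
      and "\<forall>i\<in>S. (\<Sum>j\<in>S. A i j * g j) = (if i = i\<^sub>0 then 1 else 0)"
    then have A: "\<And>i j. i \<in> S \<Longrightarrow> j \<in> S \<Longrightarrow> \<bar>A i j\<bar> \<le> q ^ grid_dist i j"
      and g: "\<And>i. i \<in> S \<Longrightarrow> (\<Sum>j\<in>S. A i j * g j) = (if i = i\<^sub>0 then 1 else 0)" by auto
    define d where "d i = grid_dist i i\<^sub>0" for i
    define h where "h i = z ^ d i * g i" for i
    define e where "e i j = q ^ grid_dist i j * (z ^ grid_dist i j - 1)" for i j
    have e0: "0 \<le> e i j" for i j using q z by (simp add: e_def)
    have row: "(\<Sum>j\<in>S. e i j) \<le> l / 2" for i
    proof -
      have "(\<Sum>j\<in>S. e i j) \<le> (\<Sum>j\<in>S. \<eta> / (1 - s) * s ^ grid_dist i j)"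
        unfolding e_def by (intro sum_mono pow_le)
      also have "\<dots> = \<eta> / (1 - s) * (\<Sum>j\<in>S. s ^ grid_dist i j)" by (simp add: sum_distrib_left)
      also have "\<dots> \<le> \<eta> / (1 - s) * R"
        unfolding R_def using S s \<eta> by (intro mult_left_mono sum_power_grid_dist_bound) auto
      also have "\<dots> = l / 2" using s R by (simp add: \<eta>_def)
      finally show ?thesis .
    qed
    \<comment> \<open>By the triangle inequality the exponents differ by at most
      \<open>grid_dist i j\<close>. For a quotient \<open>1 / w\<close> below \<open>1\<close> the
      bound uses \<open>1 - 1 / w \<le> w - 1\<close>.\<close>
    have ratio: "\<bar>1 - z ^ d i / z ^ d j\<bar> \<le> z ^ grid_dist i j - 1" for i j
    proof (cases "d j \<le> d i")
      case True
      then have "z ^ d i / z ^ d j = z ^ (d i - d j)" using z by (simp add: power_diff)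
      moreover have "z ^ (d i - d j) \<le> z ^ grid_dist i j"
        using z grid_dist_triangle[of i i\<^sub>0 j] by (intro power_increasing) (auto simp: d_def)
      moreover have "1 \<le> z ^ (d i - d j)" using z by (intro one_le_power) auto
      ultimately show ?thesis by simp
    next
      case False
      define w where "w = z ^ (d j - d i)"
      have w: "1 \<le> w" "w \<le> z ^ grid_dist i j"
        using z grid_dist_triangle[of j i\<^sub>0 i]
        by (auto simp: d_def w_def grid_dist_commute intro!: power_increasing one_le_power)
      have "z ^ d i / z ^ d j = 1 / w" using z False by (simp add: w_def power_diff)
      moreover have "1 - 1 / w \<le> w - 1"
      proof -
        have "0 \<le> (w - 1)\<^sup>2" by simp
        then show ?thesis using w by (simp add: field_simps power2_eq_square)
      qed
      ultimately show ?thesis using w by simp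
    qed
    define H where "H = (\<Sum>i\<in>S. (h i)\<^sup>2)"
    have hH: "(h i)\<^sup>2 \<le> H" if "i \<in> S" for i
      unfolding H_def by (rule member_le_sum) (use that S in auto)
    have H0: "0 \<le> H" by (simp add: H_def sum_nonneg)
    \<comment> \<open>Only the equation at \<open>i\<^sub>0\<close> has a nonzero right-hand side,
      and its weight \<open>z ^ d i\<^sub>0\<close> is \<open>1\<close>. Since
      \<open>h i\<^sub>0 \<le> sqrt H\<close>, a quadratic quantity is thereby bounded by a linear
      one.\<close>
    have "(\<Sum>i\<in>S. \<Sum>j\<in>S. h i * z ^ d i * (A i j * g j)) = h i\<^sub>0"
    proof -
      have "(\<Sum>i\<in>S. \<Sum>j\<in>S. h i * z ^ d i * (A i j * g j)) = (\<Sum>i\<in>S. h i * z ^ d i * (\<Sum>j\<in>S. A i j * g j))"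
        by (simp add: sum_distrib_left)
      also have "\<dots> = (\<Sum>i\<in>S. if i = i\<^sub>0 then h i * z ^ d i else 0)"
        by (intro sum.cong) (auto simp: g)
      also have "\<dots> = h i\<^sub>0" using S i0 by (simp add: d_def)
      finally show ?thesis .
    qed
    moreover have "(\<Sum>i\<in>S. \<Sum>j\<in>S. h i * z ^ d i * (A i j * g j))
        = (\<Sum>i\<in>S. \<Sum>j\<in>S. h i * h j * A i j * (z ^ d i / z ^ d j))"
      using z by (intro sum.cong) (auto simp: h_def)
    ultimately have T: "(\<Sum>i\<in>S. \<Sum>j\<in>S. h i * h j * A i j * (z ^ d i / z ^ d j)) = h i\<^sub>0" by metis
    have "l * H \<le> (\<Sum>i\<in>S. \<Sum>j\<in>S. h i * h j * A i j)" using co unfolding H_def coercive_on_def by blast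
    also have "\<dots> \<le> (\<Sum>i\<in>S. \<Sum>j\<in>S. h i * h j * A i j * (z ^ d i / z ^ d j) + \<bar>h i\<bar> * e i j * \<bar>h j\<bar>)"
    proof (intro sum_mono)
      fix i j assume ij: "i \<in> S" "j \<in> S"
      have "\<bar>h i * h j * A i j * (1 - z ^ d i / z ^ d j)\<bar> \<le> \<bar>h i\<bar> * \<bar>h j\<bar> * e i j"
        unfolding abs_mult e_def mult.assoc using A[OF ij] ratio[of i j] q
        by (intro mult_left_mono mult_mono) auto
      then show "h i * h j * A i j \<le> h i * h j * A i j * (z ^ d i / z ^ d j) + \<bar>h i\<bar> * e i j * \<bar>h j\<bar>"
        by (simp add: algebra_simps)
    qed
    also have "\<dots> = h i\<^sub>0 + (\<Sum>i\<in>S. \<Sum>j\<in>S. \<bar>h i\<bar> * e i j * \<bar>h j\<bar>)"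
      unfolding sum.distrib T ..
    also have "(\<Sum>i\<in>S. \<Sum>j\<in>S. \<bar>h i\<bar> * e i j * \<bar>h j\<bar>) \<le> l / 2 * H"
      unfolding H_def by (rule schur_test[OF e0 _ row]) (simp add: e_def grid_dist_commute)
    also have "h i\<^sub>0 \<le> sqrt H" using hH[OF i0] by (intro real_le_rsqrt)
    finally have "l / 2 * H \<le> sqrt H" by simp
    then have *: "l / 2 * sqrt H * sqrt H \<le> 1 * sqrt H"
      unfolding mult.assoc real_sqrt_mult_self abs_of_nonneg[OF H0] by linarith
    have sH: "sqrt H \<le> 2 / l"
    proof (cases "H = 0")
      case True then show ?thesis using l by simp
    next
      case False
      then have "0 < sqrt H" using H0 by simp
      with * have "l / 2 * sqrt H \<le> 1"
        by (rule mult_right_le_imp_le)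
      then show ?thesis using l by (simp add: field_simps)
    qed
    have "(\<Sum>j\<in>S. \<bar>g j\<bar>) \<le> (\<Sum>j\<in>S. 2 / l * (1 / z) ^ grid_dist i\<^sub>0 j)"
    proof (rule sum_mono)
      fix j assume "j \<in> S"
      then have "\<bar>h j\<bar> \<le> 2 / l" using hH[of j] sH real_le_rsqrt[of "\<bar>h j\<bar>" H] by simp
      moreover have "\<bar>g j\<bar> = \<bar>h j\<bar> * (1 / z) ^ d j" using z by (simp add: h_def abs_mult power_divide)
      moreover have "(1 / z) ^ d j \<ge> 0" using z by simp
      ultimately show "\<bar>g j\<bar> \<le> 2 / l * (1 / z) ^ grid_dist i\<^sub>0 j"
        using mult_right_mono[of "\<bar>h j\<bar>" "2 / l" "(1 / z) ^ d j"] by (simp add: d_def grid_dist_commute)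
    qed
    also have "\<dots> = 2 / l * (\<Sum>j\<in>S. (1 / z) ^ grid_dist i\<^sub>0 j)" by (simp add: sum_distrib_left)
    also have "\<dots> \<le> C"
      unfolding C_def using S z l by (intro mult_left_mono sum_power_grid_dist_bound) auto
    finally show "(\<Sum>j\<in>S. \<bar>g j\<bar>) \<le> C" .
  qed
qed

section \<open>Uniform bounds for the correlation matrices and their inverses\<close>

lemma grid_dist_le_Lp_dist:
  assumes "p \<in> {1, 2}"
  shows "real (grid_dist i j) \<le> 2 * Lp_dist p i j"
proof -
  define a where "a = \<bar>real (fst i) - real (fst j)\<bar>"
  define b where "b = \<bar>real (snd i) - real (snd j)\<bar>"
  have ab: "0 \<le> a" "0 \<le> b" by (auto simp: a_def b_def)
  have g: "real (grid_dist i j) = a + b" by (simp add: grid_dist_def a_def b_def)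
  show ?thesis
  proof (cases "p = 1")
    case True
    then have "Lp_dist p i j = a + b" by (simp add: Lp_dist_1 a_def b_def)
    then show ?thesis using g ab by simp
  next
    case False
    then have "Lp_dist p i j = sqrt (a\<^sup>2 + b\<^sup>2)" using assms by (simp add: Lp_dist_2 a_def b_def)
    moreover have "a \<le> sqrt (a\<^sup>2 + b\<^sup>2)" "b \<le> sqrt (a\<^sup>2 + b\<^sup>2)" by (auto intro: real_le_rsqrt)
    ultimately show ?thesis using g by linarith
  qed
qed

lemma inverse_on_unique:
  assumes S: "finite S" and B: "inverse_on S A B" and C: "inverse_on S A C" and ik: "i \<in> S" "k \<in> S"
  shows "B i k = C i k"
proof -
  have "B i k = (\<Sum>j\<in>S. B i j * (if j = k then 1 else 0))"
    using S ik by (simp add: if_distrib cong: if_cong)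
  also have "\<dots> = (\<Sum>j\<in>S. B i j * (\<Sum>l\<in>S. A j l * C l k))"
    using C ik by (intro sum.cong) (auto simp: inverse_on_def)
  also have "\<dots> = (\<Sum>l\<in>S. (\<Sum>j\<in>S. B i j * A j l) * C l k)"
    by (simp add: sum_distrib_left sum_distrib_right mult.assoc) (rule sum.swap)
  also have "\<dots> = (\<Sum>l\<in>S. (if i = l then 1 else 0) * C l k)"
    using B ik by (intro sum.cong) (auto simp: inverse_on_def)
  also have "\<dots> = (\<Sum>l\<in>S. if i = l then C l k else 0)" by (intro sum.cong) auto
  also have "\<dots> = C i k" using S ik by simp
  finally show ?thesis .
qed

lemma inverse_on_symmetric:
  assumes S: "finite S" and B: "inverse_on S A B" and A: "\<And>i j. i \<in> S \<Longrightarrow> j \<in> S \<Longrightarrow> A i j = A j i"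
    and ij: "i \<in> S" "j \<in> S"
  shows "B i j = B j i"
proof -
  have 1: "(\<Sum>j\<in>S. A i j * B k j) = (\<Sum>j\<in>S. B k j * A j i)" if "i \<in> S" "k \<in> S" for i k
    using A that by (intro sum.cong) (auto simp: mult.commute)
  have 2: "(\<Sum>j\<in>S. B j i * A j k) = (\<Sum>j\<in>S. A k j * B j i)" if "i \<in> S" "k \<in> S" for i k
    using A that by (intro sum.cong) (auto simp: mult.commute)
  have "inverse_on S A (\<lambda>i j. B j i)"
    using B by (auto simp: inverse_on_def 1 2)
  from inverse_on_unique[OF S B this ij] show ?thesis .
qed

lemma inverse_on_inv_on: "invertible_on S A \<Longrightarrow> inverse_on S A (inv_on S A)"
  unfolding invertible_on_def inv_on_def by (metis someI)

text \<open>\<open>A\<close> is \<open>1 - a\<close> times the identity plus \<open>a\<close> times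
  the kernel with unit diagonal, so coercivity passes to \<open>A\<close> with the factor
  \<open>a\<close>, also at \<open>a = 1\<close>. Both constants are chosen before the set of
  sites.\<close>

lemma Lp_correlation_bounds:
  fixes a \<rho> p :: real
  assumes a: "0 < a" "a \<le> 1" and \<rho>: "0 \<le> \<rho>" "\<rho> < 1" and p: "p \<in> {1, 2}"
  shows "\<exists>l>0. \<exists>C>0. \<forall>S A. finite S \<longrightarrow> (\<forall>i\<in>S. A i i = 1) \<longrightarrow>
     (\<forall>i\<in>S. \<forall>j\<in>S. i \<noteq> j \<longrightarrow> A i j = a * \<rho> powr Lp_dist p i j) \<longrightarrow>
     coercive_on S l A \<and> (\<forall>i\<in>S. (\<Sum>j\<in>S. \<bar>A i j\<bar>) \<le> C) \<and>
     (\<forall>B. inverse_on S A B \<longrightarrow> (\<forall>k\<in>S. (\<Sum>j\<in>S. \<bar>B j k\<bar>) \<le> C))"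
proof -
  \<comment> \<open>\<open>grid_dist\<close> is at most twice the \<open>Lp_dist\<close>, so
    \<open>sqrt \<rho>\<close> is a decay rate per unit of \<open>grid_dist\<close>. For
    \<open>\<rho> = 0\<close> the off-diagonal entries vanish and any rate in the open unit interval
    would do.\<close>
  define q where "q = (if \<rho> = 0 then 1 / 2 else sqrt \<rho>)"
  have q: "0 < q" "q < 1" using \<rho> by (auto simp: q_def)
  have Lp0: "Lp_dist p i i = 0" for i using p by (auto simp: Lp_dist_1 Lp_dist_2)
  have pow: "\<rho> powr Lp_dist p i j \<le> q ^ grid_dist i j" for i j
  proof (cases "\<rho> = 0")
    case True then show ?thesis by (simp add: q_def)
  next
    case False
    then have "\<rho> powr Lp_dist p i j \<le> \<rho> powr (real (grid_dist i j) / 2)"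
      using \<rho> grid_dist_le_Lp_dist[OF p, of i j] by (intro powr_mono') auto
    also have "\<dots> = (\<rho> powr (1 / 2)) powr (real (grid_dist i j))" by (simp add: powr_powr)
    also have "\<dots> = q ^ grid_dist i j" using False \<rho> by (simp add: q_def powr_half_sqrt powr_realpow)
    finally show ?thesis .
  qed
  \<comment> \<open>\<open>0 powr 0\<close> is \<open>0\<close>, so for \<open>\<rho> = 0\<close>
    the unit diagonal has to be written out.\<close>
  have "\<exists>l>0. \<forall>S. finite S \<longrightarrow> (\<forall>h. l * (\<Sum>i\<in>S. (h i)\<^sup>2) \<le> (\<Sum>i\<in>S. \<Sum>j\<in>S. h i * h j * (if i = j then 1 else \<rho> powr Lp_dist p i j)))"
  proof (cases "\<rho> = 0")
    case True
    have "(\<Sum>i\<in>S. \<Sum>j\<in>S. h i * h j * (if i = j then 1 else \<rho> powr Lp_dist p i j)) = (\<Sum>i\<in>S. (h i)\<^sup>2)"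
      if S: "finite S" for S h
    proof -
      have "(\<Sum>i\<in>S. \<Sum>j\<in>S. h i * h j * (if i = j then 1 else \<rho> powr Lp_dist p i j)) = (\<Sum>i\<in>S. \<Sum>j\<in>S. if i = j then h i * h j else 0)"
        using True by (intro sum.cong) auto
      then show ?thesis using S by (simp add: power2_eq_square)
    qed
    then show ?thesis by (intro exI[of _ 1]) auto
  next
    case False
    have eq: "(if i = j then 1 else \<rho> powr Lp_dist p i j) = \<rho> powr Lp_dist p i j" for i j
      using Lp0 False by simp
    show ?thesis
      using Lp_kernel_coercive[OF _ \<rho>(2) p] False \<rho> unfolding eq coercive_on_def by simp
  qed
  then obtain l0 where l0: "0 < l0" and co0: "\<And>S h. finite S \<Longrightarrow>
     l0 * (\<Sum>i\<in>S. (h i)\<^sup>2) \<le> (\<Sum>i\<in>S. \<Sum>j\<in>S. h i * h j * (if i = j then 1 else \<rho> powr Lp_dist p i j))"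
    by blast
  define l where "l = a * l0"
  have l: "0 < l" using a l0 by (simp add: l_def)
  obtain C1 where C1: "0 < C1" and inv: "\<forall>S A g i\<^sub>0. finite S \<longrightarrow> i\<^sub>0 \<in> S \<longrightarrow>
      (\<forall>i\<in>S. \<forall>j\<in>S. \<bar>A i j\<bar> \<le> q ^ grid_dist i j) \<longrightarrow> coercive_on S l A \<longrightarrow>
      (\<forall>i\<in>S. (\<Sum>j\<in>S. A i j * g j) = (if i = i\<^sub>0 then 1 else 0)) \<longrightarrow> (\<Sum>j\<in>S. \<bar>g j\<bar>) \<le> C1"
    using inverse_column_bound[OF q l] by blast
  define C where "C = max C1 ((2 / (1 - q))\<^sup>2)"
  show ?thesis
  proof (rule exI[of _ l], rule conjI[OF l], rule exI[of _ C], intro conjI allI impI ballI)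
    show "0 < C" using C1 by (simp add: C_def)
    fix S A
    assume S: "finite S" and diag: "\<forall>i\<in>S. A i i = 1"
      and off: "\<forall>i\<in>S. \<forall>j\<in>S. i \<noteq> j \<longrightarrow> A i j = a * \<rho> powr Lp_dist p i j"
    have A: "\<bar>A i j\<bar> \<le> q ^ grid_dist i j" if "i \<in> S" "j \<in> S" for i j
    proof (cases "i = j")
      case True then show ?thesis using diag that by simp
    next
      case False
      have "a * \<rho> powr Lp_dist p i j \<le> 1 * q ^ grid_dist i j"
        using a pow by (intro mult_mono) auto
      then show ?thesis using off that False a by simp
    qed
    show co: "coercive_on S l A"
      unfolding coercive_on_def
    proof
      fix h :: "site \<Rightarrow> real"
      have "(\<Sum>i\<in>S. \<Sum>j\<in>S. h i * h j * A i j)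
         = (\<Sum>i\<in>S. \<Sum>j\<in>S. (if i = j then (1 - a) * (h i * h j) else 0) + a * (h i * h j * (if i = j then 1 else \<rho> powr Lp_dist p i j)))"
        using diag off by (intro sum.cong) (auto simp: algebra_simps)
      also have "\<dots> = (1 - a) * (\<Sum>i\<in>S. (h i)\<^sup>2) + a * (\<Sum>i\<in>S. \<Sum>j\<in>S. h i * h j * (if i = j then 1 else \<rho> powr Lp_dist p i j))"
        using S by (simp add: sum.distrib sum_distrib_left power2_eq_square)
      also have "\<dots> \<ge> 0 + a * (l0 * (\<Sum>i\<in>S. (h i)\<^sup>2))"
        using a co0[OF S, of h] by (intro add_mono mult_left_mono) (auto intro!: mult_nonneg_nonneg sum_nonneg)
      finally show "l * (\<Sum>i\<in>S. (h i)\<^sup>2) \<le> (\<Sum>i\<in>S. \<Sum>j\<in>S. h i * h j * A i j)"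
        by (simp add: l_def)
    qed
    show "(\<Sum>j\<in>S. \<bar>A i j\<bar>) \<le> C" if "i \<in> S" for i
    proof -
      have "(\<Sum>j\<in>S. \<bar>A i j\<bar>) \<le> (\<Sum>j\<in>S. q ^ grid_dist i j)" using A that by (intro sum_mono)
      also have "\<dots> \<le> (2 / (1 - q))\<^sup>2" using S q by (intro sum_power_grid_dist_bound) auto
      finally show ?thesis by (simp add: C_def)
    qed
    fix B k
    assume B: "inverse_on S A B" and k: "k \<in> S"
    have "\<forall>i\<in>S. (\<Sum>j\<in>S. A i j * B j k) = (if i = k then 1 else 0)"
      using B k by (simp add: inverse_on_def)
    then have "(\<Sum>j\<in>S. \<bar>B j k\<bar>) \<le> C1"
      using inv[rule_format, of S k A "\<lambda>j. B j k"] S k A co by auto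
    then show "(\<Sum>j\<in>S. \<bar>B j k\<bar>) \<le> C" by (simp add: C_def)
  qed
qed

section \<open>The quasi-score function\<close>

definition logit_sd :: "real ^ 'q \<Rightarrow> real ^ 'q \<Rightarrow> real" where
  "logit_sd x \<beta> = sqrt (theta x \<beta> * (1 - theta x \<beta>))"

lemma theta_bounds: "0 < theta x \<beta>" "theta x \<beta> < 1"
  using exp_gt_zero[of "x \<bullet> \<beta>"] by (auto simp: theta_def field_simps add_pos_pos)

lemma logit_sd_bounds: "0 < logit_sd x \<beta>" "logit_sd x \<beta> \<le> 1"
proof -
  note b = theta_bounds[of x \<beta>]
  then show "0 < logit_sd x \<beta>" by (simp add: logit_sd_def)
  have "theta x \<beta> * (1 - theta x \<beta>) \<le> 1 * 1" using b by (intro mult_mono) auto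
  then show "logit_sd x \<beta> \<le> 1" by (simp add: logit_sd_def)
qed

lemma logit_sd_square: "(logit_sd x \<beta>)\<^sup>2 = theta x \<beta> * (1 - theta x \<beta>)"
  using theta_bounds[of x \<beta>] by (simp add: logit_sd_def)

text \<open>\<open>V\<close> is \<Gamma> multiplied on both sides by the diagonal of standard
  deviations, so dividing the inverse of \<Gamma> by them gives an inverse of \<open>V\<close>, and
  uniqueness identifies it with the chosen one.\<close>

lemma inv_on_work_cov:
  assumes S: "finite S" and inv: "invertible_on S \<Gamma>" and ij: "i \<in> S" "j \<in> S"
  shows "inv_on S (work_cov t \<Gamma> \<beta>) i j = inv_on S \<Gamma> i j / (logit_sd (t i) \<beta> * logit_sd (t j) \<beta>)"
proof -
  define w where "w i = logit_sd (t i) \<beta>" for i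
  have w: "w i \<noteq> 0" for i using logit_sd_bounds(1)[of "t i" \<beta>] by (simp add: w_def)
  define B where "B i j = inv_on S \<Gamma> i j / (w i * w j)" for i j
  have G: "inverse_on S \<Gamma> (inv_on S \<Gamma>)" using inv by (rule inverse_on_inv_on)
  have V: "work_cov t \<Gamma> \<beta> i j = w i * \<Gamma> i j * w j" for i j
    by (simp add: work_cov_def w_def logit_sd_def)
  have "(\<Sum>j\<in>S. work_cov t \<Gamma> \<beta> i j * B j k) = w i / w k * (\<Sum>j\<in>S. \<Gamma> i j * inv_on S \<Gamma> j k)" for i k
    unfolding V B_def sum_distrib_left using w by (intro sum.cong) (auto simp: field_simps)
  moreover have "(\<Sum>j\<in>S. B i j * work_cov t \<Gamma> \<beta> j k) = w k / w i * (\<Sum>j\<in>S. inv_on S \<Gamma> i j * \<Gamma> j k)" for i k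
    unfolding V B_def sum_distrib_left using w by (intro sum.cong) (auto simp: field_simps)
  ultimately have B: "inverse_on S (work_cov t \<Gamma> \<beta>) B"
    using G w by (auto simp: inverse_on_def)
  then have "inverse_on S (work_cov t \<Gamma> \<beta>) (inv_on S (work_cov t \<Gamma> \<beta>))"
    by (intro inverse_on_inv_on) (auto simp: invertible_on_def)
  from inverse_on_unique[OF S this B ij] show ?thesis by (simp add: B_def w_def)
qed

text \<open>A row of \<open>P\<close> carries the square of \<open>logit_sd (t i) \<beta>\<close>,
  and the inverse covariance takes one of the two factors away. What is left depends on
  \<open>\<beta>\<close> only through scalars at the two sites.\<close>

lemma quasi_score_eq:
  assumes S: "finite S" and inv: "invertible_on S \<Gamma>"
  shows "quasi_score S t \<Gamma> y \<beta> = (\<Sum>i\<in>S. (\<Sum>j\<in>S.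
    logit_sd (t i) \<beta> * inv_on S \<Gamma> i j * ((y j - theta (t j) \<beta>) / logit_sd (t j) \<beta>)) *\<^sub>R t i)"
  unfolding quasi_score_def theta_row_def scaleR_scaleR sum_distrib_right
proof (intro sum.cong refl arg_cong2[where f = scaleR])
  fix i j assume ij: "i \<in> S" "j \<in> S"
  show "inv_on S (work_cov t \<Gamma> \<beta>) i j * (y j - theta (t j) \<beta>) * (theta (t i) \<beta> * (1 - theta (t i) \<beta>))
      = logit_sd (t i) \<beta> * inv_on S \<Gamma> i j * ((y j - theta (t j) \<beta>) / logit_sd (t j) \<beta>)"
    unfolding inv_on_work_cov[OF S inv ij] logit_sd_square[symmetric]
    using logit_sd_bounds(1)[of "t i" \<beta>] logit_sd_bounds(1)[of "t j" \<beta>]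
    by (simp add: field_simps power2_eq_square)
qed

lemma inner_quasi_score:
  assumes S: "finite S" and inv: "invertible_on S \<Gamma>"
  shows "v \<bullet> quasi_score S t \<Gamma> y \<beta> = (\<Sum>i\<in>S. \<Sum>j\<in>S.
    (v \<bullet> t i) * logit_sd (t i) \<beta> * inv_on S \<Gamma> i j * ((y j - theta (t j) \<beta>) / logit_sd (t j) \<beta>))"
  unfolding quasi_score_eq[OF assms]
  by (simp add: inner_sum_right sum_distrib_left mult_ac)

section \<open>The Jacobian of the score and the linearisation of the mean\<close>

lemma theta_differentiable: "(\<lambda>\<beta>. theta x \<beta>) differentiable (at \<beta>)"
  using theta_row_is_gradient[of x \<beta>] by (auto simp: differentiable_def)

lemma logit_sd_differentiable: "(\<lambda>\<beta>. logit_sd x \<beta>) differentiable (at \<beta>)"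
proof -
  have "sqrt differentiable (at (theta x \<beta> * (1 - theta x \<beta>)))"
    using DERIV_real_sqrt[of "theta x \<beta> * (1 - theta x \<beta>)"] theta_bounds[of x \<beta>]
    by (auto simp: real_differentiable_def)
  then show ?thesis
    unfolding logit_sd_def
    by (rule differentiable_compose[where f = sqrt])
      (intro differentiable_mult differentiable_diff differentiable_const theta_differentiable)
qed

lemma quasi_score_differentiable:
  assumes S: "finite S" and inv: "invertible_on S \<Gamma>"
  shows "quasi_score S t \<Gamma> y differentiable (at \<beta>)"
proof -
  have "(\<lambda>\<beta>. \<Sum>i\<in>S. (\<Sum>j\<in>S.
    logit_sd (t i) \<beta> * inv_on S \<Gamma> i j * ((y j - theta (t j) \<beta>) / logit_sd (t j) \<beta>)) *\<^sub>R t i) differentiable (at \<beta>)"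
  proof (intro differentiable_sum[OF S] ballI differentiable_scaleR differentiable_const)
    fix i j
    have "(\<lambda>\<beta>. logit_sd (t i) \<beta> * inv_on S \<Gamma> i j) differentiable (at \<beta>)"
      by (rule differentiable_mult[OF logit_sd_differentiable differentiable_const])
    moreover have "(\<lambda>\<beta>. (y j - theta (t j) \<beta>) / logit_sd (t j) \<beta>) differentiable (at \<beta>)"
      using logit_sd_bounds(1)[of "t j" \<beta>]
      by (intro differentiable_divide differentiable_diff differentiable_const theta_differentiable
          logit_sd_differentiable) simp
    ultimately show "(\<lambda>\<beta>. logit_sd (t i) \<beta> * inv_on S \<Gamma> i j * ((y j - theta (t j) \<beta>) / logit_sd (t j) \<beta>))
        differentiable (at \<beta>)"
      by (rule differentiable_mult)
  qed
  then show ?thesis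
    using quasi_score_eq[OF assms, of t y] by (metis (no_types, lifting) ext)
qed

text \<open>The score is a linear combination of the covariate vectors. If \<open>v\<close> is
  orthogonal to all of them, then \<open>v \<bullet> U\<close> vanishes identically in
  \<open>\<beta>\<close>, hence so does its derivative, and the quadratic form of the Jacobian is
  \<open>0\<close> at \<open>v\<close>.\<close>

lemma negative_definite_jacobian_spans:
  assumes S: "finite S" and inv: "invertible_on S \<Gamma>"
    and nd: "negative_definite (c *\<^sub>R jacobian (quasi_score S t \<Gamma> y) (at \<beta>))" and v: "v \<noteq> 0"
  shows "\<exists>i\<in>S. v \<bullet> t i \<noteq> 0"
proof (rule ccontr)
  assume "\<not> ?thesis"
  then have orth: "v \<bullet> t i = 0" if "i \<in> S" for i using that by blast
  let ?U = "quasi_score S t \<Gamma> y"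
  define D where "D h = jacobian ?U (at \<beta>) *v h" for h
  have D: "(?U has_derivative D) (at \<beta>)"
    unfolding D_def[abs_def] using quasi_score_differentiable[OF S inv] jacobian_works by blast
  have "((\<lambda>\<beta>. v \<bullet> ?U \<beta>) has_derivative (\<lambda>h. v \<bullet> D h)) (at \<beta>)"
    by (rule has_derivative_inner_right[OF D])
  moreover have "v \<bullet> ?U \<beta> = 0" for \<beta>
    by (simp add: inner_quasi_score[OF S inv] orth)
  ultimately have "(\<lambda>h. v \<bullet> D h) = (\<lambda>h. 0)"
    by (intro has_derivative_unique[of "\<lambda>\<beta>. 0"]) auto
  then have "v \<bullet> D v = 0" by metis
  then have "v \<bullet> ((c *\<^sub>R jacobian ?U (at \<beta>)) *v v) = 0"
    by (simp add: D_def scaleR_matrix_vector_assoc[symmetric])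
  then show False using nd v by (auto simp: negative_definite_def)
qed

text \<open>The linearisation is taken at \<open>\<beta>\<close>, where the weights of the score
  equation live. The logistic function \<open>L\<close> is 1-Lipschitz, and its derivative changes
  by \<open>(L \<xi> - L z) * (1 - L \<xi> - L z)\<close>, whose second factor has modulus at most
  \<open>1\<close>; the mean value theorem does the rest.\<close>

lemma theta_remainder:
  "\<bar>theta x \<beta> - theta x \<beta>' - (logit_sd x \<beta>)\<^sup>2 * (x \<bullet> (\<beta> - \<beta>'))\<bar> \<le> (x \<bullet> (\<beta> - \<beta>'))\<^sup>2"
proof -
  define L where "L z = exp z / (1 + exp z)" for z :: real
  have pos: "1 + exp z \<noteq> 0" for z :: real using exp_gt_zero[of z] by linarith
  have L01: "0 < L z" "L z < 1" for z
    using exp_gt_zero[of z] by (auto simp: L_def field_simps add_pos_pos)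
  have L': "(L has_real_derivative L z * (1 - L z)) (at z)" for z
    unfolding L_def[abs_def] using pos[of z]
    by (auto intro!: derivative_eq_intros simp: divide_simps algebra_simps power2_eq_square)
  have lip: "\<bar>L a - L b\<bar> \<le> \<bar>a - b\<bar>" for a b
  proof -
    have "L z * (1 - L z) \<le> 1 * 1" for z using L01[of z] by (intro mult_mono) auto
    then have "norm (L z * (1 - L z)) \<le> 1" for z
      using L01[of z] by (simp add: abs_mult)
    then have "norm (L a - L b) \<le> 1 * norm (a - b)"
      by (intro field_differentiable_bound[of UNIV L "\<lambda>z. L z * (1 - L z)"]) (auto intro: L')
    then show ?thesis by simp
  qed
  have rem: "\<bar>L z - L w - L z * (1 - L z) * (z - w)\<bar> \<le> (z - w)\<^sup>2" for z w
  proof -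
    have "\<exists>\<xi>. \<bar>\<xi> - z\<bar> \<le> \<bar>z - w\<bar> \<and> L z - L w = (z - w) * (L \<xi> * (1 - L \<xi>))"
    proof (cases z w rule: linorder_cases)
      case less
      from MVT2[OF less, of L "\<lambda>z. L z * (1 - L z)"] L' obtain \<xi> where
        "z < \<xi>" "\<xi> < w" "L w - L z = (w - z) * (L \<xi> * (1 - L \<xi>))" by auto
      then show ?thesis by (intro exI[of _ \<xi>]) (auto simp: algebra_simps)
    next
      case greater
      from MVT2[OF greater, of L "\<lambda>z. L z * (1 - L z)"] L' obtain \<xi> where
        "w < \<xi>" "\<xi> < z" "L z - L w = (z - w) * (L \<xi> * (1 - L \<xi>))" by auto
      then show ?thesis by (intro exI[of _ \<xi>]) auto
    qed auto
    then obtain \<xi> where \<xi>: "\<bar>\<xi> - z\<bar> \<le> \<bar>z - w\<bar>" "L z - L w = (z - w) * (L \<xi> * (1 - L \<xi>))" by blast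
    have "L z - L w - L z * (1 - L z) * (z - w) = (z - w) * ((L \<xi> - L z) * (1 - L \<xi> - L z))"
      unfolding \<xi>(2) by (simp add: algebra_simps)
    also have "\<bar>\<dots>\<bar> \<le> \<bar>z - w\<bar> * (\<bar>z - w\<bar> * 1)"
      unfolding abs_mult using L01[of z] L01[of \<xi>] lip[of \<xi> z] \<xi>(1)
      by (intro mult_left_mono mult_mono) auto
    finally show ?thesis by (simp add: power2_eq_square abs_mult_self_eq)
  qed
  have "theta x \<beta> = L (x \<bullet> \<beta>)" for \<beta> by (simp add: theta_def L_def)
  then show ?thesis
    using rem[of "x \<bullet> \<beta>" "x \<bullet> \<beta>'"] by (simp add: logit_sd_square inner_diff_right)
qed

text \<open>
  Testing the score equation against \<open>\<beta> - \<beta>\<^sub>0\<close> and grouping the noise by covariate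
  pattern: \<open>s (t i)\<close> stands for \<open>logit_sd (t i) \<beta> * (t i \<bullet> (\<beta> - \<beta>\<^sub>0))\<close>, \<open>f (t i)\<close> for
  \<open>1 / logit_sd (t i) \<beta>\<close> and \<open>e (t i)\<close> for the linearisation error of \<open>theta\<close>
  divided by \<open>logit_sd (t i) \<beta>\<close>.
\<close>

lemma score_root_bound:
  fixes t :: "'i \<Rightarrow> 'x" and s f e :: "'x \<Rightarrow> real" and Z :: "'i \<Rightarrow> real"
  assumes S: "finite S" and X: "finite X" and tX: "t ` S \<subseteq> X" and g: "0 < g" and F: "0 \<le> F" and C: "0 \<le> C"
    and G: "coercive_on S g G" and Gsym: "\<And>i j. i \<in> S \<Longrightarrow> j \<in> S \<Longrightarrow> G i j = G j i"
    and row: "\<And>i. i \<in> S \<Longrightarrow> (\<Sum>j\<in>S. \<bar>G i j\<bar>) \<le> C"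
    and f: "\<And>x. x \<in> X \<Longrightarrow> \<bar>f x\<bar> \<le> F"
    and e: "\<And>x. x \<in> X \<Longrightarrow> \<bar>e x\<bar> \<le> \<eta> * \<bar>s x\<bar>" and \<eta>: "C * \<eta> \<le> g / 2" "0 \<le> \<eta>"
    and root: "(\<Sum>i\<in>S. \<Sum>k\<in>S. s (t i) * G i k * (f (t k) * Z k - s (t k) - e (t k))) = 0"
    and x: "x \<in> X"
  defines "n \<equiv> \<lambda>x. card {i\<in>S. t i = x}"
  defines "W \<equiv> \<lambda>x y. \<Sum>i | i \<in> S \<and> t i = x. \<Sum>k | k \<in> S \<and> t k = y. G i k * Z k"
  shows "real (n x) * (s x)\<^sup>2 \<le> (2 * F / g)\<^sup>2 * real (card X) * (\<Sum>x\<in>X. \<Sum>y\<in>X. (W x y)\<^sup>2 / real (n x))"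
proof -
  define H where "H = (\<Sum>i\<in>S. (s (t i))\<^sup>2)"
  define Q where "Q = (\<Sum>x\<in>X. \<Sum>y\<in>X. (W x y)\<^sup>2 / real (n x))"
  have Q0: "0 \<le> Q" by (simp add: Q_def sum_nonneg)
  have H0: "0 \<le> H" by (simp add: H_def sum_nonneg)
  have group: "(\<Sum>i\<in>S. h i) = (\<Sum>x\<in>X. \<Sum>i | i \<in> S \<and> t i = x. h i)" for h :: "'i \<Rightarrow> real"
    using sum.group[OF S X tX, of h] by simp
  have HX: "H = (\<Sum>x\<in>X. real (n x) * (s x)\<^sup>2)"
    unfolding H_def group n_def by (intro sum.cong) auto
  \<comment> \<open>\<open>s\<close> and \<open>f\<close> are constant on pattern classes, so all
    dependence on \<open>\<beta>\<close> leaves the inner sums.\<close>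
  have noise: "(\<Sum>i\<in>S. \<Sum>k\<in>S. s (t i) * G i k * (f (t k) * Z k)) = (\<Sum>x\<in>X. \<Sum>y\<in>X. s x * f y * W x y)"
  proof -
    have "(\<Sum>i\<in>S. \<Sum>k\<in>S. s (t i) * G i k * (f (t k) * Z k))
        = (\<Sum>x\<in>X. \<Sum>i | i \<in> S \<and> t i = x. \<Sum>y\<in>X. \<Sum>k | k \<in> S \<and> t k = y. s (t i) * G i k * (f (t k) * Z k))"
      unfolding group ..
    also have "\<dots> = (\<Sum>x\<in>X. \<Sum>i | i \<in> S \<and> t i = x. \<Sum>y\<in>X. \<Sum>k | k \<in> S \<and> t k = y. s x * f y * (G i k * Z k))"
      by (intro sum.cong) auto
    also have "\<dots> = (\<Sum>x\<in>X. \<Sum>y\<in>X. \<Sum>i | i \<in> S \<and> t i = x. \<Sum>k | k \<in> S \<and> t k = y. s x * f y * (G i k * Z k))"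
      by (intro sum.cong refl sum.swap)
    also have "\<dots> = (\<Sum>x\<in>X. \<Sum>y\<in>X. s x * f y * W x y)"
      unfolding W_def sum_distrib_left ..
    finally show ?thesis .
  qed
  have "g * H \<le> (\<Sum>i\<in>S. \<Sum>k\<in>S. s (t i) * s (t k) * G i k)"
    using G unfolding coercive_on_def H_def by (rule allE)
  also have "\<dots> = (\<Sum>i\<in>S. \<Sum>k\<in>S. s (t i) * G i k * (f (t k) * Z k)) - (\<Sum>i\<in>S. \<Sum>k\<in>S. s (t i) * G i k * e (t k))
      - (\<Sum>i\<in>S. \<Sum>k\<in>S. s (t i) * G i k * (f (t k) * Z k - s (t k) - e (t k)))"
    by (simp add: sum_subtractf[symmetric] algebra_simps)
  also have "\<dots> = (\<Sum>x\<in>X. \<Sum>y\<in>X. s x * f y * W x y) - (\<Sum>i\<in>S. \<Sum>k\<in>S. s (t i) * G i k * e (t k))"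
    by (simp only: root noise)
  finally have gH0: "g * H \<le> (\<Sum>x\<in>X. \<Sum>y\<in>X. s x * f y * W x y) - (\<Sum>i\<in>S. \<Sum>k\<in>S. s (t i) * G i k * e (t k))" .
  \<comment> \<open>By the Schur test the linearisation error uses up half of the coercivity
    constant; the noise below takes another quarter.\<close>
  have "- (\<Sum>i\<in>S. \<Sum>k\<in>S. s (t i) * G i k * e (t k)) \<le> g / 2 * H"
  proof -
    have "- (\<Sum>i\<in>S. \<Sum>k\<in>S. s (t i) * G i k * e (t k)) = (\<Sum>i\<in>S. \<Sum>k\<in>S. - (s (t i) * G i k * e (t k)))"
      by (simp add: sum_negf)
    also have "\<dots> \<le> (\<Sum>i\<in>S. \<Sum>k\<in>S. \<eta> * (\<bar>s (t i)\<bar> * \<bar>G i k\<bar> * \<bar>s (t k)\<bar>))"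
    proof (intro sum_mono)
      fix i k assume "i \<in> S" "k \<in> S"
      then have "\<bar>e (t k)\<bar> \<le> \<eta> * \<bar>s (t k)\<bar>" using e tX by blast
      then have "\<bar>s (t i) * G i k * e (t k)\<bar> \<le> \<bar>s (t i)\<bar> * \<bar>G i k\<bar> * (\<eta> * \<bar>s (t k)\<bar>)"
        unfolding abs_mult by (intro mult_left_mono) auto
      then show "- (s (t i) * G i k * e (t k)) \<le> \<eta> * (\<bar>s (t i)\<bar> * \<bar>G i k\<bar> * \<bar>s (t k)\<bar>)"
        by (simp add: abs_le_iff mult_ac)
    qed
    also have "\<dots> = \<eta> * (\<Sum>i\<in>S. \<Sum>k\<in>S. \<bar>s (t i)\<bar> * \<bar>G i k\<bar> * \<bar>s (t k)\<bar>)"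
      by (simp add: sum_distrib_left)
    also have "\<dots> \<le> \<eta> * (C * H)"
      unfolding H_def using \<eta>(2) by (intro mult_left_mono schur_test row) (auto simp: Gsym)
    also have "\<dots> \<le> g / 2 * H" using mult_right_mono[OF \<eta>(1) H0] by (simp add: mult_ac)
    finally show ?thesis .
  qed
  with gH0 have gH: "g / 2 * H \<le> (\<Sum>x\<in>X. \<Sum>y\<in>X. s x * f y * W x y)" by linarith
  \<comment> \<open>A pattern without sites makes the quotient by \<open>n x\<close> equal to
    \<open>0\<close> by convention; this loses nothing, because its noise sum is empty.\<close>
  have W0: "W x y = 0" if "n x = 0" for x y
  proof -
    have "{i \<in> S. t i = x} = {}" using that S by (simp add: n_def)
    then show ?thesis by (simp only: W_def sum.empty)
  qed
  have "(\<Sum>x\<in>X. \<Sum>y\<in>X. s x * f y * W x y) \<le> (\<Sum>x\<in>X. \<Sum>y\<in>X. g / (4 * card X) * (n x * (s x)\<^sup>2) + F\<^sup>2 * card X / g * ((W x y)\<^sup>2 / n x))"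
  proof (intro sum_mono)
    fix x y assume xy: "x \<in> X" "y \<in> X"
    then have c: "0 < real (card X)" using X by (auto simp: card_gt_0_iff)
    show "s x * f y * W x y \<le> g / (4 * card X) * (n x * (s x)\<^sup>2) + F\<^sup>2 * card X / g * ((W x y)\<^sup>2 / n x)"
    proof (cases "n x = 0")
      case True then show ?thesis using W0 by simp
    next
      case False
      then have n: "0 < real (n x)" by simp
      have "s x * f y * W x y \<le> F * (\<bar>s x\<bar> * \<bar>W x y\<bar>)"
      proof -
        have "s x * f y * W x y \<le> \<bar>s x\<bar> * \<bar>f y\<bar> * \<bar>W x y\<bar>" by (simp add: abs_mult[symmetric])
        also have "\<dots> \<le> \<bar>s x\<bar> * F * \<bar>W x y\<bar>" using f xy by (intro mult_right_mono mult_left_mono) auto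
        finally show ?thesis by (simp add: mult_ac)
      qed
      also have "F * (\<bar>s x\<bar> * \<bar>W x y\<bar>) \<le> g / (4 * card X) * (n x * (s x)\<^sup>2) + F\<^sup>2 * card X / g * ((W x y)\<^sup>2 / n x)"
      proof -
        \<comment> \<open>Young's inequality as a square. The factor \<open>1 / card X\<close> in
          \<open>p\<close> compensates for the sum over \<open>y\<close>, so that all pairs together
          cost \<open>g / 4 * H\<close>.\<close>
        define p where "p = g * n x * \<bar>s x\<bar> / (2 * card X)"
        define r where "r = F * \<bar>W x y\<bar>"
        have "0 \<le> (p - r)\<^sup>2 * (card X / (g * n x))" using g n c by (intro mult_nonneg_nonneg) auto
        also have "\<dots> = g / (4 * card X) * (n x * (s x)\<^sup>2) + F\<^sup>2 * card X / g * ((W x y)\<^sup>2 / n x) - F * (\<bar>s x\<bar> * \<bar>W x y\<bar>)"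
          using g n c by (simp add: p_def r_def power2_diff power_mult_distrib power_divide field_simps power2_eq_square)
        finally show ?thesis by simp
      qed
      finally show ?thesis .
    qed
  qed
  also have "\<dots> = g / 4 * H + F\<^sup>2 * card X / g * Q"
  proof -
    have "real (card X) \<noteq> 0" using X x by auto
    then have "(\<Sum>x\<in>X. \<Sum>y\<in>X. g / (4 * card X) * (n x * (s x)\<^sup>2)) = g / 4 * H"
      by (simp add: HX sum_distrib_left)
    then show ?thesis by (simp add: sum.distrib Q_def sum_distrib_left)
  qed
  finally have "(\<Sum>x\<in>X. \<Sum>y\<in>X. s x * f y * W x y) \<le> g / 4 * H + F\<^sup>2 * card X / g * Q" .
  with gH have "g / 4 * H \<le> F\<^sup>2 * card X / g * Q" by linarith
  then have "H \<le> (2 * F / g)\<^sup>2 * card X * Q"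
    using g by (simp add: field_simps power2_eq_square)
  moreover have "real (n x) * (s x)\<^sup>2 \<le> H"
    unfolding HX by (rule member_le_sum) (use x X in auto)
  ultimately show ?thesis by (simp add: Q_def)
qed

section \<open>Moment bounds for a single grid\<close>

text \<open>Schur's bound for the operator norm: write \<open>\<bar>A i j\<bar>\<close> as a product
  of two square roots, apply Cauchy-Schwarz along rows, then sum along columns.\<close>

lemma matrix_norm_bound:
  fixes A :: "'i \<Rightarrow> 'i \<Rightarrow> real"
  assumes S: "finite S" and C: "0 \<le> C"
    and row: "\<And>i. i \<in> S \<Longrightarrow> (\<Sum>j\<in>S. \<bar>A i j\<bar>) \<le> C"
    and col: "\<And>j. j \<in> S \<Longrightarrow> (\<Sum>i\<in>S. \<bar>A i j\<bar>) \<le> C"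
  shows "(\<Sum>i\<in>S. (\<Sum>j\<in>S. A i j * u j)\<^sup>2) \<le> C\<^sup>2 * (\<Sum>j\<in>S. (u j)\<^sup>2)"
proof -
  have "(\<Sum>j\<in>S. A i j * u j)\<^sup>2 \<le> C * (\<Sum>j\<in>S. \<bar>A i j\<bar> * (u j)\<^sup>2)" if i: "i \<in> S" for i
  proof -
    have "\<bar>\<Sum>j\<in>S. A i j * u j\<bar> \<le> (\<Sum>j\<in>S. sqrt \<bar>A i j\<bar> * (sqrt \<bar>A i j\<bar> * \<bar>u j\<bar>))"
      by (rule order_trans[OF sum_abs]) (simp add: abs_mult mult.assoc[symmetric])
    then have "\<bar>\<Sum>j\<in>S. A i j * u j\<bar>\<^sup>2 \<le> (\<Sum>j\<in>S. sqrt \<bar>A i j\<bar> * (sqrt \<bar>A i j\<bar> * \<bar>u j\<bar>))\<^sup>2"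
      by (intro power_mono) auto
    also have "\<dots> \<le> (\<Sum>j\<in>S. (sqrt \<bar>A i j\<bar>)\<^sup>2) * (\<Sum>j\<in>S. (sqrt \<bar>A i j\<bar> * \<bar>u j\<bar>)\<^sup>2)"
      by (rule Cauchy_Schwarz_ineq_sum)
    also have "\<dots> = (\<Sum>j\<in>S. \<bar>A i j\<bar>) * (\<Sum>j\<in>S. \<bar>A i j\<bar> * (u j)\<^sup>2)"
      by (simp add: power_mult_distrib)
    also have "\<dots> \<le> C * (\<Sum>j\<in>S. \<bar>A i j\<bar> * (u j)\<^sup>2)"
      using row[OF i] by (intro mult_right_mono sum_nonneg) auto
    finally show ?thesis by simp
  qed
  then have "(\<Sum>i\<in>S. (\<Sum>j\<in>S. A i j * u j)\<^sup>2) \<le> (\<Sum>i\<in>S. C * (\<Sum>j\<in>S. \<bar>A i j\<bar> * (u j)\<^sup>2))"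
    by (rule sum_mono)
  also have "\<dots> = C * (\<Sum>j\<in>S. (\<Sum>i\<in>S. \<bar>A i j\<bar>) * (u j)\<^sup>2)"
    by (simp add: sum_distrib_left sum_distrib_right) (rule sum.swap)
  also have "\<dots> \<le> C * (\<Sum>j\<in>S. C * (u j)\<^sup>2)"
    using C col by (intro mult_left_mono sum_mono mult_right_mono) auto
  finally show ?thesis by (simp add: sum_distrib_left power2_eq_square mult_ac)
qed

text \<open>With \<open>u = B h\<close> one has \<open>h = A u\<close>, so the norm bound on
  \<open>A\<close> gives \<open>\<Sum> h\<^sup>2 \<le> C\<^sup>2 * \<Sum> u\<^sup>2\<close>, and the
  form of \<open>B\<close> at \<open>h\<close> is the form of \<open>A\<close> at \<open>u\<close>.
  The second claim keeps the latter form, which later appears as a second moment.\<close>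

lemma inverse_coercive:
  fixes A :: site_matrix
  assumes S: "finite S" and co: "coercive_on S l A" and l: "0 < l" and C: "0 < C"
    and sym: "\<And>i j. i \<in> S \<Longrightarrow> j \<in> S \<Longrightarrow> A i j = A j i"
    and row: "\<And>i. i \<in> S \<Longrightarrow> (\<Sum>j\<in>S. \<bar>A i j\<bar>) \<le> C"
    and B: "inverse_on S A B"
  shows "coercive_on S (l / C\<^sup>2) B"
    and "l / C\<^sup>2 * (\<Sum>i\<in>S. (h i)\<^sup>2) \<le> (\<Sum>k\<in>S. \<Sum>k'\<in>S. (\<Sum>i\<in>S. h i * B i k) * (\<Sum>i\<in>S. h i * B i k') * A k k')"
proof -
  have Bsym: "B i j = B j i" if "i \<in> S" "j \<in> S" for i j
    by (rule inverse_on_symmetric[OF S B sym that])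
  have *: "l / C\<^sup>2 * (\<Sum>i\<in>S. (h i)\<^sup>2) \<le> (\<Sum>k\<in>S. \<Sum>k'\<in>S. (\<Sum>i\<in>S. h i * B i k) * (\<Sum>i\<in>S. h i * B i k') * A k k')" for h
  proof -
    define u where "u k = (\<Sum>i\<in>S. h i * B i k)" for k
    have h: "h i = (\<Sum>k\<in>S. A i k * u k)" if i: "i \<in> S" for i
    proof -
      have "(\<Sum>k\<in>S. A i k * u k) = (\<Sum>j\<in>S. h j * (\<Sum>k\<in>S. B j k * A k i))"
        unfolding u_def sum_distrib_left
        by (subst sum.swap) (use sym i in \<open>auto simp: mult_ac intro!: sum.cong\<close>)
      also have "\<dots> = (\<Sum>j\<in>S. if j = i then h j else 0)"
        using B i by (intro sum.cong) (auto simp: inverse_on_def)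
      finally show ?thesis using S i by simp
    qed
    have "(\<Sum>i\<in>S. (h i)\<^sup>2) = (\<Sum>i\<in>S. (\<Sum>k\<in>S. A i k * u k)\<^sup>2)" using h by simp
    also have "\<dots> \<le> C\<^sup>2 * (\<Sum>k\<in>S. (u k)\<^sup>2)"
    proof (rule matrix_norm_bound[OF S _ row])
      show "(\<Sum>i\<in>S. \<bar>A i j\<bar>) \<le> C" if "j \<in> S" for j
        using row[OF that] sym that by (simp cong: sum.cong)
    qed (use C in auto)
    finally have "l / C\<^sup>2 * (\<Sum>i\<in>S. (h i)\<^sup>2) \<le> l / C\<^sup>2 * (C\<^sup>2 * (\<Sum>k\<in>S. (u k)\<^sup>2))"
      using l by (intro mult_left_mono) auto
    also have "\<dots> = l * (\<Sum>k\<in>S. (u k)\<^sup>2)" using C by simp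
    also have "\<dots> \<le> (\<Sum>k\<in>S. \<Sum>k'\<in>S. u k * u k' * A k k')"
      using co unfolding coercive_on_def by blast
    finally show ?thesis by (simp add: u_def)
  qed
  show "coercive_on S (l / C\<^sup>2) B"
    unfolding coercive_on_def
  proof
    fix h :: "site \<Rightarrow> real"
    define u where "u k = (\<Sum>i\<in>S. h i * B i k)" for k
    have "(\<Sum>k\<in>S. \<Sum>k'\<in>S. u k * u k' * A k k') = (\<Sum>k\<in>S. u k * (\<Sum>k'\<in>S. u k' * A k k'))"
      by (simp add: sum_distrib_left mult_ac)
    also have "\<dots> = (\<Sum>k\<in>S. u k * h k)"
    proof (intro sum.cong refl arg_cong2[where f = "(*)"])
      fix k assume k: "k \<in> S"
      have "(\<Sum>k'\<in>S. u k' * A k k') = (\<Sum>i\<in>S. h i * (\<Sum>k'\<in>S. B i k' * A k' k))"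
        unfolding u_def sum_distrib_left sum_distrib_right
        by (subst sum.swap) (use sym k in \<open>auto simp: mult_ac intro!: sum.cong\<close>)
      also have "\<dots> = (\<Sum>i\<in>S. if i = k then h i else 0)"
        using B k by (intro sum.cong) (auto simp: inverse_on_def)
      finally show "(\<Sum>k'\<in>S. u k' * A k k') = h k" using S k by simp
    qed
    also have "\<dots> = (\<Sum>i\<in>S. \<Sum>k\<in>S. h i * h k * B i k)"
      unfolding u_def sum_distrib_right by (subst sum.swap) (simp add: mult_ac)
    finally show "l / C\<^sup>2 * (\<Sum>i\<in>S. (h i)\<^sup>2) \<le> (\<Sum>i\<in>S. \<Sum>k\<in>S. h i * h k * B i k)"
      using *[of h] by (simp add: u_def)
  qed
  show "l / C\<^sup>2 * (\<Sum>i\<in>S. (h i)\<^sup>2) \<le> (\<Sum>k\<in>S. \<Sum>k'\<in>S. (\<Sum>i\<in>S. h i * B i k) * (\<Sum>i\<in>S. h i * B i k') * A k k')"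
    by (rule *)
qed

text \<open>One grid with assumptions on the margins only. This layer is separate because the
  exclusion of \<rho> = 1 needs it before any bound on the correlation matrix is at hand.\<close>

locale logistic_responses = prob_space M for M :: "'w measure" +
  fixes S :: "site set" and Y :: "site \<Rightarrow> 'w \<Rightarrow> real" and t :: "site \<Rightarrow> real ^ 'q" and \<beta>\<^sub>0 :: "real ^ 'q"
  assumes finite_sites: "finite S"
    and response_measurable: "i \<in> S \<Longrightarrow> Y i \<in> borel_measurable M"
    and response_binary: "i \<in> S \<Longrightarrow> \<omega> \<in> space M \<Longrightarrow> Y i \<omega> \<in> {0, 1}"
    and response_mean: "i \<in> S \<Longrightarrow> expectation (Y i) = theta (t i) \<beta>\<^sub>0"
begin

definition Z :: "site \<Rightarrow> 'w \<Rightarrow> real" where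
  "Z i \<omega> = Y i \<omega> - theta (t i) \<beta>\<^sub>0"

definition \<Gamma> :: site_matrix where
  "\<Gamma> i j = correlation M (Y i) (Y j)"

definition \<sigma> :: "site \<Rightarrow> real" where
  "\<sigma> i = logit_sd (t i) \<beta>\<^sub>0"

lemma sigma_bounds: "0 < \<sigma> i" "\<sigma> i \<le> 1"
  unfolding \<sigma>_def by (rule logit_sd_bounds)+

lemma Z_measurable: "i \<in> S \<Longrightarrow> Z i \<in> borel_measurable M"
  unfolding Z_def[abs_def] using response_measurable by measurable

lemma abs_Z_le: "i \<in> S \<Longrightarrow> \<omega> \<in> space M \<Longrightarrow> \<bar>Z i \<omega>\<bar> \<le> 1"
  using response_binary[of i \<omega>] theta_bounds[of "t i" \<beta>\<^sub>0] by (auto simp: Z_def)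

lemma integrable_response:
  assumes i: "i \<in> S"
  shows "integrable M (Y i)"
proof (rule integrable_const_bound[where B = 1])
  show "AE \<omega> in M. norm (Y i \<omega>) \<le> 1"
    using response_binary[OF i] by (intro AE_I2) fastforce
qed (rule response_measurable[OF i])

lemma integrable_Z_mult: "i \<in> S \<Longrightarrow> j \<in> S \<Longrightarrow> integrable M (\<lambda>\<omega>. Z i \<omega> * Z j \<omega>)"
  by (rule integrable_const_bound[where B = 1])
    (auto intro!: AE_I2 mult_le_one abs_Z_le borel_measurable_times Z_measurable simp: abs_mult)

lemma variance_response:
  assumes i: "i \<in> S"
  shows "variance (Y i) = (\<sigma> i)\<^sup>2"
proof -
  define \<theta> where "\<theta> = theta (t i) \<beta>\<^sub>0"
  have "variance (Y i) = (\<integral>\<omega>. Y i \<omega> * (1 - 2 * \<theta>) + \<theta>\<^sup>2 \<partial>M)"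
    unfolding response_mean[OF i] \<theta>_def[symmetric]
    using response_binary[OF i] by (intro Bochner_Integration.integral_cong refl) (auto simp: power2_eq_square algebra_simps)
  also have "\<dots> = \<theta> * (1 - 2 * \<theta>) + \<theta>\<^sup>2"
    using integrable_response[OF i] by (simp add: response_mean[OF i] \<theta>_def prob_space)
  also have "\<dots> = (\<sigma> i)\<^sup>2"
    unfolding \<sigma>_def logit_sd_square \<theta>_def by (simp add: power2_eq_square algebra_simps)
  finally show ?thesis .
qed

lemma expectation_Z_mult:
  assumes ij: "i \<in> S" "j \<in> S"
  shows "expectation (\<lambda>\<omega>. Z i \<omega> * Z j \<omega>) = \<sigma> i * \<sigma> j * \<Gamma> i j"
proof -
  have "sqrt (variance (Y i) * variance (Y j)) = \<sigma> i * \<sigma> j"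
    using sigma_bounds(1)[of i] sigma_bounds(1)[of j]
    by (simp add: variance_response ij real_sqrt_mult)
  then have "\<Gamma> i j = expectation (\<lambda>\<omega>. Z i \<omega> * Z j \<omega>) / (\<sigma> i * \<sigma> j)"
    by (simp add: \<Gamma>_def correlation_def Z_def response_mean ij)
  then show ?thesis using sigma_bounds(1)[of i] sigma_bounds(1)[of j] by simp
qed

lemma \<Gamma>_diag: "i \<in> S \<Longrightarrow> \<Gamma> i i = 1"
  using expectation_Z_mult[of i i] variance_response[of i] sigma_bounds(1)[of i]
  by (simp add: Z_def[symmetric] response_mean power2_eq_square)

lemma \<Gamma>_commute: "\<Gamma> i j = \<Gamma> j i"
  by (simp add: \<Gamma>_def correlation_def mult.commute)

lemma linear_combination_square:
  "integrable M (\<lambda>\<omega>. (\<Sum>k\<in>S. b k * Z k \<omega>)\<^sup>2)"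
  "expectation (\<lambda>\<omega>. (\<Sum>k\<in>S. b k * Z k \<omega>)\<^sup>2) = (\<Sum>k\<in>S. \<Sum>k'\<in>S. (b k * \<sigma> k) * (b k' * \<sigma> k') * \<Gamma> k k')"
proof -
  have eq: "(\<lambda>\<omega>. (\<Sum>k\<in>S. b k * Z k \<omega>)\<^sup>2) = (\<lambda>\<omega>. \<Sum>k\<in>S. \<Sum>k'\<in>S. b k * b k' * (Z k \<omega> * Z k' \<omega>))"
    by (simp add: power2_eq_square sum_product mult_ac)
  show "integrable M (\<lambda>\<omega>. (\<Sum>k\<in>S. b k * Z k \<omega>)\<^sup>2)"
    unfolding eq by (intro Bochner_Integration.integrable_sum integrable_mult_right integrable_Z_mult)
  have "expectation (\<lambda>\<omega>. (\<Sum>k\<in>S. b k * Z k \<omega>)\<^sup>2) = (\<Sum>k\<in>S. \<Sum>k'\<in>S. b k * b k' * (\<sigma> k * \<sigma> k' * \<Gamma> k k'))"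
    unfolding eq by (simp add: Bochner_Integration.integral_sum integrable_Z_mult expectation_Z_mult cong: sum.cong)
  then show "expectation (\<lambda>\<omega>. (\<Sum>k\<in>S. b k * Z k \<omega>)\<^sup>2) = (\<Sum>k\<in>S. \<Sum>k'\<in>S. (b k * \<sigma> k) * (b k' * \<sigma> k') * \<Gamma> k k')"
    by (simp add: mult_ac)
qed

end

text \<open>\<open>l\<close>, \<open>C\<close> and \<open>X\<close> are parameters, so the bounds
  obtained here are uniform along a sequence of grids that shares them.\<close>

locale bounded_correlation = logistic_responses M S Y t \<beta>\<^sub>0
  for M :: "'w measure" and S Y and t :: "site \<Rightarrow> real ^ 'q" and \<beta>\<^sub>0 +
  fixes l C :: real and X :: "(real ^ 'q) set"
  assumes l: "0 < l" and C: "0 < C"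
    and \<Gamma>_coercive: "coercive_on S l \<Gamma>" and \<Gamma>_invertible: "invertible_on S \<Gamma>"
    and \<Gamma>_row: "i \<in> S \<Longrightarrow> (\<Sum>j\<in>S. \<bar>\<Gamma> i j\<bar>) \<le> C"
    and inverse_col: "inverse_on S \<Gamma> B \<Longrightarrow> k \<in> S \<Longrightarrow> (\<Sum>j\<in>S. \<bar>B j k\<bar>) \<le> C"
    and finite_patterns: "finite X" and patterns: "t ` S \<subseteq> X"
begin

definition G :: site_matrix where "G = inv_on S \<Gamma>"

definition U :: "'w \<Rightarrow> real ^ 'q \<Rightarrow> real ^ 'q" where
  "U \<omega> = quasi_score S t \<Gamma> (\<lambda>i. Y i \<omega>)"

lemma inverse_G: "inverse_on S \<Gamma> G"
  unfolding G_def using \<Gamma>_invertible by (rule inverse_on_inv_on)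

lemma G_commute: "i \<in> S \<Longrightarrow> j \<in> S \<Longrightarrow> G i j = G j i"
  by (rule inverse_on_symmetric[OF finite_sites inverse_G]) (auto simp: \<Gamma>_commute)

lemma G_col: "k \<in> S \<Longrightarrow> (\<Sum>j\<in>S. \<bar>G j k\<bar>) \<le> C"
  by (rule inverse_col[OF inverse_G])

lemma G_row: "k \<in> S \<Longrightarrow> (\<Sum>j\<in>S. \<bar>G k j\<bar>) \<le> C"
  using G_col[of k] by (simp add: G_commute[of k] cong: sum.cong)

lemma G_coercive: "coercive_on S (l / C\<^sup>2) G"
  by (rule inverse_coercive(1)[OF finite_sites \<Gamma>_coercive l C \<Gamma>_commute \<Gamma>_row inverse_G])

lemma inner_U:
  "v \<bullet> U \<omega> \<beta> = (\<Sum>i\<in>S. \<Sum>k\<in>S. (v \<bullet> t i) * logit_sd (t i) \<beta> * G i k * ((Y k \<omega> - theta (t k) \<beta>) / logit_sd (t k) \<beta>))"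
  unfolding U_def G_def by (rule inner_quasi_score[OF finite_sites \<Gamma>_invertible])

definition num :: "real ^ 'q \<Rightarrow> nat" where "num x = card {i \<in> S. t i = x}"

text \<open>The noise from sites of pattern \<open>y\<close> as it reaches, through
  \<open>G\<close>, the sites of pattern \<open>x\<close>.\<close>

definition W :: "real ^ 'q \<Rightarrow> real ^ 'q \<Rightarrow> 'w \<Rightarrow> real" where
  "W x y \<omega> = (\<Sum>i | i \<in> S \<and> t i = x. \<Sum>k | k \<in> S \<and> t k = y. G i k * Z k \<omega>)"

definition Q :: "'w \<Rightarrow> real" where
  "Q \<omega> = (\<Sum>x\<in>X. \<Sum>y\<in>X. (W x y \<omega>)\<^sup>2 / real (num x))"

text \<open>\<open>W x y\<close> is a combination of the \<open>Z k\<close> with coefficients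
  \<open>G\<close> applied to the indicator of class \<open>x\<close>, cut down to class
  \<open>y\<close>. One factor \<open>C\<close> comes from the covariances, two from the squared
  norm of \<open>G\<close>; the class of \<open>y\<close> does not enter the bound.\<close>

lemma expectation_W_square:
  "integrable M (\<lambda>\<omega>. (W x y \<omega>)\<^sup>2)" "expectation (\<lambda>\<omega>. (W x y \<omega>)\<^sup>2) \<le> C ^ 3 * real (num x)"
proof -
  define b where "b k = (\<Sum>i\<in>S. G k i * indicator {i. t i = x} i)" for k
  define b' where "b' k = (if t k = y then b k else 0)" for k
  have W: "W x y \<omega> = (\<Sum>k\<in>S. b' k * Z k \<omega>)" for \<omega>
  proof -
    have "W x y \<omega> = (\<Sum>k | k \<in> S \<and> t k = y. \<Sum>i | i \<in> S \<and> t i = x. G k i * Z k \<omega>)"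
      unfolding W_def by (subst sum.swap) (auto simp: G_commute intro!: sum.cong)
    also have "\<dots> = (\<Sum>k | k \<in> S \<and> t k = y. b k * Z k \<omega>)"
      using finite_sites unfolding b_def sum_distrib_right
      by (intro sum.cong refl sum.mono_neutral_cong_left) (auto simp: indicator_def)
    also have "\<dots> = (\<Sum>k\<in>S. b' k * Z k \<omega>)"
      using finite_sites by (intro sum.mono_neutral_cong_left) (auto simp: b'_def)
    finally show ?thesis .
  qed
  show "integrable M (\<lambda>\<omega>. (W x y \<omega>)\<^sup>2)" unfolding W by (rule linear_combination_square(1))
  have "expectation (\<lambda>\<omega>. (W x y \<omega>)\<^sup>2) = (\<Sum>k\<in>S. \<Sum>k'\<in>S. (b' k * \<sigma> k) * (b' k' * \<sigma> k') * \<Gamma> k k')"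
    unfolding W by (rule linear_combination_square(2))
  also have "\<dots> \<le> (\<Sum>k\<in>S. \<Sum>k'\<in>S. \<bar>b' k * \<sigma> k\<bar> * \<bar>\<Gamma> k k'\<bar> * \<bar>b' k' * \<sigma> k'\<bar>)"
  proof (intro sum_mono)
    fix k k'
    have "(b' k * \<sigma> k) * (b' k' * \<sigma> k') * \<Gamma> k k' \<le> \<bar>(b' k * \<sigma> k) * (b' k' * \<sigma> k') * \<Gamma> k k'\<bar>" by simp
    then show "(b' k * \<sigma> k) * (b' k' * \<sigma> k') * \<Gamma> k k' \<le> \<bar>b' k * \<sigma> k\<bar> * \<bar>\<Gamma> k k'\<bar> * \<bar>b' k' * \<sigma> k'\<bar>"
      unfolding abs_mult by (simp only: mult_ac)
  qed
  also have "\<dots> \<le> C * (\<Sum>k\<in>S. (b' k * \<sigma> k)\<^sup>2)"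
    by (rule schur_test) (auto simp: \<Gamma>_commute \<Gamma>_row)
  also have "\<dots> \<le> C * (\<Sum>k\<in>S. (b k)\<^sup>2)"
  proof (intro mult_left_mono sum_mono)
    fix k
    have "(\<sigma> k)\<^sup>2 \<le> 1" using sigma_bounds[of k] by (simp add: power_le_one)
    then have "(b k)\<^sup>2 * (\<sigma> k)\<^sup>2 \<le> (b k)\<^sup>2" by (intro mult_left_le) auto
    then show "(b' k * \<sigma> k)\<^sup>2 \<le> (b k)\<^sup>2" by (simp add: b'_def power_mult_distrib)
  qed (use C in simp)
  also have "\<dots> \<le> C * (C\<^sup>2 * (\<Sum>i\<in>S. (indicator {i. t i = x} i)\<^sup>2))"
    unfolding b_def using C
    by (intro mult_left_mono matrix_norm_bound finite_sites G_row G_col) auto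
  also have "(\<Sum>i\<in>S. (indicator {i. t i = x} i :: real)\<^sup>2) = (\<Sum>i\<in>S. of_bool (t i = x))"
    by (intro sum.cong) (auto simp: indicator_def)
  also have "\<dots> = real (num x)"
    using finite_sites by (simp add: num_def Int_def)
  finally show "expectation (\<lambda>\<omega>. (W x y \<omega>)\<^sup>2) \<le> C ^ 3 * real (num x)"
    by (simp add: power3_eq_cube power2_eq_square mult_ac)
qed

lemma expectation_Q: "integrable M Q" "expectation Q \<le> (real (card X))\<^sup>2 * C ^ 3"
proof -
  show "integrable M Q"
    unfolding Q_def[abs_def] using expectation_W_square(1)
    by (intro Bochner_Integration.integrable_sum integrable_divide)
  have "expectation Q = (\<Sum>x\<in>X. \<Sum>y\<in>X. expectation (\<lambda>\<omega>. (W x y \<omega>)\<^sup>2) / real (num x))"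
    unfolding Q_def[abs_def] using expectation_W_square(1)
    by (simp add: Bochner_Integration.integral_sum)
  also have "\<dots> \<le> (\<Sum>x\<in>X. \<Sum>y\<in>X. C ^ 3)"
  proof (intro sum_mono)
    fix x y
    show "expectation (\<lambda>\<omega>. (W x y \<omega>)\<^sup>2) / real (num x) \<le> C ^ 3"
    proof (cases "num x = 0")
      case True then show ?thesis using C by simp
    next
      case False then show ?thesis using expectation_W_square(2)[of x y] by (simp add: field_simps)
    qed
  qed
  finally show "expectation Q \<le> (real (card X))\<^sup>2 * C ^ 3" by (simp add: power2_eq_square)
qed

lemma Q_nonneg: "0 \<le> Q \<omega>"
  by (simp add: Q_def sum_nonneg)

text \<open>Here \<open>G\<close> has coercivity constant \<open>l / C\<^sup>2\<close>. The scaled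
  linearisation error is at most \<open>\<tau>\<^sup>2 / d = (\<bar>\<tau>\<bar> / d\<^sup>2) * (d *
  \<bar>\<tau>\<bar>)\<close>, which explains \<open>b / m\<^sup>2\<close>; the final division by
  \<open>m\<^sup>2\<close> removes the standard deviation from \<open>s\<close>.\<close>

lemma root_deviation_bound:
  assumes m: "0 < m" and sd: "\<And>x. x \<in> X \<Longrightarrow> m \<le> logit_sd x \<beta>"
    and b: "0 \<le> b" and near: "\<And>x. x \<in> X \<Longrightarrow> \<bar>x \<bullet> (\<beta> - \<beta>\<^sub>0)\<bar> \<le> b" and small: "C * (b / m\<^sup>2) \<le> l / C\<^sup>2 / 2"
    and root: "U \<omega> \<beta> = 0" and x: "x \<in> X"
  shows "real (num x) * (x \<bullet> (\<beta> - \<beta>\<^sub>0))\<^sup>2 \<le> (2 * (1 / m) / (l / C\<^sup>2))\<^sup>2 * real (card X) / m\<^sup>2 * Q \<omega>"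
proof -
  define s where "s x = logit_sd x \<beta> * (x \<bullet> (\<beta> - \<beta>\<^sub>0))" for x
  define e where "e x = (theta x \<beta> - theta x \<beta>\<^sub>0 - (logit_sd x \<beta>)\<^sup>2 * (x \<bullet> (\<beta> - \<beta>\<^sub>0))) / logit_sd x \<beta>" for x
  have eq: "1 / logit_sd (t k) \<beta> * Z k \<omega> - s (t k) - e (t k) = (Y k \<omega> - theta (t k) \<beta>) / logit_sd (t k) \<beta>" for k
    using logit_sd_bounds(1)[of "t k" \<beta>]
    by (simp add: s_def e_def Z_def field_simps power2_eq_square)
  have "real (num x) * (s x)\<^sup>2 \<le> (2 * (1 / m) / (l / C\<^sup>2))\<^sup>2 * real (card X) * Q \<omega>"
    unfolding Q_def W_def num_def
  proof (rule score_root_bound[where \<eta> = "b / m\<^sup>2" and e = e and f = "\<lambda>x. 1 / logit_sd x \<beta>" and C = C])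
    show "\<bar>1 / logit_sd x \<beta>\<bar> \<le> 1 / m" if "x \<in> X" for x
      using sd[OF that] m by (simp add: field_simps)
    show "\<bar>e x\<bar> \<le> b / m\<^sup>2 * \<bar>s x\<bar>" if x: "x \<in> X" for x
    proof -
      define \<tau> where "\<tau> = x \<bullet> (\<beta> - \<beta>\<^sub>0)"
      define d where "d = logit_sd x \<beta>"
      have d: "0 < d" "m \<le> d" using logit_sd_bounds(1)[of x \<beta>] sd[OF x] by (auto simp: d_def)
      have "\<bar>e x\<bar> \<le> \<tau>\<^sup>2 / d"
        unfolding e_def d_def[symmetric] \<tau>_def[symmetric] abs_divide
        using theta_remainder[of x \<beta> \<beta>\<^sub>0] d by (intro frac_le) (auto simp: d_def \<tau>_def)
      also have "\<tau>\<^sup>2 / d = \<bar>\<tau>\<bar> / d\<^sup>2 * (d * \<bar>\<tau>\<bar>)" using d by (simp add: power2_eq_square)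
      also have "\<dots> \<le> b / m\<^sup>2 * (d * \<bar>\<tau>\<bar>)"
        using d m b near[OF x] by (intro mult_right_mono frac_le power_mono) (auto simp: \<tau>_def)
      also have "d * \<bar>\<tau>\<bar> = \<bar>s x\<bar>" using d by (simp add: s_def d_def \<tau>_def abs_mult)
      finally show ?thesis .
    qed
    have "(\<Sum>i\<in>S. \<Sum>k\<in>S. s (t i) * G i k * (1 / logit_sd (t k) \<beta> * Z k \<omega> - s (t k) - e (t k))) = (\<beta> - \<beta>\<^sub>0) \<bullet> U \<omega> \<beta>"
      unfolding eq inner_U by (intro sum.cong) (auto simp: s_def inner_commute mult_ac)
    then show "(\<Sum>i\<in>S. \<Sum>k\<in>S. s (t i) * G i k * (1 / logit_sd (t k) \<beta> * Z k \<omega> - s (t k) - e (t k))) = 0"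
      by (simp add: root)
  qed (use finite_sites finite_patterns patterns l C m b small G_coercive G_commute G_row x in auto)
  moreover have "m\<^sup>2 * (real (num x) * (x \<bullet> (\<beta> - \<beta>\<^sub>0))\<^sup>2) \<le> real (num x) * (s x)\<^sup>2"
  proof -
    have "m\<^sup>2 \<le> (logit_sd x \<beta>)\<^sup>2" using sd[OF x] m by (intro power_mono) auto
    then have "m\<^sup>2 * (x \<bullet> (\<beta> - \<beta>\<^sub>0))\<^sup>2 \<le> (s x)\<^sup>2"
      by (simp add: s_def power_mult_distrib mult_right_mono)
    then show ?thesis using mult_left_mono[of _ _ "real (num x)"] by (simp add: mult.left_commute)
  qed
  ultimately have "m\<^sup>2 * (real (num x) * (x \<bullet> (\<beta> - \<beta>\<^sub>0))\<^sup>2) \<le> (2 * (1 / m) / (l / C\<^sup>2))\<^sup>2 * real (card X) * Q \<omega>"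
    by linarith
  then have "real (num x) * (x \<bullet> (\<beta> - \<beta>\<^sub>0))\<^sup>2 \<le> (2 * (1 / m) / (l / C\<^sup>2))\<^sup>2 * real (card X) * Q \<omega> / m\<^sup>2"
    using m by (simp only: pos_le_divide_eq zero_less_power mult.commute)
  then show ?thesis by simp
qed

text \<open>At most \<open>N\<close> rows are active and each is controlled by an absolute row sum
  of \<open>G\<close>, so the number of columns, that is the size of the grid, does not
  matter.\<close>

lemma weighted_form_bound:
  assumes a: "\<And>i. i \<in> S \<Longrightarrow> \<bar>a i\<bar> \<le> B" and B: "0 \<le> B" and num: "card {i \<in> S. a i \<noteq> 0} \<le> N"
    and c: "\<And>i k. i \<in> S \<Longrightarrow> k \<in> S \<Longrightarrow> \<bar>c i k\<bar> \<le> \<eta>" and \<eta>: "0 \<le> \<eta>"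
  shows "\<bar>\<Sum>i\<in>S. \<Sum>k\<in>S. a i * G i k * c i k\<bar> \<le> real N * B * C * \<eta>"
proof -
  have "(\<Sum>i\<in>S. \<Sum>k\<in>S. a i * G i k * c i k) = (\<Sum>i | i \<in> S \<and> a i \<noteq> 0. \<Sum>k\<in>S. a i * G i k * c i k)"
    using finite_sites by (intro sum.mono_neutral_right) auto
  also have "\<bar>\<dots>\<bar> \<le> (\<Sum>i | i \<in> S \<and> a i \<noteq> 0. B * C * \<eta>)"
  proof (rule order_trans[OF sum_abs], rule sum_mono)
    fix i assume "i \<in> {i. i \<in> S \<and> a i \<noteq> 0}"
    then have i: "i \<in> S" by simp
    have "\<bar>\<Sum>k\<in>S. a i * G i k * c i k\<bar> \<le> (\<Sum>k\<in>S. B * \<bar>G i k\<bar> * \<eta>)"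
      unfolding atomize_eq
      by (rule order_trans[OF sum_abs], rule sum_mono)
        (use a[OF i] c[OF i] B in \<open>auto simp: abs_mult intro!: mult_mono\<close>)
    also have "\<dots> = B * (\<Sum>k\<in>S. \<bar>G i k\<bar>) * \<eta>" by (simp add: sum_distrib_left sum_distrib_right)
    also have "\<dots> \<le> B * C * \<eta>" using G_row[OF i] B \<eta> by (intro mult_right_mono mult_left_mono)
    finally show "\<bar>\<Sum>k\<in>S. a i * G i k * c i k\<bar> \<le> B * C * \<eta>" .
  qed
  also have "\<dots> = real (card {i \<in> S. a i \<noteq> 0}) * (B * C * \<eta>)" by simp
  also have "\<dots> \<le> real N * (B * C * \<eta>)"
    using num B C \<eta> by (intro mult_right_mono) auto
  finally show ?thesis by (simp add: mult_ac)
qed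

text \<open>A second moment argument: \<open>A\<close> is bounded by \<open>K\<close> everywhere and
  its square is below \<open>c0 / 2\<close> on \<open>E\<close>, while its second moment is at least
  \<open>c0\<close>. Hence the complement of \<open>E\<close> carries mass at least
  \<open>c0 / (2 * K\<^sup>2)\<close>.\<close>

lemma prob_root_le:
  assumes w: "\<And>i. i \<in> S \<Longrightarrow> \<bar>w \<bullet> t i\<bar> \<le> B" and B: "0 < B" and num: "card {i \<in> S. w \<bullet> t i \<noteq> 0} \<le> N"
    and cw: "0 < cw" and i0: "i\<^sub>0 \<in> S" "cw \<le> \<bar>w \<bullet> t i\<^sub>0\<bar>"
    and m: "0 < m" and sd: "\<And>x. x \<in> X \<Longrightarrow> m \<le> logit_sd x \<beta>\<^sub>0"
    and ratio: "\<And>x y \<beta>. x \<in> X \<Longrightarrow> y \<in> X \<Longrightarrow> \<beta> \<in> D \<Longrightarrow>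
      \<bar>logit_sd x \<beta> / logit_sd y \<beta> - logit_sd x \<beta>\<^sub>0 / logit_sd y \<beta>\<^sub>0\<bar> \<le> \<eta>"
    and shift: "\<And>x y \<beta>. x \<in> X \<Longrightarrow> y \<in> X \<Longrightarrow> \<beta> \<in> D \<Longrightarrow>
      \<bar>logit_sd x \<beta> / logit_sd y \<beta> * (theta y \<beta> - theta y \<beta>\<^sub>0)\<bar> \<le> \<eta>"
    and \<eta>: "0 \<le> \<eta>" and small: "2 * (real N * B * C * (2 * \<eta>))\<^sup>2 < l / C\<^sup>2 * (cw * m)\<^sup>2"
    and E: "E \<in> sets M" and root: "\<And>\<omega>. \<omega> \<in> E \<Longrightarrow> \<exists>\<beta>\<in>D. U \<omega> \<beta> = 0"
  shows "prob E \<le> 1 - l / C\<^sup>2 * (cw * m)\<^sup>2 / (2 * (real N * B * C * (1 / m))\<^sup>2)"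
proof -
  define c0 where "c0 = l / C\<^sup>2 * (cw * m)\<^sup>2"
  define K where "K = real N * B * C * (1 / m)"
  define A where "A \<omega> = w \<bullet> U \<omega> \<beta>\<^sub>0" for \<omega>
  have tX: "t i \<in> X" if "i \<in> S" for i using patterns that by blast
  have "w \<bullet> t i\<^sub>0 \<noteq> 0" using i0 cw by auto
  then have "{i \<in> S. w \<bullet> t i \<noteq> 0} \<noteq> {}" using i0(1) by blast
  then have "0 < card {i \<in> S. w \<bullet> t i \<noteq> 0}" using finite_sites by (simp add: card_gt_0_iff)
  then have "0 < N" using num by linarith
  then have K: "0 < K" using B C m by (simp add: K_def)
  have A1: "A \<omega> = (\<Sum>i\<in>S. \<Sum>k\<in>S. (w \<bullet> t i) * G i k * (logit_sd (t i) \<beta>\<^sub>0 / logit_sd (t k) \<beta>\<^sub>0 * Z k \<omega>))" for \<omega>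
    unfolding A_def inner_U Z_def by (simp add: mult_ac)
  have A2: "A \<omega> = (\<Sum>k\<in>S. (\<Sum>i\<in>S. (w \<bullet> t i) * \<sigma> i * G i k) / \<sigma> k * Z k \<omega>)" for \<omega>
    unfolding A1 \<sigma>_def sum_divide_distrib sum_distrib_right by (subst sum.swap) (simp add: mult_ac)
  have Abound: "\<bar>A \<omega>\<bar> \<le> K" if \<omega>: "\<omega> \<in> space M" for \<omega>
    unfolding A1 K_def
  proof (rule weighted_form_bound[OF w])
    fix i k assume ik: "i \<in> S" "k \<in> S"
    have "\<bar>logit_sd (t i) \<beta>\<^sub>0 / logit_sd (t k) \<beta>\<^sub>0 * Z k \<omega>\<bar> \<le> 1 / m * 1"
      unfolding abs_mult using logit_sd_bounds[of "t i" \<beta>\<^sub>0] logit_sd_bounds(1)[of "t k" \<beta>\<^sub>0] sd[OF tX[OF ik(2)]] m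
      by (intro mult_mono abs_Z_le ik \<omega>) (auto simp: abs_divide intro!: frac_le)
    then show "\<bar>logit_sd (t i) \<beta>\<^sub>0 / logit_sd (t k) \<beta>\<^sub>0 * Z k \<omega>\<bar> \<le> 1 / m" by simp
  qed (use B num m in auto)
  have Asmall: "\<bar>A \<omega>\<bar> \<le> real N * B * C * (2 * \<eta>)" if \<omega>: "\<omega> \<in> E" for \<omega>
  proof -
    have sp: "\<omega> \<in> space M" using E \<omega> sets.sets_into_space by auto
    obtain \<beta> where \<beta>: "\<beta> \<in> D" "U \<omega> \<beta> = 0" using root[OF \<omega>] by blast
    \<comment> \<open>Subtracting the vanishing score at the root leaves only the change of the
      weights and the shift of the means, each at most \<open>\<eta>\<close> per entry.\<close>
    have "A \<omega> = A \<omega> - w \<bullet> U \<omega> \<beta>" using \<beta> by simp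
    also have "\<dots> = (\<Sum>i\<in>S. \<Sum>k\<in>S. (w \<bullet> t i) * G i k *
        (logit_sd (t i) \<beta>\<^sub>0 / logit_sd (t k) \<beta>\<^sub>0 * Z k \<omega> - logit_sd (t i) \<beta> / logit_sd (t k) \<beta> * (Y k \<omega> - theta (t k) \<beta>)))"
      unfolding A1 inner_U by (simp add: sum_subtractf[symmetric] algebra_simps)
    also have "\<bar>\<dots>\<bar> \<le> real N * B * C * (2 * \<eta>)"
    proof (rule weighted_form_bound[OF w])
      fix i k assume ik: "i \<in> S" "k \<in> S"
      define r where "r = logit_sd (t i) \<beta> / logit_sd (t k) \<beta> - logit_sd (t i) \<beta>\<^sub>0 / logit_sd (t k) \<beta>\<^sub>0"
      define s where "s = logit_sd (t i) \<beta> / logit_sd (t k) \<beta> * (theta (t k) \<beta> - theta (t k) \<beta>\<^sub>0)"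
      have "logit_sd (t i) \<beta>\<^sub>0 / logit_sd (t k) \<beta>\<^sub>0 * Z k \<omega> - logit_sd (t i) \<beta> / logit_sd (t k) \<beta> * (Y k \<omega> - theta (t k) \<beta>)
        = s - r * Z k \<omega>" by (simp add: r_def s_def Z_def algebra_simps diff_divide_distrib add_divide_distrib)
      moreover have "\<bar>s\<bar> \<le> \<eta>" unfolding s_def by (rule shift[OF tX tX \<beta>(1)]) (use ik in auto)
      moreover have "\<bar>r * Z k \<omega>\<bar> \<le> \<eta> * 1"
        unfolding abs_mult r_def by (intro mult_mono ratio tX \<beta>(1) ik abs_Z_le sp \<eta>) auto
      ultimately show "\<bar>logit_sd (t i) \<beta>\<^sub>0 / logit_sd (t k) \<beta>\<^sub>0 * Z k \<omega> - logit_sd (t i) \<beta> / logit_sd (t k) \<beta> * (Y k \<omega> - theta (t k) \<beta>)\<bar> \<le> 2 * \<eta>"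
        by linarith
    qed (use B num \<eta> in auto)
    finally show ?thesis .
  qed
  have int: "integrable M (\<lambda>\<omega>. (A \<omega>)\<^sup>2)" unfolding A2 by (rule linear_combination_square(1))
  \<comment> \<open>The coefficient of \<open>Z k\<close> in \<open>A\<close> is that of
    \<open>G s\<close> divided by \<open>\<sigma> k\<close>, which cancels against the covariances;
    the second moment is the \<Gamma>-form at \<open>G s\<close>, and the single site
    \<open>i\<^sub>0\<close> bounds it below.\<close>
  have "c0 \<le> expectation (\<lambda>\<omega>. (A \<omega>)\<^sup>2)"
  proof -
    define s where "s i = (w \<bullet> t i) * \<sigma> i" for i
    have "(cw * m)\<^sup>2 \<le> (s i\<^sub>0)\<^sup>2"
    proof -
      have "cw * m \<le> \<bar>w \<bullet> t i\<^sub>0\<bar> * \<sigma> i\<^sub>0" using i0 sd[OF tX[OF i0(1)]] cw m by (intro mult_mono) (auto simp: \<sigma>_def)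
      also have "\<dots> = \<bar>s i\<^sub>0\<bar>" using sigma_bounds(1)[of i\<^sub>0] by (simp add: s_def abs_mult)
      finally have "(cw * m)\<^sup>2 \<le> \<bar>s i\<^sub>0\<bar>\<^sup>2" using cw m by (intro power_mono) auto
      then show ?thesis by simp
    qed
    also have "(s i\<^sub>0)\<^sup>2 \<le> (\<Sum>i\<in>S. (s i)\<^sup>2)" by (rule member_le_sum) (use i0 finite_sites in auto)
    finally have "c0 \<le> l / C\<^sup>2 * (\<Sum>i\<in>S. (s i)\<^sup>2)" unfolding c0_def using l C by (intro mult_left_mono) auto
    also have "\<dots> \<le> (\<Sum>k\<in>S. \<Sum>k'\<in>S. (\<Sum>i\<in>S. s i * G i k) * (\<Sum>i\<in>S. s i * G i k') * \<Gamma> k k')"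
      by (rule inverse_coercive(2)[OF finite_sites \<Gamma>_coercive l C \<Gamma>_commute \<Gamma>_row inverse_G])
    also have "\<dots> = expectation (\<lambda>\<omega>. (A \<omega>)\<^sup>2)"
    proof -
      have "x / \<sigma> k * \<sigma> k = x" for x k using sigma_bounds(1)[of k] by simp
      then show ?thesis unfolding A2 linear_combination_square(2) s_def by simp
    qed
    finally show ?thesis .
  qed
  also have "\<dots> \<le> expectation (\<lambda>\<omega>. c0 / 2 + K\<^sup>2 * indicator (space M - E) \<omega>)"
  proof (rule integral_mono[OF int])
    show "integrable M (\<lambda>\<omega>. c0 / 2 + K\<^sup>2 * indicator (space M - E) \<omega>)"
      using E by (intro Bochner_Integration.integrable_add integrable_mult_right integrable_real_indicator)
        (auto simp: less_top[symmetric] intro: emeasure_finite)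
    fix \<omega> assume sp: "\<omega> \<in> space M"
    show "(A \<omega>)\<^sup>2 \<le> c0 / 2 + K\<^sup>2 * indicator (space M - E) \<omega>"
    proof (cases "\<omega> \<in> E")
      case True
      have "\<bar>A \<omega>\<bar>\<^sup>2 \<le> (real N * B * C * (2 * \<eta>))\<^sup>2" using Asmall[OF True] by (intro power_mono) auto
      moreover have "2 * (real N * B * C * (2 * \<eta>))\<^sup>2 < c0" using small unfolding c0_def .
      ultimately show ?thesis using True unfolding power2_abs by simp
    next
      case False
      have "\<bar>A \<omega>\<bar>\<^sup>2 \<le> K\<^sup>2" using Abound[OF sp] by (intro power_mono) auto
      moreover have "0 \<le> c0" using l by (simp add: c0_def)
      ultimately show ?thesis using False sp by (simp add: indicator_def)
    qed
  qed
  also have "\<dots> = c0 / 2 + K\<^sup>2 * (1 - prob E)"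
    using E by (subst Bochner_Integration.integral_add)
      (auto simp: prob_compl prob_space less_top[symmetric] intro!: integrable_real_indicator)
  finally have "c0 / 2 \<le> K\<^sup>2 * (1 - prob E)" by simp
  then have "c0 / (2 * K\<^sup>2) \<le> 1 - prob E" using K by (simp add: field_simps)
  then show ?thesis by (simp add: c0_def K_def)
qed

end

section \<open>Joint moments under constant correlation\<close>

lemma finite_pairings: "finite (pairings k)"
proof (rule finite_subset)
  show "pairings k \<subseteq> Pow (Pow {..<k})"
    by (auto simp: pairings_def partition_on_def)
qed simp

lemma card_pairing:
  assumes "\<pi> \<in> pairings (2 * l)"
  shows "card \<pi> = l"
proof -
  have part: "partition_on {..<2 * l} \<pi>" and two: "\<And>B. B \<in> \<pi> \<Longrightarrow> card B = 2"
    using assms by (auto simp: pairings_def)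
  have "2 * l = card (\<Union>\<pi>)" using part by (simp add: partition_on_def)
  also have "\<dots> = sum card \<pi>"
    using part two by (intro card_Union_disjoint) (auto simp: partition_on_def disjoint_def pairwise_def intro: card_ge_0_finite)
  also have "\<dots> = 2 * card \<pi>" using two by simp
  finally show ?thesis by simp
qed

text \<open>A permutation \<open>\<sigma>\<close> of \<open>{..<l}\<close> gives the pairing of \<open>i\<close> with \<open>l + \<sigma> i\<close>.\<close>

lemma fact_le_card_pairings: "fact l \<le> card (pairings (2 * l))"
proof -
  define f where "f \<sigma> = (\<lambda>i. {i, l + \<sigma> i}) ` {..<l}" for \<sigma> :: "nat \<Rightarrow> nat"
  have "inj_on f {\<sigma>. \<sigma> permutes {..<l}}"
  proof (rule inj_onI, rule ext)
    fix \<sigma> \<tau> i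
    assume \<sigma>: "\<sigma> \<in> {\<sigma>. \<sigma> permutes {..<l}}" and \<tau>: "\<tau> \<in> {\<sigma>. \<sigma> permutes {..<l}}" and eq: "f \<sigma> = f \<tau>"
    show "\<sigma> i = \<tau> i"
    proof (cases "i < l")
      case True
      then have "{i, l + \<sigma> i} \<in> f \<tau>" unfolding eq[symmetric] by (auto simp: f_def)
      then obtain j where j: "j < l" "{i, l + \<sigma> i} = {j, l + \<tau> j}" by (auto simp: f_def)
      then have "i = j \<and> l + \<sigma> i = l + \<tau> j" using True by (auto simp: doubleton_eq_iff)
      then show ?thesis by auto
    next
      case False
      then show ?thesis using \<sigma> \<tau> by (simp add: permutes_not_in)
    qed
  qed
  moreover have "f ` {\<sigma>. \<sigma> permutes {..<l}} \<subseteq> pairings (2 * l)"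
  proof clarify
    fix \<sigma> assume \<sigma>: "\<sigma> permutes {..<l}"
    have lt: "\<sigma> i < l \<longleftrightarrow> i < l" for i using permutes_in_image[OF \<sigma>, of i] by simp
    have inj: "\<sigma> i = \<sigma> j \<longleftrightarrow> i = j" for i j using permutes_inj[OF \<sigma>] by (auto dest: injD)
    have "\<Union>(f \<sigma>) = {..<2 * l}"
    proof (intro equalityI subsetI)
      fix x assume "x \<in> \<Union>(f \<sigma>)"
      then obtain i where "i < l" "x = i \<or> x = l + \<sigma> i" by (auto simp: f_def)
      then show "x \<in> {..<2 * l}" using lt[of i] by auto
    next
      fix x assume x: "x \<in> {..<2 * l}"
      show "x \<in> \<Union>(f \<sigma>)"
      proof (cases "x < l")
        case True then show ?thesis by (auto simp: f_def)
      next
        case False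
        then have "x - l \<in> \<sigma> ` {..<l}" using x permutes_image[OF \<sigma>] by auto
        then obtain i where "i < l" "x - l = \<sigma> i" by auto
        then have "x = l + \<sigma> i" "i \<in> {..<l}" using False by auto
        then show ?thesis by (auto simp: f_def)
      qed
    qed
    moreover have "disjoint (f \<sigma>)"
      by (rule disjointI) (auto simp: f_def inj lt; use lt in fastforce)
    moreover have "{} \<notin> f \<sigma>" by (auto simp: f_def)
    moreover have "card B = 2" if "B \<in> f \<sigma>" for B
      using that by (auto simp: f_def)
    ultimately show "f \<sigma> \<in> pairings (2 * l)" by (simp add: pairings_def partition_on_def)
  qed
  ultimately have "card {\<sigma>. \<sigma> permutes {..<l}} \<le> card (pairings (2 * l))"
    using finite_pairings by (intro card_inj_on_le)
  then show ?thesis by (simp add: card_permutations)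
qed

text \<open>A falling factorial with \<open>k\<close> factors, each at least half of
  \<open>card S\<close>.\<close>

lemma card_distinct_tuples_ge:
  assumes S: "finite S" and k: "2 * k \<le> card S"
  shows "(real (card S) / 2) ^ k \<le> real (card (distinct_tuples S k))"
proof -
  have "card (distinct_tuples S k) = \<Prod>{card S - k + 1..card S}"
    unfolding distinct_tuples_def using S k by (intro card_lists_distinct_length_eq) auto
  moreover have "(\<Prod>i\<in>{card S - k + 1..card S}. real (card S) / 2) \<le> (\<Prod>i\<in>{card S - k + 1..card S}. real i)"
    using k by (intro prod_mono) auto
  ultimately show ?thesis using k by simp
qed

text \<open>
  When the pair covariances are bounded below by \<open>\<kappa> > 0\<close>, the pairing terms alone are of order
  \<open>(2l - 1)!! \<kappa>\<^sup>l\<close>, which exceeds the trivial bound \<open>1\<close> on a joint moment once \<open>l\<close> is large.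
\<close>

lemma moment_condition_fails:
  fixes S :: "nat \<Rightarrow> site set"
  assumes fin: "\<And>r. finite (S r)" and lim: "filterlim (\<lambda>r. card (S r)) at_top sequentially"
    and \<kappa>: "0 < \<kappa>"
    and bound: "\<And>r xs B. set xs \<subseteq> S r \<Longrightarrow> B \<subseteq> {..<length xs} \<Longrightarrow> moment (M r) (Z r) xs B \<le> 1"
    and pair: "\<And>r xs B. set xs \<subseteq> S r \<Longrightarrow> distinct xs \<Longrightarrow> B \<subseteq> {..<length xs} \<Longrightarrow> card B = 2 \<Longrightarrow>
       \<kappa> \<le> moment (M r) (Z r) xs B"
  obtains k where "1 \<le> k" "\<And>\<alpha>. \<alpha> < real k / 2 \<Longrightarrow>
     (\<lambda>r. \<Sum>xs\<in>distinct_tuples (S r) k. c_moment (M r) (Z r) xs) \<notin> O(\<lambda>r. real (card (S r)) powr \<alpha>)"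
proof -
  have "(\<lambda>l. inverse \<kappa> ^ l / fact l) \<longlonglongrightarrow> 0"
    using summable_LIMSEQ_zero[OF summable_exp[of "inverse \<kappa>"]]
    by (simp add: divide_inverse mult.commute)
  then have "\<forall>\<^sub>F l in sequentially. inverse \<kappa> ^ l / fact l < 1 / 2 \<and> 1 \<le> l"
    by (intro eventually_conj order_tendstoD(2)[where a = "1 / 2"] eventually_ge_at_top) auto
  then obtain l where l: "inverse \<kappa> ^ l / fact l < 1 / 2" "1 \<le> l"
    by (auto simp: eventually_sequentially)
  \<comment> \<open>The factorial outgrows the powers of \<open>1 / \<kappa>\<close>. The value
    \<open>2\<close> beats the bound \<open>1\<close> on the joint moment by \<open>1\<close>,
    whence every \<open>c_moment\<close> is at most \<open>- 1\<close>.\<close>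
  have big: "2 \<le> fact l * \<kappa> ^ l"
    using l(1) \<kappa> by (simp add: field_simps power_inverse)
  define k where "k = 2 * l"
  have c: "c_moment (M r) (Z r) xs \<le> - 1" if xs: "xs \<in> distinct_tuples (S r) k" for r xs
  proof -
    have len: "length xs = 2 * l" and d: "distinct xs" and sub: "set xs \<subseteq> S r"
      using xs by (auto simp: distinct_tuples_def k_def)
    have "\<kappa> ^ l \<le> (\<Prod>B\<in>\<pi>. moment (M r) (Z r) xs B)" if \<pi>: "\<pi> \<in> pairings (2 * l)" for \<pi>
    proof -
      have "(\<Prod>B\<in>\<pi>. \<kappa>) \<le> (\<Prod>B\<in>\<pi>. moment (M r) (Z r) xs B)"
        using \<pi> \<kappa> len by (intro prod_mono conjI pair sub d) (auto simp: pairings_def partition_on_def)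
      then show ?thesis by (simp add: card_pairing[OF \<pi>])
    qed
    then have "(\<Sum>\<pi>\<in>pairings (2 * l). \<kappa> ^ l) \<le> (\<Sum>\<pi>\<in>pairings (2 * l). \<Prod>B\<in>\<pi>. moment (M r) (Z r) xs B)"
      by (rule sum_mono)
    moreover have "2 \<le> (\<Sum>\<pi>\<in>pairings (2 * l). \<kappa> ^ l)"
    proof -
      have "fact l * \<kappa> ^ l \<le> real (card (pairings (2 * l))) * \<kappa> ^ l"
        using of_nat_mono[OF fact_le_card_pairings[of l], where 'a = real] \<kappa>
        by (intro mult_right_mono) auto
      then show ?thesis using big by simp
    qed
    moreover have "moment (M r) (Z r) xs {..<2 * l} \<le> 1" using bound[OF sub] len by simp
    ultimately show ?thesis by (simp add: c_moment_def len)
  qed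
  show ?thesis
  proof (rule that[of k])
    show "1 \<le> k" using l(2) by (simp add: k_def)
    fix \<alpha> assume \<alpha>: "\<alpha> < real k / 2"
    show "(\<lambda>r. \<Sum>xs\<in>distinct_tuples (S r) k. c_moment (M r) (Z r) xs) \<notin> O(\<lambda>r. real (card (S r)) powr \<alpha>)"
    proof
      assume "(\<lambda>r. \<Sum>xs\<in>distinct_tuples (S r) k. c_moment (M r) (Z r) xs) \<in> O(\<lambda>r. real (card (S r)) powr \<alpha>)"
      then obtain K where K: "0 < K" and ev: "\<forall>\<^sub>F r in sequentially.
          norm (\<Sum>xs\<in>distinct_tuples (S r) k. c_moment (M r) (Z r) xs) \<le> K * norm (real (card (S r)) powr \<alpha>)"
        by (auto elim: landau_o.bigE)
      have N: "filterlim (\<lambda>r. real (card (S r))) at_top sequentially"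
        by (rule filterlim_compose[OF filterlim_real_sequentially lim])
      have large: "\<forall>\<^sub>F r in sequentially. K * 2 ^ k < real (card (S r))"
        using N by (simp add: filterlim_at_top_dense)
      have "\<forall>\<^sub>F r in sequentially. 2 * k + 1 \<le> card (S r)"
        using lim by (simp add: filterlim_at_top)
      with ev large have "\<forall>\<^sub>F r in sequentially. False"
      proof eventually_elim
        case (elim r)
        define n where "n = real (card (S r))"
        have n: "1 \<le> n" using elim(3) by (simp add: n_def)
        \<comment> \<open>All tuples contribute with the same sign, so the sum has order at least
          \<open>n ^ k\<close> against an allowance of \<open>n powr (k / 2)\<close>. As
          \<open>k \<ge> 2\<close>, the quotient is at least of order \<open>n\<close>,
          contradicting the choice of \<open>r\<close>.\<close>
        have "(n / 2) ^ k \<le> real (card (distinct_tuples (S r) k))"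
          unfolding n_def using elim(3) by (intro card_distinct_tuples_ge fin) simp
        also have "\<dots> \<le> - (\<Sum>xs\<in>distinct_tuples (S r) k. c_moment (M r) (Z r) xs)"
        proof -
          have "(\<Sum>xs\<in>distinct_tuples (S r) k. c_moment (M r) (Z r) xs) \<le> (\<Sum>xs\<in>distinct_tuples (S r) k. - 1)"
            by (intro sum_mono c)
          then show ?thesis by simp
        qed
        also have "\<dots> \<le> K * n powr \<alpha>" using elim(1) by (simp add: n_def abs_le_iff)
        also have "\<dots> \<le> K * n powr (real k / 2)"
          using n \<alpha> K by (intro mult_left_mono powr_mono) auto
        finally have "n ^ k \<le> K * 2 ^ k * n powr (real k / 2)"
          by (simp add: power_divide field_simps)
        moreover have "n ^ k = n powr (real k / 2) * n powr (real k / 2)"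
          using n by (simp add: powr_add[symmetric] powr_realpow)
        ultimately have "n powr (real k / 2) * n powr (real k / 2) \<le> K * 2 ^ k * n powr (real k / 2)" by simp
        then have "n powr (real k / 2) \<le> K * 2 ^ k"
          by (rule mult_right_le_imp_le) (use n in simp)
        moreover have "n powr 1 \<le> n powr (real k / 2)"
          using n l(2) by (intro powr_mono) (auto simp: k_def)
        ultimately show False using elim(2) n by (simp add: n_def)
      qed
      then show False by simp
    qed
  qed
qed

section \<open>Sequences of grids\<close>

text \<open>Dual form of the statement that the linear span of \<open>A\<close> is the whole space:
  its negation directly supplies the test vector \<open>w\<close>.\<close>

definition spanning :: "(real ^ 'q) set \<Rightarrow> bool" where
  "spanning A \<longleftrightarrow> (\<forall>v. v \<noteq> 0 \<longrightarrow> (\<exists>x\<in>A. v \<bullet> x \<noteq> 0))"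

text \<open>The right-hand side is continuous and positive on the compact unit sphere; homogeneity
  extends its minimum to all \<open>v\<close>.\<close>

lemma spanning_coercive:
  fixes A :: "(real ^ 'q) set"
  assumes A: "finite A" and sp: "spanning A"
  shows "\<exists>c>0. \<forall>v. c * (norm v)\<^sup>2 \<le> (\<Sum>x\<in>A. (x \<bullet> v)\<^sup>2)"
proof -
  define f where "f v = (\<Sum>x\<in>A. (x \<bullet> v)\<^sup>2)" for v :: "real ^ 'q"
  have "continuous_on (sphere 0 1) f"
    unfolding f_def[abs_def] by (intro continuous_intros)
  moreover have "axis undefined 1 \<in> sphere (0 :: real ^ 'q) 1" by simp
  then have "sphere (0 :: real ^ 'q) 1 \<noteq> {}" by blast
  ultimately obtain v0 where v0: "v0 \<in> sphere 0 1" and min: "\<And>v. v \<in> sphere 0 1 \<Longrightarrow> f v0 \<le> f v"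
    using continuous_attains_inf[of "sphere 0 1" f] by auto
  have "0 < f v0"
  proof -
    have "v0 \<noteq> 0" using v0 by auto
    then obtain x where "x \<in> A" "v0 \<bullet> x \<noteq> 0" using sp by (auto simp: spanning_def)
    then show ?thesis unfolding f_def using A
      by (intro sum_pos2[of A x]) (auto simp: inner_commute)
  qed
  moreover have "f v0 * (norm v)\<^sup>2 \<le> f v" for v
  proof (cases "v = 0")
    case True then show ?thesis by (simp add: f_def)
  next
    case False
    have "f v = f ((1 / norm v) *\<^sub>R v) * (norm v)\<^sup>2"
      using False by (simp add: f_def power_mult_distrib power_divide sum_distrib_right)
    moreover have "f v0 \<le> f ((1 / norm v) *\<^sub>R v)" using False by (intro min) simp
    ultimately show ?thesis by (simp add: mult_right_mono)
  qed
  ultimately show ?thesis unfolding f_def by blast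
qed

lemma uniform_positive_constant:
  assumes F: "finite F" and ex: "\<And>a. a \<in> F \<Longrightarrow> \<exists>c::real>0. P a c"
    and anti: "\<And>a c d. P a c \<Longrightarrow> d \<le> c \<Longrightarrow> P a d"
  shows "\<exists>c>0. \<forall>a\<in>F. P a c"
  using F ex
proof (induction F)
  case empty
  show ?case by (intro exI[of _ 1]) auto
next
  case (insert a F)
  then obtain c d where "0 < c" "\<forall>a\<in>F. P a c" "0 < d" "P a d" by (metis insertCI)
  then show ?case by (intro exI[of _ "min c d"]) (auto intro: anti)
qed

text \<open>The set of frequent patterns changes with the grid, so one constant must serve all
  spanning subsets of \<open>X\<close>.\<close>

lemma spanning_coercive_uniform:
  fixes X :: "(real ^ 'q) set"
  assumes X: "finite X"
  shows "\<exists>c>0. \<forall>A\<in>Pow X. spanning A \<longrightarrow> (\<forall>v. c * (norm v)\<^sup>2 \<le> (\<Sum>x\<in>A. (x \<bullet> v)\<^sup>2))"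
proof (rule uniform_positive_constant)
  show "finite (Pow X)" using X by simp
  show "\<exists>c>0. spanning A \<longrightarrow> (\<forall>v. c * (norm v)\<^sup>2 \<le> (\<Sum>x\<in>A. (x \<bullet> v)\<^sup>2))" if "A \<in> Pow X" for A
    using spanning_coercive[of A] that X finite_subset[of A X] by (cases "spanning A") (auto intro: exI[of _ 1])
  show "spanning A \<longrightarrow> (\<forall>v. d * (norm v)\<^sup>2 \<le> (\<Sum>x\<in>A. (x \<bullet> v)\<^sup>2))"
    if "spanning A \<longrightarrow> (\<forall>v. c * (norm v)\<^sup>2 \<le> (\<Sum>x\<in>A. (x \<bullet> v)\<^sup>2))" "d \<le> c" for A and c d :: real
  proof (intro impI allI)
    fix v assume "spanning A"
    then have "c * (norm v)\<^sup>2 \<le> (\<Sum>x\<in>A. (x \<bullet> v)\<^sup>2)" using that(1) by blast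
    moreover have "d * (norm v)\<^sup>2 \<le> c * (norm v)\<^sup>2" using that(2) by (rule mult_right_mono) simp
    ultimately show "d * (norm v)\<^sup>2 \<le> (\<Sum>x\<in>A. (x \<bullet> v)\<^sup>2)" by linarith
  qed
qed

section \<open>Neighbourhoods of the true parameter that serve all patterns\<close>

lemma tendsto_logit_sd: "((\<lambda>\<beta>. logit_sd x \<beta>) \<longlongrightarrow> logit_sd x \<beta>\<^sub>0) (nhds \<beta>\<^sub>0)"
  using differentiable_imp_continuous_within[OF logit_sd_differentiable[of x \<beta>\<^sub>0]]
  by (simp add: continuous_at tendsto_at_iff_tendsto_nhds)

lemma tendsto_theta: "((\<lambda>\<beta>. theta x \<beta>) \<longlongrightarrow> theta x \<beta>\<^sub>0) (nhds \<beta>\<^sub>0)"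
  using differentiable_imp_continuous_within[OF theta_differentiable[of x \<beta>\<^sub>0]]
  by (simp add: continuous_at tendsto_at_iff_tendsto_nhds)

lemma logit_sd_lower_bound:
  assumes X: "finite X"
  shows "\<exists>m>0. \<exists>\<delta>>0. \<forall>x\<in>X. \<forall>\<beta>\<in>ball \<beta>\<^sub>0 \<delta>. m \<le> logit_sd x \<beta>"
proof -
  have "\<exists>m>0. \<forall>x\<in>X. m < logit_sd x \<beta>\<^sub>0"
    by (rule uniform_positive_constant[OF X]) (use dense[OF logit_sd_bounds(1)] in auto)
  then obtain m where m: "0 < m" "\<forall>x\<in>X. m < logit_sd x \<beta>\<^sub>0" by blast
  have "\<forall>\<^sub>F \<beta> in nhds \<beta>\<^sub>0. \<forall>x\<in>X. m < logit_sd x \<beta>"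
    using m X order_tendstoD(1)[OF tendsto_logit_sd] by (intro eventually_ball_finite) auto
  then obtain \<delta> where "0 < \<delta>" "\<And>\<beta>. dist \<beta> \<beta>\<^sub>0 < \<delta> \<Longrightarrow> \<forall>x\<in>X. m < logit_sd x \<beta>"
    by (auto simp: eventually_nhds_metric)
  then show ?thesis using m(1)
    by (intro exI[of _ m] conjI exI[of _ \<delta>] ballI less_imp_le) (auto simp: dist_commute)
qed

lemma score_weights_continuous:
  assumes X: "finite X" and \<eta>: "0 < \<eta>"
  shows "\<exists>\<delta>>0. \<forall>x\<in>X. \<forall>y\<in>X. \<forall>\<beta>\<in>ball \<beta>\<^sub>0 \<delta>.
    \<bar>logit_sd x \<beta> / logit_sd y \<beta> - logit_sd x \<beta>\<^sub>0 / logit_sd y \<beta>\<^sub>0\<bar> \<le> \<eta> \<and>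
    \<bar>logit_sd x \<beta> / logit_sd y \<beta> * (theta y \<beta> - theta y \<beta>\<^sub>0)\<bar> \<le> \<eta>"
proof -
  let ?P = "\<lambda>x y \<beta>. \<bar>logit_sd x \<beta> / logit_sd y \<beta> - logit_sd x \<beta>\<^sub>0 / logit_sd y \<beta>\<^sub>0\<bar> < \<eta> \<and>
    \<bar>logit_sd x \<beta> / logit_sd y \<beta> * (theta y \<beta> - theta y \<beta>\<^sub>0)\<bar> < \<eta>"
  have "\<forall>\<^sub>F \<beta> in nhds \<beta>\<^sub>0. ?P x y \<beta>" for x y
  proof -
    have nz: "logit_sd y \<beta>\<^sub>0 \<noteq> 0" using logit_sd_bounds(1)[of y \<beta>\<^sub>0] by simp
    have "((\<lambda>\<beta>. \<bar>logit_sd x \<beta> / logit_sd y \<beta> - logit_sd x \<beta>\<^sub>0 / logit_sd y \<beta>\<^sub>0\<bar>) \<longlongrightarrow>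
        \<bar>logit_sd x \<beta>\<^sub>0 / logit_sd y \<beta>\<^sub>0 - logit_sd x \<beta>\<^sub>0 / logit_sd y \<beta>\<^sub>0\<bar>) (nhds \<beta>\<^sub>0)"
      by (intro tendsto_intros tendsto_logit_sd nz)
    moreover have "((\<lambda>\<beta>. \<bar>logit_sd x \<beta> / logit_sd y \<beta> * (theta y \<beta> - theta y \<beta>\<^sub>0)\<bar>) \<longlongrightarrow>
        \<bar>logit_sd x \<beta>\<^sub>0 / logit_sd y \<beta>\<^sub>0 * (theta y \<beta>\<^sub>0 - theta y \<beta>\<^sub>0)\<bar>) (nhds \<beta>\<^sub>0)"
      by (intro tendsto_intros tendsto_logit_sd tendsto_theta nz)
    ultimately show ?thesis
      using \<eta> by (intro eventually_conj order_tendstoD(2)) auto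
  qed
  then have "\<forall>\<^sub>F \<beta> in nhds \<beta>\<^sub>0. \<forall>x\<in>X. \<forall>y\<in>X. ?P x y \<beta>"
    using X by (intro eventually_ball_finite ballI)
  then obtain \<delta> where "0 < \<delta>" "\<And>\<beta>. dist \<beta> \<beta>\<^sub>0 < \<delta> \<Longrightarrow> \<forall>x\<in>X. \<forall>y\<in>X. ?P x y \<beta>"
    by (auto simp: eventually_nhds_metric)
  then show ?thesis
    by (intro exI[of _ \<delta>] conjI ballI) (auto simp: dist_commute intro!: less_imp_le)
qed

locale response_sequence =
  fixes M :: "nat \<Rightarrow> 'w measure" and S and Y and t :: "nat \<Rightarrow> site \<Rightarrow> real ^ 'q" and \<beta>\<^sub>0 and l C X
  assumes bounded: "\<And>r. bounded_correlation (M r) (S r) (Y r) (t r) \<beta>\<^sub>0 l C X"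
begin

sublocale B: bounded_correlation "M r" "S r" "Y r" "t r" \<beta>\<^sub>0 l C X for r
  by (rule bounded)

text \<open>A root farther than \<epsilon> from the true parameter forces \<open>Q\<close> above a
  level proportional to the threshold \<open>K\<close>, whereas the expectation of \<open>Q\<close>
  is bounded along the sequence; Markov's inequality makes this unlikely for large
  \<open>K\<close>.\<close>

lemma consistent_of_large_patterns:
  assumes large: "\<And>K. \<forall>\<^sub>F r in sequentially. spanning {x \<in> X. K \<le> B.num r x}"
  shows "\<exists>\<delta>>0. \<forall>\<beta>hat :: nat \<Rightarrow> 'w \<Rightarrow> real ^ 'q.
    with_prob_tending_to_1 M (\<lambda>r \<omega>. \<beta>hat r \<omega> \<in> ball \<beta>\<^sub>0 \<delta> \<and> B.U r \<omega> (\<beta>hat r \<omega>) = 0)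
    \<longrightarrow> tendsto_in_prob M \<beta>hat \<beta>\<^sub>0"
proof -
  note X = B.finite_patterns and l = B.l and C = B.C
  obtain m \<delta>1 where m: "0 < m" and \<delta>1: "0 < \<delta>1" and sd: "\<And>x \<beta>. x \<in> X \<Longrightarrow> \<beta> \<in> ball \<beta>\<^sub>0 \<delta>1 \<Longrightarrow> m \<le> logit_sd x \<beta>"
    using logit_sd_lower_bound[OF X, of \<beta>\<^sub>0] by blast
  obtain c where c: "0 < c" and cX: "\<And>A v. A \<in> Pow X \<Longrightarrow> spanning A \<Longrightarrow> c * (norm v)\<^sup>2 \<le> (\<Sum>x\<in>A. (x \<bullet> v)\<^sup>2)"
    using spanning_coercive_uniform[OF X] by blast
  obtain Bx where Bx: "0 < Bx" "\<And>x. x \<in> X \<Longrightarrow> norm x \<le> Bx"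
    using finite_imp_bounded[OF X] by (auto simp: bounded_pos)
  define b where "b = l / C\<^sup>2 / 2 * m\<^sup>2 / C"
  have b: "0 < b" "C * (b / m\<^sup>2) \<le> l / C\<^sup>2 / 2" using l C m by (simp_all add: b_def)
  \<comment> \<open>\<open>\<delta>1\<close> keeps the standard deviations above \<open>m\<close>,
    and \<open>b / Bx\<close> keeps \<open>\<bar>x \<bullet> v\<bar>\<close> below \<open>b\<close>,
    the size at which the linearisation error is absorbed.\<close>
  define \<delta> where "\<delta> = min \<delta>1 (b / Bx)"
  have \<delta>: "0 < \<delta>" "\<delta> \<le> \<delta>1" "Bx * \<delta> \<le> b" using \<delta>1 b(1) Bx(1) by (auto simp: \<delta>_def min_def field_simps)
  define K0 where "K0 = (2 * (1 / m) / (l / C\<^sup>2))\<^sup>2 * real (card X) / m\<^sup>2"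
  have K0: "0 \<le> K0" by (simp add: K0_def)
  define K1 where "K1 = real (card X) * K0 + 1"
  have K1: "0 < K1" using K0 by (simp add: K1_def add_nonneg_pos)
  define T where "T = (real (card X))\<^sup>2 * C ^ 3"
  have T: "0 \<le> T" using C by (simp add: T_def)
  show ?thesis
  proof (intro exI[of _ \<delta>] conjI allI impI)
    show "0 < \<delta>" by (rule \<delta>)
    fix \<beta>hat :: "nat \<Rightarrow> 'w \<Rightarrow> real ^ 'q"
    define E where "E r = {\<omega> \<in> space (M r). \<beta>hat r \<omega> \<in> ball \<beta>\<^sub>0 \<delta> \<and> B.U r \<omega> (\<beta>hat r \<omega>) = 0}" for r
    assume "with_prob_tending_to_1 M (\<lambda>r \<omega>. \<beta>hat r \<omega> \<in> ball \<beta>\<^sub>0 \<delta> \<and> B.U r \<omega> (\<beta>hat r \<omega>) = 0)"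
    then have E1: "(\<lambda>r. measure (M r) (E r)) \<longlonglongrightarrow> 1"
      by (simp add: with_prob_tending_to_1_def E_def)
    show "tendsto_in_prob M \<beta>hat \<beta>\<^sub>0"
      unfolding tendsto_in_prob_def
    proof (intro allI impI)
      fix \<epsilon> :: real assume \<epsilon>: "0 < \<epsilon>"
      define D where "D r = {\<omega> \<in> space (M r). dist (\<beta>hat r \<omega>) \<beta>\<^sub>0 > \<epsilon>}" for r
      show "(\<lambda>r. measure (M r) (D r)) \<longlonglongrightarrow> 0"
      proof (rule order_tendstoI)
        fix \<eta> :: real assume \<eta>: "\<eta> < 0"
        show "\<forall>\<^sub>F r in sequentially. \<eta> < measure (M r) (D r)"
          using \<eta> measure_nonneg by (intro always_eventually allI) (rule less_le_trans)
      next
        fix \<eta> :: real assume \<eta>: "0 < \<eta>"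
        \<comment> \<open>Large enough to make the Markov bound \<open>T / \<tau>\<close> smaller
          than \<open>\<eta> / 2\<close>.\<close>
        obtain K :: nat where K: "2 * T * K1 / (c * \<epsilon>\<^sup>2 * \<eta>) < real K"
          using reals_Archimedean2 by blast
        have "0 \<le> 2 * T * K1 / (c * \<epsilon>\<^sup>2 * \<eta>)" using T K1 c \<epsilon> \<eta> by simp
        then have K_pos: "0 < real K" using K by linarith
        define \<tau> where "\<tau> = real K * c * \<epsilon>\<^sup>2 / K1"
        have \<tau>: "0 < \<tau>" "T / \<tau> < \<eta> / 2"
          using K K_pos c \<epsilon> K1 \<eta> by (auto simp: \<tau>_def field_simps)
        have "\<forall>\<^sub>F r in sequentially. max (1 - \<eta> / 2) 0 < measure (M r) (E r)"
          using E1 \<eta> by (intro order_tendstoD(1)) auto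
        with large[of K] show "\<forall>\<^sub>F r in sequentially. measure (M r) (D r) < \<eta>"
        proof eventually_elim
          case (elim r)
          \<comment> \<open>Sets outside the sigma-algebra have \<open>measure\<close> zero, so
            positive measure certifies measurability; this is why the lower bound is a maximum with
            \<open>0\<close>.\<close>
          have Es: "E r \<in> sets (M r)" using elim(2) measure_notin_sets[of "E r" "M r"] by (cases "E r \<in> sets (M r)") auto
          define H where "H = {\<omega> \<in> space (M r). \<tau> \<le> B.Q r \<omega>}"
          have Qm: "B.Q r \<in> borel_measurable (M r)" using B.expectation_Q(1) by (rule borel_measurable_integrable)
          have Hs: "H \<in> sets (M r)" unfolding H_def using Qm by measurable
          have "D r \<subseteq> (space (M r) - E r) \<union> H"
          proof
            fix \<omega> assume \<omega>: "\<omega> \<in> D r"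
            show "\<omega> \<in> (space (M r) - E r) \<union> H"
            proof (cases "\<omega> \<in> E r")
              case False then show ?thesis using \<omega> by (simp add: D_def)
            next
              case True
              define v where "v = \<beta>hat r \<omega> - \<beta>\<^sub>0"
              have vn: "\<epsilon> < norm v" using \<omega> by (simp add: D_def v_def dist_norm)
              have ball: "\<beta>hat r \<omega> \<in> ball \<beta>\<^sub>0 \<delta>" and root: "B.U r \<omega> (\<beta>hat r \<omega>) = 0"
                using True by (auto simp: E_def)
              have v\<delta>: "norm v < \<delta>" using ball by (simp add: v_def dist_norm norm_minus_commute)
              have dev: "real (B.num r x) * (x \<bullet> v)\<^sup>2 \<le> K0 * B.Q r \<omega>" if x: "x \<in> X" for x
                unfolding v_def K0_def
              proof (rule B.root_deviation_bound[OF m _ less_imp_le[OF b(1)] _ b(2) root x])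
                show "m \<le> logit_sd x (\<beta>hat r \<omega>)" if "x \<in> X" for x
                  using sd[OF that] ball \<delta>(2) by auto
                show "\<bar>x \<bullet> (\<beta>hat r \<omega> - \<beta>\<^sub>0)\<bar> \<le> b" if "x \<in> X" for x
                proof -
                  have "\<bar>x \<bullet> v\<bar> \<le> norm x * norm v" by (rule Cauchy_Schwarz_ineq2)
                  also have "\<dots> \<le> Bx * \<delta>" using Bx that v\<delta> by (intro mult_mono) auto
                  also have "\<dots> \<le> b" by (rule \<delta>)
                  finally show ?thesis by (simp add: v_def)
                qed
              qed
              let ?A = "{x \<in> X. K \<le> B.num r x}"
              have "real K * (c * \<epsilon>\<^sup>2) \<le> real K * (c * (norm v)\<^sup>2)"
                using vn \<epsilon> c by (intro mult_left_mono power_mono) auto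
              also have "\<dots> \<le> real K * (\<Sum>x\<in>?A. (x \<bullet> v)\<^sup>2)"
                using cX[of ?A v] elim(1) by (intro mult_left_mono) auto
              also have "\<dots> = (\<Sum>x\<in>?A. real K * (x \<bullet> v)\<^sup>2)" by (simp add: sum_distrib_left)
              also have "\<dots> \<le> (\<Sum>x\<in>?A. K0 * B.Q r \<omega>)"
              proof (rule sum_mono)
                fix x assume x: "x \<in> ?A"
                then have "real K * (x \<bullet> v)\<^sup>2 \<le> real (B.num r x) * (x \<bullet> v)\<^sup>2" by (intro mult_right_mono) auto
                also have "\<dots> \<le> K0 * B.Q r \<omega>" using x by (intro dev) simp
                finally show "real K * (x \<bullet> v)\<^sup>2 \<le> K0 * B.Q r \<omega>" .
              qed
              also have "\<dots> \<le> (\<Sum>x\<in>X. K0 * B.Q r \<omega>)"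
                using X K0 B.Q_nonneg by (intro sum_mono2) auto
              also have "\<dots> \<le> K1 * B.Q r \<omega>" using B.Q_nonneg[of r \<omega>] by (simp add: K1_def algebra_simps)
              finally have "\<tau> \<le> B.Q r \<omega>" using K1 by (simp add: \<tau>_def field_simps)
              then show ?thesis using True by (simp add: H_def E_def)
            qed
          qed
          then have "measure (M r) (D r) \<le> measure (M r) ((space (M r) - E r) \<union> H)"
            using Es Hs by (intro B.finite_measure_mono) auto
          also have "\<dots> \<le> measure (M r) (space (M r) - E r) + measure (M r) H"
            using Es Hs by (intro measure_Un_le) auto
          also have "measure (M r) (space (M r) - E r) = 1 - measure (M r) (E r)" using Es by (rule B.prob_compl)
          also have "measure (M r) H \<le> integral\<^sup>L (M r) (B.Q r) / \<tau>"
            unfolding H_def using B.expectation_Q(1) B.Q_nonneg \<tau>(1)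
            by (intro integral_Markov_inequality_measure[where A = "{}"]) auto
          also have "\<dots> \<le> T / \<tau>" using B.expectation_Q(2) \<tau>(1) by (simp add: T_def divide_right_mono)
          finally show ?case using elim(2) \<tau>(2) by linarith
        qed
      qed
    qed
  qed
qed

text \<open>By pigeonhole one non-spanning subset \<open>A\<close> of \<open>X\<close> is the set of
  frequent patterns for infinitely many grids, so \<open>w\<close> can be fixed. Patterns outside
  \<open>A\<close> occupy at most \<open>card X * K\<close> sites altogether, which bounds the
  number of active rows of the score in direction \<open>w\<close>.\<close>

lemma no_roots_of_small_patterns:
  assumes span: "\<forall>\<^sub>F r in sequentially. spanning (t r ` S r)"
    and small: "\<exists>\<^sub>F r in sequentially. \<not> spanning {x \<in> X. K \<le> B.num r x}"
  shows "\<exists>\<delta>>0. \<forall>\<beta>hat :: nat \<Rightarrow> 'w \<Rightarrow> real ^ 'q.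
    \<not> with_prob_tending_to_1 M (\<lambda>r \<omega>. \<beta>hat r \<omega> \<in> ball \<beta>\<^sub>0 \<delta> \<and> B.U r \<omega> (\<beta>hat r \<omega>) = 0)"
proof -
  note X = B.finite_patterns and l = B.l and C = B.C
  have "\<exists>\<^sub>F r in sequentially. \<exists>A\<in>{A \<in> Pow X. \<not> spanning A}. {x \<in> X. K \<le> B.num r x} = A"
    using small by (rule frequently_elim1) auto
  then obtain A where A: "\<not> spanning A" and freq: "\<exists>\<^sub>F r in sequentially. {x \<in> X. K \<le> B.num r x} = A"
    using frequently_bex_finite[of "{A \<in> Pow X. \<not> spanning A}" "\<lambda>r A. {x \<in> X. K \<le> B.num r x} = A" sequentially] X by auto
  obtain w where w: "w \<noteq> 0" "\<And>x. x \<in> A \<Longrightarrow> w \<bullet> x = 0" using A by (auto simp: spanning_def)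
  have "\<exists>cw>0. \<forall>x\<in>X. w \<bullet> x \<noteq> 0 \<longrightarrow> cw \<le> \<bar>w \<bullet> x\<bar>"
  proof (rule uniform_positive_constant[OF X])
    show "\<exists>c>0. w \<bullet> x \<noteq> 0 \<longrightarrow> c \<le> \<bar>w \<bullet> x\<bar>" for x
      by (cases "w \<bullet> x = 0") (auto intro: exI[of _ 1] exI[of _ "\<bar>w \<bullet> x\<bar>"])
  qed auto
  then obtain cw where cw: "0 < cw" "\<And>x. x \<in> X \<Longrightarrow> w \<bullet> x \<noteq> 0 \<Longrightarrow> cw \<le> \<bar>w \<bullet> x\<bar>" by blast
  obtain m \<delta>1 where m: "0 < m" and \<delta>1: "0 < \<delta>1" and "\<And>x \<beta>. x \<in> X \<Longrightarrow> \<beta> \<in> ball \<beta>\<^sub>0 \<delta>1 \<Longrightarrow> m \<le> logit_sd x \<beta>"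
    using logit_sd_lower_bound[OF X, of \<beta>\<^sub>0] by blast
  then have sd: "\<And>x. x \<in> X \<Longrightarrow> m \<le> logit_sd x \<beta>\<^sub>0" by simp
  obtain Bw where Bw: "0 < Bw" "\<And>x. x \<in> X \<Longrightarrow> \<bar>w \<bullet> x\<bar> \<le> Bw"
    using finite_imp_bounded[of "(\<lambda>x. w \<bullet> x) ` X"] X by (auto simp: bounded_pos)
  define N where "N = card X * K"
  define L where "L = real N * Bw * C"
  define c0 where "c0 = l / C\<^sup>2 * (cw * m)\<^sup>2"
  have c0: "0 < c0" using l C cw m by (simp add: c0_def)
  have L0: "0 \<le> L" using Bw C by (simp add: L_def)
  \<comment> \<open>Gives \<open>L * (2 * \<eta>) \<le> sqrt c0 / 2\<close>, so twice the square is
    at most \<open>c0 / 2\<close>. The \<open>1\<close> in \<open>L + 1\<close> avoids division by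
    zero.\<close>
  define \<eta> where "\<eta> = sqrt c0 / (4 * (L + 1))"
  have \<eta>0: "0 < \<eta>" using c0 L0 by (simp add: \<eta>_def)
  have \<eta>: "2 * (L * (2 * \<eta>))\<^sup>2 < c0"
  proof -
    have "x * (2 * (sqrt c0 / (4 * x))) = sqrt c0 / 2" if "0 < x" for x using that by simp
    from this[of "L + 1"] have "(L + 1) * (2 * \<eta>) = sqrt c0 / 2" using L0 by (simp add: \<eta>_def)
    moreover have "L * (2 * \<eta>) \<le> (L + 1) * (2 * \<eta>)" using \<eta>0 by (intro mult_right_mono) auto
    ultimately have "L * (2 * \<eta>) \<le> sqrt c0 / 2" by simp
    then have "(L * (2 * \<eta>))\<^sup>2 \<le> (sqrt c0 / 2)\<^sup>2" using L0 \<eta>0 by (intro power_mono) auto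
    also have "\<dots> = c0 / 4" using c0 by (simp add: power_divide)
    finally show ?thesis using c0 by linarith
  qed
  obtain \<delta> where \<delta>: "0 < \<delta>" and cont: "\<And>x y \<beta>. x \<in> X \<Longrightarrow> y \<in> X \<Longrightarrow> \<beta> \<in> ball \<beta>\<^sub>0 \<delta> \<Longrightarrow>
    \<bar>logit_sd x \<beta> / logit_sd y \<beta> - logit_sd x \<beta>\<^sub>0 / logit_sd y \<beta>\<^sub>0\<bar> \<le> \<eta> \<and>
    \<bar>logit_sd x \<beta> / logit_sd y \<beta> * (theta y \<beta> - theta y \<beta>\<^sub>0)\<bar> \<le> \<eta>"
    using score_weights_continuous[OF X \<eta>0, of \<beta>\<^sub>0] by blast
  define gap where "gap = c0 / (2 * (L * (1 / m))\<^sup>2)"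
  show ?thesis
  proof (intro exI[of _ \<delta>] conjI allI notI)
    show "0 < \<delta>" by (rule \<delta>)
    fix \<beta>hat :: "nat \<Rightarrow> 'w \<Rightarrow> real ^ 'q"
    define E where "E r = {\<omega> \<in> space (M r). \<beta>hat r \<omega> \<in> ball \<beta>\<^sub>0 \<delta> \<and> B.U r \<omega> (\<beta>hat r \<omega>) = 0}" for r
    assume "with_prob_tending_to_1 M (\<lambda>r \<omega>. \<beta>hat r \<omega> \<in> ball \<beta>\<^sub>0 \<delta> \<and> B.U r \<omega> (\<beta>hat r \<omega>) = 0)"
    then have E1: "(\<lambda>r. measure (M r) (E r)) \<longlonglongrightarrow> 1"
      by (simp add: with_prob_tending_to_1_def E_def)
    \<comment> \<open>For \<open>L = 0\<close> the quotient \<open>gap\<close> would be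
      \<open>0\<close>. Positivity of \<open>L\<close> is only visible from a grid that has a site
      not orthogonal to \<open>w\<close>, hence the conjunction.\<close>
    have bound: "0 < L \<and> measure (M r) (E r) \<le> 1 - gap"
      if sp: "spanning (t r ` S r)" and eq: "{x \<in> X. K \<le> B.num r x} = A" and pos: "0 < measure (M r) (E r)" for r
    proof -
      have Es: "E r \<in> sets (M r)" using pos measure_notin_sets[of "E r" "M r"] by (cases "E r \<in> sets (M r)") auto
      have tX: "t r i \<in> X" if "i \<in> S r" for i using B.patterns that by blast
      obtain i0 where i0: "i0 \<in> S r" "w \<bullet> t r i0 \<noteq> 0" using sp w(1) by (auto simp: spanning_def)
      have sub: "{i \<in> S r. w \<bullet> t r i \<noteq> 0} \<subseteq> (\<Union>x\<in>X - A. {i \<in> S r. t r i = x})"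
        using tX w(2) by auto
      have num: "card {i \<in> S r. w \<bullet> t r i \<noteq> 0} \<le> N"
      proof -
        have "card {i \<in> S r. w \<bullet> t r i \<noteq> 0} \<le> card (\<Union>x\<in>X - A. {i \<in> S r. t r i = x})"
          using X B.finite_sites by (intro card_mono sub) auto
        also have "\<dots> \<le> (\<Sum>x\<in>X - A. B.num r x)"
          unfolding B.num_def using X by (intro card_UN_le) simp
        also have "\<dots> \<le> (\<Sum>x\<in>X - A. K)"
          using eq by (intro sum_mono) (auto simp: not_le)
        also have "\<dots> \<le> N" using X by (simp add: N_def card_mono)
        finally show ?thesis .
      qed
      have "{i \<in> S r. w \<bullet> t r i \<noteq> 0} \<noteq> {}" using i0 by blast
      then have "0 < card {i \<in> S r. w \<bullet> t r i \<noteq> 0}"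
        using B.finite_sites by (simp add: card_gt_0_iff)
      then have "0 < L" using num Bw C by (simp add: L_def)
      moreover have "measure (M r) (E r) \<le> 1 - gap"
        unfolding gap_def c0_def L_def
      proof (rule B.prob_root_le[where w = w and D = "ball \<beta>\<^sub>0 \<delta>" and \<eta> = \<eta>, OF _ Bw(1) num cw(1) i0(1) _ m sd])
        show "\<exists>\<beta>\<in>ball \<beta>\<^sub>0 \<delta>. B.U r \<omega> \<beta> = 0" if "\<omega> \<in> E r" for \<omega>
          using that by (auto simp: E_def)
        show "2 * (real N * Bw * C * (2 * \<eta>))\<^sup>2 < l / C\<^sup>2 * (cw * m)\<^sup>2"
          using \<eta> by (simp add: L_def c0_def)
      qed (use cont cw(2) tX i0 Bw(2) \<eta>0 Es in auto)
      ultimately show ?thesis by blast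
    qed
    have "\<forall>\<^sub>F r in sequentially. 0 < measure (M r) (E r)"
      using E1 by (intro order_tendstoD(1)) auto
    with span have ev: "\<forall>\<^sub>F r in sequentially. spanning (t r ` S r) \<and> 0 < measure (M r) (E r)"
      by (rule eventually_conj)
    have fr: "\<exists>\<^sub>F r in sequentially. 0 < L \<and> measure (M r) (E r) \<le> 1 - gap"
      using frequently_eventually_conj[OF freq ev] by (rule frequently_elim1) (use bound in blast)
    then have "0 < L" by (auto dest: frequently_ex)
    then have "0 < gap" using c0 m by (simp add: gap_def)
    then have "\<forall>\<^sub>F r in sequentially. 1 - gap < measure (M r) (E r)"
      using E1 by (intro order_tendstoD(1)) auto
    with fr show False by (auto simp: frequently_def not_le elim: eventually_mono)
  qed
qed

end

lemma (in logistic_responses) moment_le_1: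
  assumes xs: "set xs \<subseteq> S" and B: "B \<subseteq> {..<length xs}"
  shows "moment M Z xs B \<le> 1"
proof -
  have mem: "xs ! k \<in> S" if "k \<in> B" for k 
  proof -
    have "k < length xs" using that B by auto
    then show ?thesis using xs nth_mem by blast
  qed
  have le: "\<bar>\<Prod>k\<in>B. Z (xs ! k) \<omega>\<bar> \<le> 1" if "\<omega> \<in> space M" for \<omega>
    unfolding abs_prod using abs_Z_le[OF mem that] by (intro prod_le_1) auto
  have "integrable M (\<lambda>\<omega>. \<Prod>k\<in>B. Z (xs ! k) \<omega>)"
    by (rule integrable_const_bound[where B = 1])
      (use le mem in \<open>auto intro!: AE_I2 borel_measurable_prod Z_measurable\<close>)
  moreover have "AE \<omega> in M. (\<Prod>k\<in>B. Z (xs ! k) \<omega>) \<le> 1"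
    using le by (intro AE_I2) (auto simp: abs_le_iff)
  ultimately show ?thesis unfolding moment_def by (rule integral_le_const)
qed

lemma (in logistic_responses) moment_pair:
  assumes xs: "set xs \<subseteq> S" "distinct xs" and B: "B \<subseteq> {..<length xs}" "card B = 2"
  obtains i j where "i \<in> S" "j \<in> S" "i \<noteq> j" "moment M Z xs B = \<sigma> i * \<sigma> j * \<Gamma> i j"
proof -
  obtain b b' where b: "B = {b, b'}" "b \<noteq> b'" using B(2) by (auto simp: card_2_iff)
  have len: "b < length xs" "b' < length xs" using B(1) b by auto
  have mem: "xs ! b \<in> S" "xs ! b' \<in> S" using xs(1) nth_mem[OF len(1)] nth_mem[OF len(2)] by blast+
  show ?thesis
  proof (rule that[OF mem])
    show "xs ! b \<noteq> xs ! b'" using len b xs(2) by (simp add: nth_eq_iff_index_eq)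
    show "moment M Z xs B = \<sigma> (xs ! b) * \<sigma> (xs ! b') * \<Gamma> (xs ! b) (xs ! b')"
      using b by (simp add: moment_def expectation_Z_mult[OF mem])
  qed
qed

theorem lemma2p3:
  fixes m n :: "nat \<Rightarrow> nat"
    and M :: "nat \<Rightarrow> 'w measure"
    and Y :: "nat \<Rightarrow> site \<Rightarrow> 'w \<Rightarrow> real"
    and t :: "nat \<Rightarrow> site \<Rightarrow> real ^ 'q"
    and intercept :: 'q
    and \<beta>\<^sub>0 :: "real ^ 'q"
    and a \<rho> p :: real
  defines "S \<equiv> \<lambda>r. grid (m r) (n r)"
    and "N \<equiv> \<lambda>r. m r * n r"
    and "\<Gamma> \<equiv> \<lambda>r i j. correlation (M r) (Y r i) (Y r j)"
    and "Z \<equiv> \<lambda>r i \<omega>. Y r i \<omega> - theta (t r i) \<beta>\<^sub>0"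
  defines "U \<equiv> \<lambda>r \<omega>. quasi_score (S r) (t r) (\<Gamma> r) (\<lambda>i. Y r i \<omega>)"
  assumes grids: "filterlim N at_top sequentially"
    and prob: "\<And>r. prob_space (M r)"
    and response_meas: "\<And>r i. i \<in> S r \<Longrightarrow> Y r i \<in> borel_measurable (M r)"
    and response_01: "\<And>r i \<omega>. i \<in> S r \<Longrightarrow> \<omega> \<in> space (M r) \<Longrightarrow> Y r i \<omega> \<in> {0, 1}"
    and covariate_intercept: "\<And>r i. i \<in> S r \<Longrightarrow> t r i $ intercept = 1"
    and covariate_01: "\<And>r i j. i \<in> S r \<Longrightarrow> t r i $ j \<in> {0, 1}"
    and response_mean:
      "\<And>r i. i \<in> S r \<Longrightarrow> prob_space.expectation (M r) (Y r i) = theta (t r i) \<beta>\<^sub>0"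
    and a: "0 < a" "a \<le> 1" and \<rho>: "0 \<le> \<rho>" "\<rho> \<le> 1" and p: "p \<in> {1, 2}"
    and corr: "\<And>r i j. i \<in> S r \<Longrightarrow> j \<in> S r \<Longrightarrow> i \<noteq> j \<Longrightarrow> \<Gamma> r i j = a * \<rho> powr Lp_dist p i j"
    and corr_inv: "\<And>r. invertible_on (S r) (\<Gamma> r)"
    and moments:
      "\<And>k. k \<ge> 1 \<Longrightarrow> \<exists>\<alpha>. \<alpha> < real k / 2 \<and>
         (\<lambda>r. \<Sum>xs\<in>distinct_tuples (S r) k. c_moment (M r) (Z r) xs) \<in> O(\<lambda>r. real (N r) powr \<alpha>)"
    and neg_def:
      "with_prob_tending_to_1 M
         (\<lambda>r \<omega>. negative_definite ((1 / real (N r)) *\<^sub>R jacobian (U r \<omega>) (at \<beta>\<^sub>0)))"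
  shows "\<exists>\<delta>>0. \<forall>\<beta>hat :: nat \<Rightarrow> 'w \<Rightarrow> real ^ 'q.
           (\<forall>r. \<beta>hat r \<in> borel_measurable (M r)) \<and>
           with_prob_tending_to_1 M (\<lambda>r \<omega>. \<beta>hat r \<omega> \<in> ball \<beta>\<^sub>0 \<delta> \<and> U r \<omega> (\<beta>hat r \<omega>) = 0)
           \<longrightarrow> tendsto_in_prob M \<beta>hat \<beta>\<^sub>0"
proof -
  have fin: "finite (S r)" for r by (simp add: S_def grid_def)
  have cardS: "card (S r) = N r" for r by (simp add: S_def grid_def N_def)
  have resp: "logistic_responses (M r) (S r) (Y r) (t r) \<beta>\<^sub>0" for r
    unfolding logistic_responses_def logistic_responses_axioms_def
    using prob fin response_meas response_01 response_mean by blast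
  interpret L: logistic_responses "M r" "S r" "Y r" "t r" \<beta>\<^sub>0 for r by (rule resp)
  have \<Gamma>: "L.\<Gamma> r = \<Gamma> r" for r by (intro ext) (simp add: L.\<Gamma>_def \<Gamma>_def)
  have Z: "L.Z r = Z r" for r by (intro ext) (simp add: L.Z_def Z_def)
  \<comment> \<open>All 0/1 vectors rather than those that occur: the set must not depend on
    \<open>r\<close>.\<close>
  define X :: "(real ^ 'q) set" where "X = {x. \<forall>j. x $ j \<in> {0, 1}}"
  have X: "finite X"
  proof (rule finite_subset)
    show "X \<subseteq> vec_lambda ` (UNIV \<rightarrow>\<^sub>E {0, 1})"
    proof
      fix x assume "x \<in> X"
      then have "(\<lambda>j. x $ j) \<in> UNIV \<rightarrow>\<^sub>E {0, 1}" by (auto simp: X_def)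
      then have "vec_lambda (\<lambda>j. x $ j) \<in> vec_lambda ` (UNIV \<rightarrow>\<^sub>E {0, 1})" by (rule imageI)
      then show "x \<in> vec_lambda ` (UNIV \<rightarrow>\<^sub>E {0, 1})" by simp
    qed
  qed (intro finite_imageI finite_PiE, auto)
  have tX: "t r ` S r \<subseteq> X" for r using covariate_01 by (auto simp: X_def)
  \<comment> \<open>At \<open>\<rho> = 1\<close> all pairs of distinct sites have correlation
    \<open>a\<close>, and since the standard deviations stay above \<open>m'\<close>, the pair
    covariances stay above \<open>m' * m' * a\<close>.\<close>
  have "\<rho> < 1"
  proof (rule ccontr)
    assume "\<not> \<rho> < 1"
    then have \<rho>1: "\<rho> = 1" using \<rho> by simp
    obtain m' where m': "0 < m'" "\<And>x. x \<in> X \<Longrightarrow> m' \<le> logit_sd x \<beta>\<^sub>0"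
      using logit_sd_lower_bound[OF X, of \<beta>\<^sub>0] by (metis centre_in_ball)
    show False
    proof (rule moment_condition_fails[where S = S and M = M and Z = Z and \<kappa> = "m' * m' * a"])
      show "filterlim (\<lambda>r. card (S r)) at_top sequentially" using grids by (simp add: cardS)
      show "0 < m' * m' * a" using m' a by simp
      show "moment (M r) (Z r) xs B \<le> 1" if "set xs \<subseteq> S r" "B \<subseteq> {..<length xs}" for r xs B
        unfolding Z[symmetric] using that by (rule L.moment_le_1)
      show "m' * m' * a \<le> moment (M r) (Z r) xs B"
        if "set xs \<subseteq> S r" "distinct xs" "B \<subseteq> {..<length xs}" "card B = 2" for r xs B
      proof -
        note h = that
        obtain i j where ij: "i \<in> S r" "j \<in> S r" "i \<noteq> j"
          and mom: "moment (M r) (L.Z r) xs B = L.\<sigma> r i * L.\<sigma> r j * L.\<Gamma> r i j"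
          using L.moment_pair[OF h] by blast
        have "L.\<Gamma> r i j = a" using corr[OF ij] by (simp add: \<Gamma> \<rho>1)
        moreover have "m' \<le> L.\<sigma> r i" "m' \<le> L.\<sigma> r j"
          unfolding L.\<sigma>_def using m'(2) tX ij by blast+
        ultimately show ?thesis
          using mom m'(1) a by (auto simp: Z intro!: mult_mono)
      qed
      show False if "1 \<le> k" and notin: "\<And>\<alpha>. \<alpha> < real k / 2 \<Longrightarrow>
          (\<lambda>r. \<Sum>xs\<in>distinct_tuples (S r) k. c_moment (M r) (Z r) xs) \<notin> O(\<lambda>r. real (card (S r)) powr \<alpha>)" for k
        using moments[OF that(1)] notin by (auto simp: cardS)
    qed (rule fin)
  qed
  from Lp_correlation_bounds[OF a \<rho>(1) this p] obtain l C where l: "0 < l" and C: "0 < C" and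
    *: "\<forall>S A. finite S \<longrightarrow> (\<forall>i\<in>S. A i i = 1) \<longrightarrow>
     (\<forall>i\<in>S. \<forall>j\<in>S. i \<noteq> j \<longrightarrow> A i j = a * \<rho> powr Lp_dist p i j) \<longrightarrow>
     coercive_on S l A \<and> (\<forall>i\<in>S. (\<Sum>j\<in>S. \<bar>A i j\<bar>) \<le> C) \<and>
     (\<forall>B. inverse_on S A B \<longrightarrow> (\<forall>k\<in>S. (\<Sum>j\<in>S. \<bar>B j k\<bar>) \<le> C))"
    by (elim exE conjE) (rule that)
  have \<Gamma>_bounds: "coercive_on (S r) l (\<Gamma> r) \<and> (\<forall>i\<in>S r. (\<Sum>j\<in>S r. \<bar>\<Gamma> r i j\<bar>) \<le> C) \<and>
     (\<forall>B. inverse_on (S r) (\<Gamma> r) B \<longrightarrow> (\<forall>k\<in>S r. (\<Sum>j\<in>S r. \<bar>B j k\<bar>) \<le> C))" for r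
  proof -
    have "\<forall>i\<in>S r. \<Gamma> r i i = 1" using L.\<Gamma>_diag unfolding \<Gamma> by blast
    moreover have "\<forall>i\<in>S r. \<forall>j\<in>S r. i \<noteq> j \<longrightarrow> \<Gamma> r i j = a * \<rho> powr Lp_dist p i j" using corr by blast
    ultimately show ?thesis
      by (rule spec[OF spec[OF *, of "S r"], of "\<Gamma> r", THEN mp, OF fin, THEN mp, THEN mp])
  qed
  interpret response_sequence M S Y t \<beta>\<^sub>0 l C X
  proof (unfold response_sequence_def bounded_correlation_def bounded_correlation_axioms_def \<Gamma>, intro allI conjI impI resp)
  qed (use l C \<Gamma>_bounds corr_inv X tX in blast)+
  have U: "B.U r = U r" for r
    by (intro ext) (simp add: B.U_def U_def \<Gamma>)
  \<comment> \<open>The covariates are deterministic, so one outcome with a negative definite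
    Jacobian suffices; positive probability provides it.\<close>
  have span: "\<forall>\<^sub>F r in sequentially. spanning (t r ` S r)"
  proof -
    have "\<forall>\<^sub>F r in sequentially. 0 < measure (M r) {\<omega> \<in> space (M r). negative_definite ((1 / real (N r)) *\<^sub>R jacobian (U r \<omega>) (at \<beta>\<^sub>0))}"
      using neg_def unfolding with_prob_tending_to_1_def by (intro order_tendstoD(1)) auto
    then show ?thesis
    proof eventually_elim
      case (elim r)
      then have "{\<omega> \<in> space (M r). negative_definite ((1 / real (N r)) *\<^sub>R jacobian (U r \<omega>) (at \<beta>\<^sub>0))} \<noteq> {}"
        by (metis measure_empty less_irrefl)
      then obtain \<omega> where "negative_definite ((1 / real (N r)) *\<^sub>R jacobian (U r \<omega>) (at \<beta>\<^sub>0))" by blast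
      from negative_definite_jacobian_spans[OF fin corr_inv this[unfolded U_def]]
      show ?case by (auto simp: spanning_def)
    qed
  qed
  show ?thesis
  proof (cases "\<forall>K. \<forall>\<^sub>F r in sequentially. spanning {x \<in> X. K \<le> B.num r x}")
    case True
    then show ?thesis using consistent_of_large_patterns unfolding U by blast
  next
    case False
    then obtain K where "\<exists>\<^sub>F r in sequentially. \<not> spanning {x \<in> X. K \<le> B.num r x}"
      by (auto simp: not_eventually)
    from no_roots_of_small_patterns[OF span this] show ?thesis unfolding U by blast
  qed
qed

end
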